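(* Let $tr_{\mathrm{R}}$ and $tr'_{\mathrm{R}}$ be as described in the context. Then: (1) For every sequent $\Gamma\to C$ of $\mathrm{L}^{\mathrm{R}}$: $\mathrm{L}^{\mathrm{R}}\vdash\Gamma\to C$ if and only if $\mathrm{HL}\vdash tr_{\mathrm{R}}(\Gamma\to C)$. (2) If $\mathrm{HL}\vdash G\to T$ is a derivable graph sequent all of whose types belong to $tr_{\mathrm{R}}(Tp(\mathrm{L}^{\mathrm{R}}))$, then there is an $\mathrm{L}^{\mathrm{R}}$-sequent $\Gamma\to C$ such that $G\to T\in tr'_{\mathrm{R}}(\Gamma\to C)$ and $\mathrm{L}^{\mathrm{R}}\vdash\Gamma\to C$.
   Context: $\mathrm{L}^{\mathrm{R}}$: types built from primitive types by $\backslash,/,\cdot$ and unary ${}^{\mathrm{R}}$; sequents $\Gamma\to A$ with $\Gamma$ nonempty; $(A_1,\dots,A_n)^{\mathrm{R}}=A_n^{\mathrm{R}},\dots,A_1^{\mathrm{R}}$. Axioms $p\to p$; rules of $\mathrm{L}$ ($\Pi,\Psi$ nonempty): from $\Pi\to A$, $\Gamma,B,\Delta\to C$ infer $\Gamma,\Pi,A\backslash B,\Delta\to C$; from $A,\Pi\to B$ infer $\Pi\to A\backslash B$; from $\Gamma,A,B,\Delta\to C$ infer $\Gamma,A\cdot B,\Delta\to C$; from $\Pi\to A$, $\Gamma,B,\Delta\to C$ infer $\Gamma,B/A,\Pi,\Delta\to C$; from $\Pi,A\to B$ infer $\Pi\to B/A$; from $\Pi\to A$, $\Psi\to B$ infer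 $\Pi,\Psi\to A\cdot B$; plus: from $\Gamma\to C$ infer $\Gamma^{\mathrm{R}}\to C^{\mathrm{R}}$; from $\Gamma,A^{\mathrm{RR}},\Delta\to C$ infer $\Gamma,A,\Delta\to C$; from $\Pi\to C^{\mathrm{RR}}$ infer $\Pi\to C$; cut: from $\Pi\to A$ and $\Gamma,A,\Delta\to B$ infer $\Gamma,\Pi,\Delta\to B$. Hypergraphs: given labels with arities, a graph is $G=\langle V,E,att,lab,ext\rangle$, $att:E\to V^\circledast$ (distinct nodes), $type(lab(e))=|att(e)|$, $ext\in V^\circledast$; $type(G)=|ext|$; isomorphic graphs identified. Handle $a^\bullet$: one edge labeled $a$ attached to $v_1\dots v_n$, all external. String graph $w^\bullet$ of $w=a_1\dots a_n$: nodes $v_0..v_n$, edges $e_i$, $att(e_i)=v_{i-1}v_i$, $lab(e_i)=a_i$, $ext=v_0v_n$. A generalized string graph $(a_1^{\delta_1}\dots a_n^{\delta_n})^\bullet$ ($\delta_i\in\{0,1\}$) is the same except $att(e_i)=v_{i-1}v_i$ if $\delta_i=0$ and $att(e_i)=v_iv_{i-1}$ if $\delta_i=1$. Replacement $G[e/H]$: remove $e$, insert a disjoint copy of $H$, fuse $i$-th external node of $H$ with $i$-th attachment node of $e$; relabeling $G[e:=a]$. $\mathrm{HL}$: primitive types with arities (infinitely many of each arity); symbol $\$$ of any arity. Types: primitives; $N\div D$ ($D$ has exactly one $\$$-edge $d_0$, others labeled by types, $type(N)=type(D)$, $type(N\div D)=type_D(d_0)$); $\times(M)$ ($M$ type-labeled,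 $type(\times(M))=type(M)$). Graph sequent $H\to A$, $type(H)=type(A)$. Axioms $p^\bullet\to p$. Rules: $(\div\to)$: for $N\div D$, $E_D=\{d_0,\dots,d_k\}$, $e\in E_H$ labeled $N$: from $H\to A$, $H_i\to lab(d_i)$ infer $H[e/D][d_0:=N\div D][d_1/H_1,\dots,d_k/H_k]\to A$; $(\to\div)$: from $D[d_0/F]\to N$ infer $F\to N\div D$; $(\times\to)$: $e\in E_G$ labeled $\times(F)$, from $G[e/F]\to A$ infer $G\to A$; $(\to\times)$: $E_M=\{m_1,\dots,m_l\}$, from $H_i\to lab(m_i)$ infer $M[m_1/H_1,\dots,m_l/H_l]\to\times(M)$. Translations: $tr_{\mathrm{R}}(p)=p$ (primitive of type 2), $tr_{\mathrm{R}}(A/B)=tr_{\mathrm{R}}(A)\div(\$\,tr_{\mathrm{R}}(B))^\bullet$, $tr_{\mathrm{R}}(B\backslash A)=tr_{\mathrm{R}}(A)\div(tr_{\mathrm{R}}(B)\,\$)^\bullet$, $tr_{\mathrm{R}}(A\cdot B)=\times((tr_{\mathrm{R}}(A)\,tr_{\mathrm{R}}(B))^\bullet)$, $tr_{\mathrm{R}}(A^{\mathrm{R}})=\times(M_A)$ with $M_A$ having nodes $v_1,v_2$, $ext=v_1v_2$, one edge labeled $tr_{\mathrm{R}}(A)$ with $att=v_2v_1$; $tr_{\mathrm{R}}(A_1,\dots,A_n\to A)=(tr_{\mathrm{R}}(A_1)\dots tr_{\mathrm{R}}(A_n))^\bullet\to tr_{\mathrm{R}}(A)$. Write $[A]^0=A$,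 $[A]^1=A^{\mathrm{R}}$. For a sequent $Seq=A_1,\dots,A_n\to C$, $tr'_{\mathrm{R}}(Seq)$ is the set of all graph sequents $(tr_{\mathrm{R}}(B_1)^{\delta_1}\dots tr_{\mathrm{R}}(B_n)^{\delta_n})^\bullet\to tr_{\mathrm{R}}(C)$ over all choices of $\delta_i\in\{0,1\}$ and types $B_i$ with $A_i=[B_i]^{\delta_i}$. *)

theory Defs
  imports Main "HOL-Library.Nat_Bijection"
begin

text \<open>Types: LUnder B A is B\A, LOver A B is A/B, LRev A is A^R.\<close>
datatype 'p ltp = LPrim 'p | LUnder "'p ltp" "'p ltp" | LOver "'p ltp" "'p ltp"
  | LProd "'p ltp" "'p ltp" | LRev "'p ltp"

inductive LR_der :: "'p ltp list \<Rightarrow> 'p ltp \<Rightarrow> bool" where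
  ax: "LR_der [LPrim p] (LPrim p)"
| underL: "\<lbrakk>Pi \<noteq> []; LR_der Pi A; LR_der (Gam @ [B] @ Del) C\<rbrakk>
           \<Longrightarrow> LR_der (Gam @ Pi @ [LUnder A B] @ Del) C"
| underR: "\<lbrakk>Pi \<noteq> []; LR_der (A # Pi) B\<rbrakk> \<Longrightarrow> LR_der Pi (LUnder A B)"
| prodL: "LR_der (Gam @ [A, B] @ Del) C \<Longrightarrow> LR_der (Gam @ [LProd A B] @ Del) C"
| overL: "\<lbrakk>Pi \<noteq> []; LR_der Pi A; LR_der (Gam @ [B] @ Del) C\<rbrakk>
           \<Longrightarrow> LR_der (Gam @ [LOver B A] @ Pi @ Del) C"
| overR: "\<lbrakk>Pi \<noteq> []; LR_der (Pi @ [A]) B\<rbrakk> \<Longrightarrow> LR_der Pi (LOver B A)"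
| prodR: "\<lbrakk>Pi \<noteq> []; Psi \<noteq> []; LR_der Pi A; LR_der Psi B\<rbrakk>
           \<Longrightarrow> LR_der (Pi @ Psi) (LProd A B)"
| revR: "LR_der Gam C \<Longrightarrow> LR_der (rev (map LRev Gam)) (LRev C)"
| rrL: "LR_der (Gam @ [LRev (LRev A)] @ Del) C \<Longrightarrow> LR_der (Gam @ [A] @ Del) C"
| rrR: "LR_der Pi (LRev (LRev C)) \<Longrightarrow> LR_der Pi C"
| cut: "\<lbrakk>LR_der Pi A; LR_der (Gam @ [A] @ Del) B\<rbrakk> \<Longrightarrow> LR_der (Gam @ Pi @ Del) B"

text \<open>A hypergraph: a set of nodes, a list of edges (edge i is the i-th list entry,
  given by its label and its attachment string), and the string of external nodes.
  Isomorphic graphs are identified via the relation graph_iso below.\<close>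
datatype 'l hgraph = Gr (gV: "nat set") (gE: "('l \<times> nat list) list") (gext: "nat list")

definition lab :: "'l hgraph \<Rightarrow> nat \<Rightarrow> 'l" where "lab G i = fst (gE G ! i)"
definition att :: "'l hgraph \<Rightarrow> nat \<Rightarrow> nat list" where "att G i = snd (gE G ! i)"

definition wf_hgraph :: "('l \<Rightarrow> nat \<Rightarrow> bool) \<Rightarrow> 'l hgraph \<Rightarrow> bool" where
  "wf_hgraph ok G \<longleftrightarrow> finite (gV G) \<and> distinct (gext G) \<and> set (gext G) \<subseteq> gV G \<and>
     (\<forall>x \<in> set (gE G). distinct (snd x) \<and> set (snd x) \<subseteq> gV G \<and> ok (fst x) (length (snd x)))"

lemma wf_hgraph_mono[mono]:
  "(\<And>l k. P l k \<longrightarrow> Q l k) \<Longrightarrow> wf_hgraph P G \<longrightarrow> wf_hgraph Q G"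
  unfolding wf_hgraph_def by blast

definition graph_iso :: "('l \<Rightarrow> 'm \<Rightarrow> bool) \<Rightarrow> 'l hgraph \<Rightarrow> 'm hgraph \<Rightarrow> bool" where
  "graph_iso R G H \<longleftrightarrow> (\<exists>f \<sigma>. bij_betw f (gV G) (gV H) \<and> length (gE H) = length (gE G) \<and>
     bij_betw \<sigma> {..<length (gE G)} {..<length (gE H)} \<and>
     (\<forall>i < length (gE G). R (lab G i) (lab H (\<sigma> i)) \<and> att H (\<sigma> i) = map f (att G i)) \<and>
     gext H = map f (gext G))"

lemma graph_iso_mono[mono]:
  "(\<And>x y. R x y \<longrightarrow> S x y) \<Longrightarrow> graph_iso R G H \<longrightarrow> graph_iso S G H"
  unfolding graph_iso_def by blast

definition handle :: "'l \<Rightarrow> nat \<Rightarrow> 'l hgraph" where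
  "handle l k = Gr {0..<k} [(l, [0..<k])] [0..<k]"

definition genstr :: "('l \<times> bool) list \<Rightarrow> 'l hgraph" where
  "genstr xs = Gr {0..length xs}
     (map (\<lambda>i. (fst (xs ! i), if snd (xs ! i) then [Suc i, i] else [i, Suc i])) [0..<length xs])
     [0, length xs]"

text \<open>Simultaneous replacement of every edge j of G by the graph F j (fusing the k-th external
  node of F j with the k-th attachment node of j); fresh node names via prod_encode.\<close>
definition hsubst :: "'l hgraph \<Rightarrow> (nat \<Rightarrow> 'm hgraph) \<Rightarrow> 'm hgraph" where
  "hsubst G F = (let n = length (gE G);
     ren = (\<lambda>j u. case map_of (zip (gext (F j)) (att G j)) u of
                     Some v \<Rightarrow> prod_encode (0, v) | None \<Rightarrow> prod_encode (Suc j, u))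
   in Gr ((\<lambda>v. prod_encode (0, v)) ` gV G \<union> (\<Union>j < n. ren j ` gV (F j)))
         (concat (map (\<lambda>j. map (\<lambda>x. (fst x, map (ren j) (snd x))) (gE (F j))) [0..<n]))
         (map (\<lambda>v. prod_encode (0, v)) (gext G)))"

definition repl :: "'l hgraph \<Rightarrow> nat \<Rightarrow> 'l hgraph \<Rightarrow> 'l hgraph" where
  "repl G e H = hsubst G (\<lambda>j. if j = e then H else handle (lab G j) (length (att G j)))"

text \<open>Types: primitive types come with an arity; None labels the symbol \$.\<close>
datatype 'p htp = HPrim 'p nat | HDiv "'p htp" "'p htp option hgraph" | HTimes "'p htp hgraph"

definition tarity :: "'p htp \<Rightarrow> nat" where
  "tarity t = (case t of HPrim p n \<Rightarrow> n
     | HDiv N D \<Rightarrow> (case find (\<lambda>x. fst x = None) (gE D) of Some x \<Rightarrow> length (snd x) | None \<Rightarrow> 0)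
     | HTimes M \<Rightarrow> length (gext M))"

inductive wf_tp :: "'p htp \<Rightarrow> bool" where
  "wf_tp (HPrim p n)"
| "\<lbrakk>wf_tp N;
    wf_hgraph (\<lambda>l k. l = None \<or> (\<exists>t. l = Some t \<and> wf_tp t \<and> tarity t = k)) D;
    length (filter (\<lambda>x. fst x = None) (gE D)) = 1;
    tarity N = length (gext D)\<rbrakk> \<Longrightarrow> wf_tp (HDiv N D)"
| "wf_hgraph (\<lambda>t k. wf_tp t \<and> tarity t = k) M \<Longrightarrow> wf_tp (HTimes M)"

definition hseq_wf :: "'p htp hgraph \<Rightarrow> 'p htp \<Rightarrow> bool" where
  "hseq_wf H A \<longleftrightarrow> wf_tp A \<and> wf_hgraph (\<lambda>t k. wf_tp t \<and> tarity t = k) H \<and>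
     length (gext H) = tarity A"

inductive tp_eq :: "'p htp \<Rightarrow> 'p htp \<Rightarrow> bool" where
  "tp_eq (HPrim p n) (HPrim p n)"
| "\<lbrakk>tp_eq N N';
    graph_iso (\<lambda>l l'. (l = None \<and> l' = None) \<or> (\<exists>t t'. l = Some t \<and> l' = Some t' \<and> tp_eq t t')) D D'\<rbrakk>
   \<Longrightarrow> tp_eq (HDiv N D) (HDiv N' D')"
| "graph_iso tp_eq M M' \<Longrightarrow> tp_eq (HTimes M) (HTimes M')"

inductive HL_der :: "'p htp hgraph \<Rightarrow> 'p htp \<Rightarrow> bool" where
  ax: "HL_der (handle (HPrim p n) n) (HPrim p n)"
| iso: "\<lbrakk>HL_der H A; graph_iso tp_eq H H'; tp_eq A A'\<rbrakk> \<Longrightarrow> HL_der H' A'"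
| divL: "\<lbrakk>HL_der H A; e < length (gE H); lab H e = N;
          d0 < length (gE D); lab D d0 = None;
          \<forall>j < length (gE D). j \<noteq> d0 \<longrightarrow> (\<exists>t. lab D j = Some t \<and> HL_der (Hs j) t);
          G = repl H e (hsubst D (\<lambda>j. if j = d0 then handle (HDiv N D) (length (att D d0)) else Hs j));
          hseq_wf G A\<rbrakk> \<Longrightarrow> HL_der G A"
| divR: "\<lbrakk>d0 < length (gE D); lab D d0 = None;
          HL_der (hsubst D (\<lambda>j. if j = d0 then F else handle (the (lab D j)) (length (att D j)))) N;
          hseq_wf F (HDiv N D)\<rbrakk> \<Longrightarrow> HL_der F (HDiv N D)"
| timesL: "\<lbrakk>e < length (gE G); lab G e = HTimes F; HL_der (repl G e F) A; hseq_wf G A\<rbrakk>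
          \<Longrightarrow> HL_der G A"
| timesR: "\<lbrakk>\<forall>i < length (gE M). HL_der (Hs i) (lab M i); hseq_wf (hsubst M Hs) (HTimes M)\<rbrakk>
          \<Longrightarrow> HL_der (hsubst M Hs) (HTimes M)"

primrec trR :: "'p ltp \<Rightarrow> 'p htp" where
  "trR (LPrim p) = HPrim p 2"
| "trR (LOver A B) = HDiv (trR A) (genstr [(None, False), (Some (trR B), False)])"
| "trR (LUnder B A) = HDiv (trR A) (genstr [(Some (trR B), False), (None, False)])"
| "trR (LProd A B) = HTimes (genstr [(trR A, False), (trR B, False)])"
| "trR (LRev A) = HTimes (Gr {0, 1} [(trR A, [1, 0])] [0, 1])"

definition trR_seq :: "'p ltp list \<Rightarrow> 'p ltp \<Rightarrow> 'p htp hgraph \<times> 'p htp" where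
  "trR_seq Gam C = (genstr (map (\<lambda>A. (trR A, False)) Gam), trR C)"

definition brk :: "'p ltp \<Rightarrow> bool \<Rightarrow> 'p ltp" where
  "brk B d = (if d then LRev B else B)"

definition trR' :: "'p ltp list \<Rightarrow> 'p ltp \<Rightarrow> ('p htp hgraph \<times> 'p htp) set" where
  "trR' Gam C = {(genstr (zip (map trR Bs) ds), trR C) | Bs ds.
      length Bs = length Gam \<and> length ds = length Gam \<and>
      (\<forall>i < length Gam. Gam ! i = brk (Bs ! i) (ds ! i))}"

definition seq_mem :: "'p htp hgraph \<times> 'p htp \<Rightarrow> ('p htp hgraph \<times> 'p htp) set \<Rightarrow> bool" where
  "seq_mem S X \<longleftrightarrow> (\<exists>S' \<in> X. graph_iso tp_eq (fst S') (fst S) \<and> tp_eq (snd S') (snd S))"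

end

theory Submission
  imports Defs "HOL-Combinatorics.List_Permutation"
begin

text \<open>The translation of a sequent is a path, and a generalized string graph is a path whose edges
  may be reversed, so it is determined by a list of signed types, reversal of an edge being the
  counterpart of the operation \<open>LRev\<close>. Replacing an edge of a path by a path pastes the
  lists, after flipping the inserted one if the edge is reversed; conversely, if a premise of an HL
  rule is a path then so is its conclusion, because the fresh node of a replaced edge has degree
  two. By induction on HL derivations every derivable sequent over translated types is therefore a
  path, and the signed list read with \<open>LRev\<close> for the negative sign is derivable in
  L with reversal.

  In the other direction the only obstacle is cut. Instead of eliminating it, one interprets a type
  by a set of signed lists closed under the Galois connection of HL-derivable contexts. Both cut
  and the cancellation of a double \<open>LRev\<close> are trivially sound in this model, and the
  one-letter list of a type \<open>A\<close> belongs to the interpretation of \<open>A\<close>, all members of which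
  HL-derive \<open>A\<close>.\<close>

section \<open>Paths with signed labels\<close>

text \<open>HL has no cut rule: its premises contain only parts of the types of the conclusion, so
  the property of being a translation passes upwards through a derivation. The rule
  \<open>iso\<close>, however, may change labels to isomorphic types and permute edges, so the
  invariant is isomorphism to a translation, and edges are compared as multisets. The target
  calculus does have cut, so a left division step there is an application followed by a cut.

  In the other direction, cut and the two double reversal rules have premises with types absent from
  the conclusion, which cannot be imitated rule by rule. The model follows Okada's proof of cut
  elimination by phase semantics. A context consists of \<open>Gam\<close>, \<open>Del\<close>,
  \<open>C\<close> and also a sign \<open>d\<close>, since it may receive its argument reversed;
  without the sign the closed sets could not be handled under \<open>flip\<close>.\<close>

definition flip :: "('a \<times> bool) list \<Rightarrow> ('a \<times> bool) list" where
  "flip xs = rev (map (apsnd Not) xs)"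

definition orient :: "bool \<Rightarrow> ('a \<times> bool) list \<Rightarrow> ('a \<times> bool) list" where
  "orient d xs = (if d then flip xs else xs)"

lemma orient_simps [simp]: "orient False xs = xs" "orient True xs = flip xs"
  by (simp_all add: orient_def)

lemma flip_simps [simp]:
  "flip [] = []" "flip (x # xs) = flip xs @ [apsnd Not x]" "flip (xs @ ys) = flip ys @ flip xs"
  "flip (flip xs) = xs" "length (flip xs) = length xs" "flip xs = [] \<longleftrightarrow> xs = []"
  by (simp_all add: flip_def rev_map comp_def apsnd_def map_prod_def split_beta)

lemma map_flip: "map (apfst f) (flip xs) = flip (map (apfst f) xs)"
  by (simp add: flip_def rev_map comp_def)

lemma map_orient: "map (apfst f) (orient d xs) = orient d (map (apfst f) xs)"
  by (simp add: orient_def map_flip)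

lemma fst_set_orient [simp]: "fst ` set (orient d xs) = fst ` set xs"
  by (force simp: orient_def flip_def image_image)

lemma length_orient [simp]: "length (orient d xs) = length xs"
  by (simp add: orient_def)

lemma orient_eq_Nil [simp]: "orient d xs = [] \<longleftrightarrow> xs = []"
  by (simp add: orient_def)

lemma orient_single [simp]: "orient d [(A, False)] = [(A, d)]"
  by (simp add: orient_def)

definition edge :: "nat \<Rightarrow> 'l \<times> bool \<Rightarrow> nat \<Rightarrow> 'l \<times> nat list" where
  "edge u x v = (fst x, if snd x then [v, u] else [u, v])"

fun path_edges :: "nat list \<Rightarrow> ('l \<times> bool) list \<Rightarrow> ('l \<times> nat list) list" where
  "path_edges (u # v # vs) (x # xs) = edge u x v # path_edges (v # vs) xs"
| "path_edges _ _ = []"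

lemma path_edges_Nil [simp]: "path_edges vs [] = []" "path_edges [u] xs = []"
  by (cases vs rule: list.exhaust[case_product list.exhaust]; simp)
     (cases xs; simp)

lemma set_edge: "set (snd (edge u x v)) = {u, v}"
  by (auto simp: edge_def)

lemma edge_map: "apsnd (map f) (edge u x v) = edge (f u) x (f v)"
  by (simp add: edge_def)

lemma edge_reverse: "edge v (apsnd Not x) u = edge u x v"
  by (simp add: edge_def)

text \<open>With \<open>u\<close> and \<open>v\<close> different, the place of \<open>u\<close> in
  the attachment string shows the sign; a loop would fit both signs. This makes signs recoverable
  from the edges of a path.\<close>

lemma edge_eq_left: "u \<noteq> v \<Longrightarrow> edge u x v = edge u y v' \<Longrightarrow> x = y \<and> v = v'"
  by (auto simp: edge_def prod_eq_iff split: if_splits)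

lemma edge_eq_right: "u \<noteq> v \<Longrightarrow> edge u x v = edge u' y v \<Longrightarrow> x = y \<and> u = u'"
  by (auto simp: edge_def prod_eq_iff split: if_splits)

lemma length_path_edges [simp]: "length vs = Suc (length xs) \<Longrightarrow> length (path_edges vs xs) = length xs"
  by (induction vs xs rule: path_edges.induct) auto

lemma path_edges_eq_Nil [simp]:
  "length vs = Suc (length xs) \<Longrightarrow> path_edges vs xs = [] \<longleftrightarrow> xs = []"
  using length_path_edges by force

lemma path_edges_append:
  "length us = length xs \<Longrightarrow>
   path_edges (us @ w # vs) (xs @ ys) = path_edges (us @ [w]) xs @ path_edges (w # vs) ys"
proof (induction us xs rule: list_induct2)
  case (Cons u us x xs)
  then show ?case by (cases us) auto
qed simp

lemma path_edges_nodes: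
  "e \<in> set (path_edges vs xs) \<Longrightarrow> set (snd e) \<subseteq> set vs"
  by (induction vs xs rule: path_edges.induct) (auto simp: edge_def split: if_splits)

lemma path_edges_distinct:
  "e \<in> set (path_edges vs xs) \<Longrightarrow> distinct vs \<Longrightarrow> distinct (snd e) \<and> length (snd e) = 2"
  by (induction vs xs rule: path_edges.induct) (auto simp: edge_def split: if_splits)

lemma path_edges_labels:
  "length vs = Suc (length xs) \<Longrightarrow> map fst (path_edges vs xs) = map fst xs"
  by (induction vs xs rule: path_edges.induct) (auto simp: edge_def)

lemma path_edges_map: "map (apsnd (map f)) (path_edges vs xs) = path_edges (map f vs) xs"
  by (induction vs xs rule: path_edges.induct) (auto simp: edge_map)

text \<open>Swapping the end points of an edge and negating its sign leaves the edge unchanged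
  (\<open>edge_reverse\<close>), so a walk backwards meets the same edges.\<close>

lemma path_edges_rev:
  "length vs = Suc (length xs) \<Longrightarrow> path_edges (rev vs) (flip xs) = rev (path_edges vs xs)"
proof (induction vs xs rule: path_edges.induct)
  case (1 u v vs x xs)
  then have "path_edges (rev (u # v # vs)) (flip (x # xs))
    = path_edges (rev vs @ [v]) (flip xs) @ path_edges [v, u] [apsnd Not x]"
    by (simp add: path_edges_append)
  then show ?case using 1 by (simp add: edge_reverse)
qed auto

lemma path_edges_cong:
  assumes "list_all2 (\<lambda>(l, a) (l', a'). R l l' \<and> a' = map f a) (path_edges vs xs) es"
    "length vs = Suc (length xs)"
  shows "\<exists>ys. es = path_edges (map f vs) ys \<and> list_all2 (rel_prod R (=)) xs ys"
  using assms
proof (induction vs xs arbitrary: es rule: path_edges.induct)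
  case (1 u v vs x xs)
  from "1.prems"(1) obtain l es' where es: "es = (l, map f (snd (edge u x v))) # es'"
    "R (fst x) l"
    "list_all2 (\<lambda>(l, a) (l', a'). R l l' \<and> a' = map f a) (path_edges (v # vs) xs) es'"
    by (auto simp: list_all2_Cons1 edge_def)
  from "1.IH"[OF es(3)] "1.prems"(2) obtain ys where
    ys: "es' = path_edges (map f (v # vs)) ys" "list_all2 (rel_prod R (=)) xs ys"
    by auto
  show ?case
    by (intro exI[of _ "(l, snd x) # ys"])
      (use es ys in \<open>cases x; auto simp: edge_def\<close>)
qed auto

lemma path_edges_congI:
  assumes "list_all2 (rel_prod R (=)) xs ys" "length vs = Suc (length xs)"
  shows "list_all2 (\<lambda>(l, a) (l', a'). R l l' \<and> a' = map f a)
    (path_edges vs xs) (path_edges (map f vs) ys)"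
  using assms
proof (induction xs ys arbitrary: vs rule: list_all2_induct)
  case (Cons x xs y ys)
  from Cons.prems obtain u v vs' where "vs = u # v # vs'"
    by (auto simp: length_Suc_conv)
  with Cons show ?case
    using Cons.IH[of "v # vs'"] by (auto simp: edge_def rel_prod_sel)
qed auto

text \<open>Node lists are distinct, so the start node lies on no edge after the first one. Hence
  the first edges of both walks coincide, and with them their signs and second nodes; peeling them
  off restores the situation.\<close>

lemma path_edges_unique:
  assumes "mset (path_edges vs xs) = mset (path_edges ws ys)"
    "distinct vs" "distinct ws" "hd vs = hd ws"
    "length vs = Suc (length xs)" "length ws = Suc (length ys)"
  shows "xs = ys"
  using assms
proof (induction vs xs arbitrary: ws ys rule: path_edges.induct)
  case (1 u v vs x xs)
  have "length (path_edges (u # v # vs) (x # xs)) = length (path_edges ws ys)"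
    using "1.prems"(1) by (rule mset_eq_length)
  then have "length ys = length (x # xs)"
    using "1.prems"(5,6) by (simp only: length_path_edges)
  then obtain v' ws' y ys' where ws: "ws = u # v' # ws'" "ys = y # ys'"
    using "1.prems" by (auto simp: length_Suc_conv)
  have "edge u x v \<in> set (path_edges ws ys)"
    using "1.prems"(1) by (metis list.set_intros(1) path_edges.simps(1) set_mset_mset)
  moreover have "edge u x v \<notin> set (path_edges (v' # ws') ys')"
    using path_edges_nodes[of "edge u x v" "v' # ws'" ys'] "1.prems"(3) ws
    by (auto simp: set_edge)
  ultimately have "edge u x v = edge u y v'"
    using ws by auto
  then have eq: "x = y" "v = v'"
    using edge_eq_left[of u v x y v'] "1.prems"(2) by auto
  have "xs = ys'"
    by (rule "1.IH"[of "v' # ws'"]) (use "1.prems" ws eq in auto)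
  then show ?case using ws eq by simp
qed auto

text \<open>The order of \<open>gE\<close> carries no information, so edges are compared as a
  multiset. The external nodes fix start and end of the walk and thereby the direction relative to
  which signs are read.\<close>

definition path_graph :: "'l hgraph \<Rightarrow> nat list \<Rightarrow> ('l \<times> bool) list \<Rightarrow> bool" where
  "path_graph G vs xs \<longleftrightarrow> distinct vs \<and> set vs = gV G \<and> length vs = Suc (length xs) \<and>
     gext G = [hd vs, last vs] \<and> mset (gE G) = mset (path_edges vs xs)"

definition string_graph :: "'l hgraph \<Rightarrow> ('l \<times> bool) list \<Rightarrow> bool" where
  "string_graph G xs \<longleftrightarrow> (\<exists>vs. path_graph G vs xs)"

lemma path_graph_edges: "path_graph G vs xs \<Longrightarrow> set (gE G) = set (path_edges vs xs)"
  by (auto simp: path_graph_def dest: mset_eq_setD)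

lemma path_graph_labels:
  assumes "path_graph G vs xs"
  shows "fst ` set (gE G) = fst ` set xs"
proof -
  have "fst ` set (gE G) = set (map fst (path_edges vs xs))"
    by (simp add: path_graph_edges[OF assms])
  also have "\<dots> = set (map fst xs)"
    using assms by (simp add: path_graph_def path_edges_labels del: set_map)
  finally show ?thesis by simp
qed

lemma path_graph_wf:
  assumes "path_graph G vs xs" "xs \<noteq> []" "\<And>l. l \<in> fst ` set xs \<Longrightarrow> ok l 2"
  shows "wf_hgraph ok G"
proof -
  have vs: "distinct vs" "set vs = gV G" "length vs = Suc (length xs)" "gext G = [hd vs, last vs]"
    using assms(1) by (auto simp: path_graph_def)
  \<comment> \<open>A walk with at least one edge has two different ends, as
    \<open>wf_hgraph\<close> demands of external nodes.\<close>
  obtain u v vs' where "vs = u # v # vs'"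
    using vs(3) assms(2) by (cases xs) (auto simp: length_Suc_conv)
  then have "distinct (gext G)" "set (gext G) \<subseteq> gV G"
    using vs(1,4) by (auto simp: vs(2)[symmetric])
  moreover have "finite (gV G)" using vs(2) by (metis List.finite_set)
  moreover have "distinct (snd e) \<and> set (snd e) \<subseteq> gV G \<and> ok (fst e) (length (snd e))"
    if "e \<in> set (gE G)" for e
  proof -
    have "e \<in> set (path_edges vs xs)" using that path_graph_edges[OF assms(1)] by simp
    moreover have "fst e \<in> fst ` set xs" using that path_graph_labels[OF assms(1)] by blast
    ultimately show ?thesis
      using path_edges_distinct[of e vs xs] path_edges_nodes[of e vs xs] vs assms(3) by simp
  qed
  ultimately show ?thesis by (simp add: wf_hgraph_def)
qed

lemma string_graph_labels: "string_graph G xs \<Longrightarrow> fst ` set (gE G) = fst ` set xs"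
  unfolding string_graph_def using path_graph_labels by blast

lemma string_graph_wf:
  "string_graph G xs \<Longrightarrow> xs \<noteq> [] \<Longrightarrow> (\<And>l. l \<in> fst ` set xs \<Longrightarrow> ok l 2) \<Longrightarrow> wf_hgraph ok G"
  unfolding string_graph_def using path_graph_wf by metis

lemma string_graph_ext: "string_graph G xs \<Longrightarrow> length (gext G) = 2"
  by (auto simp: string_graph_def path_graph_def)

text \<open>The offset \<open>k\<close> is there for the induction: after the first edge the
  remaining string starts at node \<open>Suc k\<close>.\<close>

lemma path_edges_upt:
  "path_edges [k..<Suc (k + length xs)] xs
    = map (\<lambda>i. (fst (xs ! i), if snd (xs ! i) then [Suc (k + i), k + i] else [k + i, Suc (k + i)]))
        [0..<length xs]"
proof (induction xs arbitrary: k)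
  case (Cons x xs)
  have 1: "[k..<Suc (k + length (x # xs))] = k # Suc k # [Suc (Suc k)..<Suc (Suc k + length xs)]"
    by (simp add: upt_conv_Cons del: upt_Suc)
  have 2: "[Suc k..<Suc (Suc k + length xs)] = Suc k # [Suc (Suc k)..<Suc (Suc k + length xs)]"
    by (simp add: upt_conv_Cons del: upt_Suc)
  have 3: "[0..<length (x # xs)] = 0 # map Suc [0..<length xs]"
    by (simp add: upt_conv_Cons map_Suc_upt del: upt_Suc)
  show ?case
    unfolding 1 3 using Cons[of "Suc k", unfolded 2] by (simp add: edge_def)
qed simp

lemma string_graph_genstr: "string_graph (genstr xs) xs"
  unfolding string_graph_def path_graph_def
proof (intro exI[of _ "[0..<Suc (length xs)]"] conjI)
  show "mset (gE (genstr xs)) = mset (path_edges [0..<Suc (length xs)] xs)"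
    using path_edges_upt[of 0 xs] unfolding genstr_def hgraph.sel add_0 by simp
qed (auto simp: genstr_def hd_append)

text \<open>Both walks start at the first external node, so \<open>path_edges_unique\<close>
  applies.\<close>

lemma string_graph_unique: "string_graph G xs \<Longrightarrow> string_graph G ys \<Longrightarrow> xs = ys"
  unfolding string_graph_def path_graph_def using path_edges_unique by (metis list.inject)

text \<open>The edge bijection of \<open>graph_iso\<close> is traded for a rearrangement
  \<open>es\<close> of the edges of \<open>H\<close> that matches \<open>gE G\<close> position by
  position. In this form an isomorphism combines with the multiset in \<open>path_graph\<close>, by
  \<open>list_all2_reorder_left_invariance\<close>.\<close>

lemma graph_iso_iff:
  "graph_iso R G H \<longleftrightarrow> (\<exists>f es. bij_betw f (gV G) (gV H) \<and> gext H = map f (gext G) \<and>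
     mset es = mset (gE H) \<and>
     list_all2 (\<lambda>(l, a) (l', a'). R l l' \<and> a' = map f a) (gE G) es)" (is "?L \<longleftrightarrow> ?R")
proof
  assume ?L
  then obtain f s where *: "bij_betw f (gV G) (gV H)" "length (gE H) = length (gE G)"
    "bij_betw s {..<length (gE G)} {..<length (gE H)}" "gext H = map f (gext G)"
    "\<And>i. i < length (gE G) \<Longrightarrow> R (lab G i) (lab H (s i)) \<and> att H (s i) = map f (att G i)"
    unfolding graph_iso_def by blast
  define es where "es = map (\<lambda>i. gE H ! s i) [0..<length (gE G)]"
  have "mset es = image_mset (\<lambda>i. gE H ! i) (image_mset s (mset_set {..<length (gE G)}))"
    by (simp add: es_def image_mset.compositionality comp_def lessThan_atLeast0)
  also have "\<dots> = image_mset (\<lambda>i. gE H ! i) (mset_set {..<length (gE H)})"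
    using *(3) by (simp add: bij_betw_def image_mset_mset_set)
  also have "\<dots> = mset (map (\<lambda>i. gE H ! i) [0..<length (gE H)])"
    by (simp add: lessThan_atLeast0)
  finally have "mset es = mset (gE H)" by (simp add: map_nth)
  moreover have "list_all2 (\<lambda>(l, a) (l', a'). R l l' \<and> a' = map f a) (gE G) es"
    using *(5) by (simp add: es_def list_all2_conv_all_nth lab_def att_def split_beta)
  ultimately show ?R using * by blast
next
  assume ?R
  then obtain f es where *: "bij_betw f (gV G) (gV H)" "gext H = map f (gext G)"
    "mset es = mset (gE H)" "list_all2 (\<lambda>(l, a) (l', a'). R l l' \<and> a' = map f a) (gE G) es"
    by blast
  obtain s where s: "bij_betw s {..<length es} {..<length (gE H)}"
    "\<And>i. i < length es \<Longrightarrow> es ! i = gE H ! s i"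
    using permutation_Ex_bij[OF *(3)] by blast
  have "length es = length (gE G)" "length es = length (gE H)"
    using *(3,4) by (auto dest: list_all2_lengthD mset_eq_length)
  then show ?L
    unfolding graph_iso_def
    by (intro exI[of _ f] exI[of _ s])
      (use * s in \<open>auto simp: list_all2_conv_all_nth lab_def att_def split_beta\<close>)
qed

text \<open>The node map carries the walk of \<open>G\<close> to a walk of \<open>H\<close>. Labels
  change along \<open>R\<close>; signs depend only on the order of nodes and survive.\<close>

lemma string_graph_iso:
  assumes "string_graph G xs" "graph_iso R G H"
  shows "\<exists>ys. string_graph H ys \<and> list_all2 (rel_prod R (=)) xs ys"
proof -
  obtain vs where vs: "path_graph G vs xs" using assms(1) by (auto simp: string_graph_def)
  then have ne: "vs \<noteq> []" by (auto simp: path_graph_def)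
  obtain f es where *: "bij_betw f (gV G) (gV H)" "gext H = map f (gext G)"
    "mset es = mset (gE H)" "list_all2 (\<lambda>(l, a) (l', a'). R l l' \<and> a' = map f a) (gE G) es"
    using assms(2) by (auto simp: graph_iso_iff)
  from list_all2_reorder_left_invariance[OF *(4), of "path_edges vs xs"] vs obtain es' where
    es': "list_all2 (\<lambda>(l, a) (l', a'). R l l' \<and> a' = map f a) (path_edges vs xs) es'"
    "mset es' = mset es" by (auto simp: path_graph_def)
  from path_edges_cong[OF es'(1)] vs obtain ys where
    ys: "es' = path_edges (map f vs) ys" "list_all2 (rel_prod R (=)) xs ys"
    by (auto simp: path_graph_def)
  have "path_graph H (map f vs) ys"
    using vs * es' ys ne unfolding path_graph_def
    by (auto simp: bij_betw_def distinct_map hd_map last_map dest: list_all2_lengthD)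
  then show ?thesis using ys by (auto simp: string_graph_def)
qed

lemma graph_iso_string_graph:
  assumes "string_graph G xs" "string_graph H ys" "list_all2 (rel_prod R (=)) xs ys"
  shows "graph_iso R G H"
proof -
  obtain vs ws where vs: "path_graph G vs xs" and ws: "path_graph H ws ys"
    using assms by (auto simp: string_graph_def)
  have len: "length ws = length vs"
    using vs ws assms(3) by (auto simp: path_graph_def dest: list_all2_lengthD)
  define f where "f = (\<lambda>v. the (map_of (zip vs ws) v))"
  have map_f: "map f vs = ws"
    using vs len by (intro nth_equalityI) (auto simp: f_def path_graph_def map_of_zip_nth)
  have bij: "bij_betw f (gV G) (gV H)"
    using vs ws map_f distinct_map[of f vs] by (auto simp: path_graph_def bij_betw_def)
  have "list_all2 (\<lambda>(l, a) (l', a'). R l l' \<and> a' = map f a) (path_edges vs xs) (path_edges ws ys)"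
    using path_edges_congI[OF assms(3), of vs f] vs map_f by (simp add: path_graph_def)
  from list_all2_reorder_left_invariance[OF this, of "gE G"] obtain es where
    "list_all2 (\<lambda>(l, a) (l', a'). R l l' \<and> a' = map f a) (gE G) es" "mset es = mset (gE H)"
    using vs ws by (auto simp: path_graph_def)
  moreover have "vs \<noteq> []" using vs by (auto simp: path_graph_def)
  then have "gext H = map f (gext G)"
    using vs ws map_f by (auto simp: path_graph_def hd_map last_map)
  ultimately show ?thesis using bij unfolding graph_iso_iff by blast
qed

lemma string_graph_handle: "string_graph (handle l 2) [(l, False)]"
proof -
  have "[0..<2] = [0, Suc 0]" "{0..<2} = {0..Suc 0}"
    by (simp_all add: upt_conv_Cons) auto
  then have "handle l 2 = genstr [(l, False)]"
    by (simp add: handle_def genstr_def)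
  then show ?thesis using string_graph_genstr[of "[(l, False)]"] by simp
qed

section \<open>Substitution into paths\<close>

abbreviation old_node :: "nat \<Rightarrow> nat" where
  "old_node v \<equiv> prod_encode (0, v)"

text \<open>The local function \<open>ren\<close> of \<open>hsubst\<close> with its parameters made
  explicit. The first component of the code tells old nodes (0) from nodes private to the copy for
  edge \<open>j\<close> (\<open>Suc j\<close>).\<close>

definition rename :: "'l hgraph \<Rightarrow> (nat \<Rightarrow> 'm hgraph) \<Rightarrow> nat \<Rightarrow> nat \<Rightarrow> nat" where
  "rename G F j u = (case map_of (zip (gext (F j)) (att G j)) u of
     Some v \<Rightarrow> old_node v | None \<Rightarrow> prod_encode (Suc j, u))"

lemma hsubst_simps:
  "gV (hsubst G F) = old_node ` gV G \<union> (\<Union>j < length (gE G). rename G F j ` gV (F j))"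
  "gE (hsubst G F)
    = concat (map (\<lambda>j. map (apsnd (map (rename G F j))) (gE (F j))) [0..<length (gE G)])"
  "gext (hsubst G F) = map old_node (gext G)"
proof -
  have apsnd: "apsnd f = (\<lambda>x. (fst x, f (snd x)))" for f :: "nat list \<Rightarrow> nat list"
    by auto
  show "gV (hsubst G F) = old_node ` gV G \<union> (\<Union>j < length (gE G). rename G F j ` gV (F j))"
    "gE (hsubst G F)
      = concat (map (\<lambda>j. map (apsnd (map (rename G F j))) (gE (F j))) [0..<length (gE G)])"
    "gext (hsubst G F) = map old_node (gext G)"
    unfolding hsubst_def Let_def rename_def[abs_def] apsnd by simp_all
qed

lemma hsubst_labels:
  "fst ` set (gE (hsubst G F)) = (\<Union>j < length (gE G). fst ` set (gE (F j)))"
  by (force simp: hsubst_simps image_Union image_image)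

lemma inj_old_node: "inj_on old_node A"
  by (auto simp: inj_on_def prod_encode_eq)

lemma rename_ext:
  assumes "gext (F j) = [s, t]" "att G j = [u, v]" "s \<noteq> t"
  shows "rename G F j s = old_node u" "rename G F j t = old_node v"
    "w \<noteq> s \<Longrightarrow> w \<noteq> t \<Longrightarrow> rename G F j w = prod_encode (Suc j, w)"
  using assms by (auto simp: rename_def)

lemma rename_inj:
  assumes "gext (F j) = [s, t]" "att G j = [u, v]" "s \<noteq> t" "u \<noteq> v"
  shows "inj_on (rename G F j) A"
proof (rule inj_onI)
  fix x y assume "rename G F j x = rename G F j y"
  then show "x = y"
    using assms by (auto simp: rename_def prod_encode_eq split: if_splits)
qed

text \<open>The nodes of the outer path are renamed by \<open>h\<close>, and \<open>T j\<close> contains the interior nodes of the path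
  \<open>P j\<close> pasted for the edge \<open>j\<close>.\<close>
lemma path_edges_paste:
  fixes h :: "nat \<Rightarrow> nat"
  assumes "map E js = path_edges vs xs" "length vs = Suc (length xs)" "distinct vs" "distinct js"
    and h: "inj h" "\<And>j. range h \<inter> T j = {}" "\<And>i j. i \<noteq> j \<Longrightarrow> T i \<inter> T j = {}"
    and P: "\<And>j. j \<in> set js \<Longrightarrow> distinct (P j)" "\<And>j. j \<in> set js \<Longrightarrow> length (P j) = Suc (length (Y j))"
      "\<And>j. j \<in> set js \<Longrightarrow> Y j \<noteq> []"
      "\<And>j. j \<in> set js \<Longrightarrow> [hd (P j), last (P j)] = map h (snd (E j))"
      "\<And>j. j \<in> set js \<Longrightarrow> set (P j) \<subseteq> h ` set (snd (E j)) \<union> T j"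
  obtains ws where "distinct ws" "hd ws = h (hd vs)" "last ws = h (last vs)"
     "length ws = Suc (length (concat (map2 (\<lambda>j x. orient (snd x) (Y j)) js xs)))"
     "set ws = h ` set vs \<union> (\<Union>j \<in> set js. set (P j))"
     "mset (path_edges ws (concat (map2 (\<lambda>j x. orient (snd x) (Y j)) js xs)))
       = mset (concat (map (\<lambda>j. path_edges (P j) (Y j)) js))"
  using assms(1-4) P
proof (induction xs arbitrary: vs js thesis)
  case Nil
  then obtain u where "vs = [u]" by (auto simp: length_Suc_conv)
  then show ?case using Nil(2) by (intro Nil(1)[of "[h u]"]) simp_all
next
  case (Cons x xs us)
  obtain u v vs where us: "us = u # v # vs"
    using Cons.prems(3) by (auto simp: length_Suc_conv)
  note prems = Cons.prems[unfolded us]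
  note P = prems(6-10)
  have "map E js = edge u x v # path_edges (v # vs) xs"
    using prems(2) by simp
  then obtain j js' where js: "js = j # js'" and Ej: "E j = edge u x v"
    and Ejs: "map E js' = path_edges (v # vs) xs"
    unfolding map_eq_Cons_conv by blast
  have js': "j \<notin> set js'" "distinct js'" "\<And>i. i \<in> set js' \<Longrightarrow> i \<in> set js" "j \<in> set js"
    using prems(5) js by simp_all
  have vs: "u \<notin> set (v # vs)" "distinct (v # vs)" "length (v # vs) = Suc (length xs)"
    using prems(3,4) by simp_all
  let ?rest = "concat (map2 (\<lambda>j x. orient (snd x) (Y j)) js' xs)"
  obtain ws where ws: "distinct ws" "hd ws = h (hd (v # vs))" "last ws = h (last (v # vs))"
     "length ws = Suc (length ?rest)"
     "set ws = h ` set (v # vs) \<union> (\<Union>j \<in> set js'. set (P j))"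
     "mset (path_edges ws ?rest) = mset (concat (map (\<lambda>j. path_edges (P j) (Y j)) js'))"
    by (rule Cons.IH[OF _ Ejs vs(3,2) js'(2) P(1,2,3,4,5)[OF js'(3)]])
  obtain ws' where ws': "ws = h v # ws'" using ws(2,4) by (cases ws) simp_all
  note Pj = P[OF js'(4), unfolded Ej set_edge]
  \<comment> \<open>\<open>P j\<close> runs along the edge \<open>j\<close> from its first to its
    second attachment node. \<open>Q\<close> is the same path walked in the direction of the outer
    path, from \<open>h u\<close> to \<open>h v\<close>.\<close>
  define Q where "Q = (if snd x then rev (P j) else P j)"
  have "P j \<noteq> []" using Pj(2) by auto
  then have Q: "distinct Q" "length Q = Suc (length (Y j))" "hd Q = h u" "last Q = h v"
    "set Q = set (P j)"
    "mset (path_edges Q (orient (snd x) (Y j))) = mset (path_edges (P j) (Y j))"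
    using Pj(1-4) path_edges_rev[OF Pj(2)] unfolding Q_def
    by (auto simp: edge_def hd_rev last_rev)
  \<comment> \<open>The end \<open>h v\<close> of \<open>Q\<close> is already the first node of
    \<open>ws\<close>; only the nodes before it are prepended.\<close>
  obtain Q0 where Q0: "Q = Q0 @ [h v]" using Q(2,4) by (cases Q rule: rev_cases) simp_all
  have len: "length Q0 = length (orient (snd x) (Y j))" using Q(2) Q0 by simp
  have Q0ne: "Q0 \<noteq> []" using len Pj(3) by auto
  then have hdQ0: "hd Q0 = h u" using Q(3) Q0 by simp
  \<comment> \<open>Besides nodes private to \<open>j\<close>, \<open>Q0\<close> contains only
    \<open>h u\<close>, and \<open>u\<close> does not occur in the rest of the outer path.\<close>
  have disj: "set Q0 \<inter> set ws = {}"
  proof -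
    have 1: "set (P i) \<subseteq> h ` set (v # vs) \<union> T i" if "i \<in> set js'" for i
    proof -
      have "E i \<in> set (path_edges (v # vs) xs)" unfolding Ejs[symmetric] using that by simp
      then have "h ` set (snd (E i)) \<subseteq> h ` set (v # vs)" by (intro image_mono path_edges_nodes)
      with P(5)[OF js'(3)[OF that]] show ?thesis by (meson Un_mono order_refl order_trans)
    qed
    have 2: "set Q0 \<subseteq> insert (h u) (T j)"
      using Q(1,5) Pj(5) Q0 by auto
    have 3: "h u \<notin> h ` set (v # vs)"
      using vs(1) by (simp only: inj_image_mem_iff[OF h(1)] not_False_eq_True)
    have 4: "h ` A \<inter> T i = {}" for A i
      using h(2)[of i] by (auto simp: disjoint_iff)
    have 5: "T j \<inter> T i = {}" if "i \<in> set js'" for i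
      using that js'(1) by (intro h(3)) auto
    have 6: "insert (h u) (T j) \<inter> h ` set (v # vs) = {}"
      using 3 4[of "set (v # vs)" j] by (metis Int_commute Int_insert_left)
    have "insert (h u) (T j) \<inter> T i = {}" if "i \<in> set js'" for i
      using 4[of "{u}" i] 5[OF that] by simp
    then have "insert (h u) (T j) \<inter> set (P i) = {}" if "i \<in> set js'" for i
      using 1[OF that] 6 that by (metis Int_Un_distrib Int_mono Un_empty order_refl subset_empty)
    then have "insert (h u) (T j) \<inter> set ws = {}"
      using 6 unfolding ws(5) by (simp only: Int_Un_distrib Int_UN_distrib) simp
    then show ?thesis using 2 by (metis Int_mono order_refl subset_empty)
  qed
  have concat: "concat (map2 (\<lambda>j x. orient (snd x) (Y j)) js (x # xs)) = orient (snd x) (Y j) @ ?rest"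
    using js by simp
  show ?case
  proof (rule prems(1)[of "Q0 @ ws"])
    show "distinct (Q0 @ ws)" using disj ws(1) Q(1) Q0 by simp
    show "last (Q0 @ ws) = h (last (u # v # vs))" using ws(3) ws' by simp
    show "hd (Q0 @ ws) = h (hd (u # v # vs))" using hdQ0 Q0ne by simp
    show "length (Q0 @ ws) = Suc (length (concat (map2 (\<lambda>j x. orient (snd x) (Y j)) js (x # xs))))"
      unfolding concat using len ws(4) by simp
    have "h v \<in> set ws" using ws' by simp
    moreover have "set (P j) = insert (h v) (set Q0)" using Q(5) Q0 by simp
    ultimately have "set (Q0 @ ws) = set (P j) \<union> set ws" by (simp add: insert_absorb)
    moreover have "h u \<in> set Q0" using hdQ0 Q0ne hd_in_set by metis
    then have "insert (h u) (set (P j)) = set (P j)" using \<open>set (P j) = _\<close> by auto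
    ultimately show "set (Q0 @ ws) = h ` set (u # v # vs) \<union> (\<Union>j \<in> set js. set (P j))"
      unfolding ws(5) js by (simp add: Un_ac) (metis Un_insert_left Un_insert_right)
    have "path_edges (Q0 @ ws) (orient (snd x) (Y j) @ ?rest)
      = path_edges Q (orient (snd x) (Y j)) @ path_edges ws ?rest"
      using len ws' Q0 by (simp add: path_edges_append)
    then show "mset (path_edges (Q0 @ ws) (concat (map2 (\<lambda>j x. orient (snd x) (Y j)) js (x # xs))))
       = mset (concat (map (\<lambda>j. path_edges (P j) (Y j)) js))"
      unfolding concat using Q(6) ws(6) js by simp
  qed
qed

text \<open>HL rules address an edge by its index in \<open>gE\<close>, a signed list by its
  position in the walk. \<open>js\<close> is the dictionary between the two: the indices in walk
  order.\<close>

definition path_order :: "'l hgraph \<Rightarrow> ('l \<times> bool) list \<Rightarrow> nat list \<Rightarrow> bool" where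
  "path_order G xs js \<longleftrightarrow> distinct js \<and> set js = {..<length (gE G)} \<and>
     (\<exists>vs. path_graph G vs xs \<and> map ((!) (gE G)) js = path_edges vs xs)"

lemma path_order_exists:
  assumes "string_graph G xs"
  obtains js where "path_order G xs js"
proof -
  obtain vs where vs: "path_graph G vs xs" using assms(1) by (auto simp: string_graph_def)
  have meq: "mset (path_edges vs xs) = mset (gE G)" using vs by (simp add: path_graph_def)
  obtain s where s: "bij_betw s {..<length (path_edges vs xs)} {..<length (gE G)}"
    "\<And>i. i < length (path_edges vs xs) \<Longrightarrow> path_edges vs xs ! i = gE G ! s i"
    using permutation_Ex_bij[OF meq] by blast
  define js where "js = map s [0..<length (path_edges vs xs)]"
  have "distinct js" "set js = {..<length (gE G)}"
    using s(1) by (auto simp: js_def distinct_map bij_betw_def lessThan_atLeast0)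
  moreover have "map ((!) (gE G)) js = path_edges vs xs"
    using s(2) by (auto simp: js_def intro!: nth_equalityI)
  ultimately show ?thesis using vs that unfolding path_order_def by blast
qed

lemma path_order_labels:
  assumes "path_order G xs js"
  shows "map (lab G) js = map fst xs"
proof -
  obtain vs where vs: "path_graph G vs xs" "map ((!) (gE G)) js = path_edges vs xs"
    using assms by (auto simp: path_order_def)
  have "map (lab G) js = map fst (map ((!) (gE G)) js)" by (simp add: lab_def)
  also have "\<dots> = map fst xs"
    using vs(1) by (simp only: vs(2) path_edges_labels path_graph_def)
  finally show ?thesis .
qed

lemma path_order_length: "path_order G xs js \<Longrightarrow> length js = length xs"
  using path_order_labels map_eq_imp_length_eq by blast

lemma string_graph_att:
  assumes "string_graph G xs" "j < length (gE G)"
  shows "distinct (att G j)" "length (att G j) = 2" "set (att G j) \<subseteq> gV G"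
proof -
  obtain vs where vs: "path_graph G vs xs" using assms(1) by (auto simp: string_graph_def)
  have e: "gE G ! j \<in> set (path_edges vs xs)"
    using path_graph_edges[OF vs] assms(2) nth_mem[OF assms(2)] by simp
  show "distinct (att G j)" "length (att G j) = 2" "set (att G j) \<subseteq> gV G"
    using path_edges_distinct[OF e] path_edges_nodes[OF e] vs
    by (simp_all add: path_graph_def att_def)
qed

text \<open>One statement serves all HL rules, because \<open>repl\<close> and the graphs in the
  division rules and \<open>timesR\<close> are instances of \<open>hsubst\<close>.
  \<open>Y j \<noteq> []\<close> makes the external nodes of each inserted path different, which the
  fusion in \<open>rename\<close> relies on.\<close>

lemma string_graph_hsubst:
  assumes "path_order G xs js"
    and F: "\<And>j. j < length (gE G) \<Longrightarrow> string_graph (F j) (Y j) \<and> Y j \<noteq> []"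
  shows "string_graph (hsubst G F) (concat (map2 (\<lambda>j x. orient (snd x) (Y j)) js xs))"
proof -
  let ?n = "length (gE G)"
  obtain vs where vs: "path_graph G vs xs" and map_js: "map ((!) (gE G)) js = path_edges vs xs"
    and js: "distinct js" "set js = {..<?n}"
    using assms(1) by (auto simp: path_order_def)
  have "\<forall>j. \<exists>us. j < ?n \<longrightarrow> path_graph (F j) us (Y j)"
    using F by (auto simp: string_graph_def)
  then obtain U where U: "\<And>j. j < ?n \<Longrightarrow> path_graph (F j) (U j) (Y j)"
    by metis
  define P where "P = (\<lambda>j. map (rename G F j) (U j))"
  have *: "distinct (P j)" "length (P j) = Suc (length (Y j))" "Y j \<noteq> []"
      "[hd (P j), last (P j)] = map old_node (snd (gE G ! j))"
      "set (P j) \<subseteq> old_node ` set (snd (gE G ! j)) \<union> range (\<lambda>w. prod_encode (Suc j, w))"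
    if "j \<in> set js" for j
  proof -
    have j: "j < ?n" using that js by simp
    have "string_graph G xs" using vs by (auto simp: string_graph_def)
    from string_graph_att(1,2)[OF this j]
    obtain u v where uv: "att G j = [u, v]" "u \<noteq> v"
      by (auto simp: length_Suc_conv numeral_2_eq_2)
    have ext: "gext (F j) = [hd (U j), last (U j)]" and len: "length (U j) = Suc (length (Y j))"
      and dis: "distinct (U j)"
      using U[OF j] by (auto simp: path_graph_def)
    have Y: "Y j \<noteq> []" using F[OF j] by simp
    have ne: "hd (U j) \<noteq> last (U j)" using len dis Y by (cases "U j") auto
    have "U j \<noteq> []" using len by auto
    then have "hd (P j) = old_node u" "last (P j) = old_node v"
      using rename_ext(1,2)[where F = F and G = G and j = j, OF ext uv(1) ne]
      by (simp_all add: P_def hd_map last_map)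
    moreover have "distinct (P j)"
      using rename_inj[where F = F and G = G, OF ext uv(1) ne uv(2)] dis
      by (simp add: P_def distinct_map)
    moreover have "rename G F j w \<in> {old_node u, old_node v} \<union> range (\<lambda>w. prod_encode (Suc j, w))"
      for w
      using rename_ext[where F = F and G = G and j = j, OF ext uv(1) ne]
      by (cases "w = hd (U j) \<or> w = last (U j)") auto
    then have "set (P j) \<subseteq> old_node ` set (att G j) \<union> range (\<lambda>w. prod_encode (Suc j, w))"
      unfolding P_def uv(1) by auto
    ultimately show "distinct (P j)" "length (P j) = Suc (length (Y j))" "Y j \<noteq> []"
      "[hd (P j), last (P j)] = map old_node (snd (gE G ! j))"
      "set (P j) \<subseteq> old_node ` set (snd (gE G ! j)) \<union> range (\<lambda>w. prod_encode (Suc j, w))"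
      using len Y uv(1) by (simp_all add: P_def att_def)
  qed
  let ?Y = "concat (map2 (\<lambda>j x. orient (snd x) (Y j)) js xs)"
  obtain ws where ws: "distinct ws" "hd ws = old_node (hd vs)" "last ws = old_node (last vs)"
     "length ws = Suc (length ?Y)" "set ws = old_node ` set vs \<union> (\<Union>j \<in> set js. set (P j))"
     "mset (path_edges ws ?Y) = mset (concat (map (\<lambda>j. path_edges (P j) (Y j)) js))"
  proof (rule path_edges_paste[OF map_js _ _ js(1) inj_old_node _ _ *])
    show "length vs = Suc (length xs)" "distinct vs" using vs by (simp_all add: path_graph_def)
    show "range old_node \<inter> range (\<lambda>w. prod_encode (Suc j, w)) = {}" for j
      by (auto simp: prod_encode_eq)
    show "range (\<lambda>w. prod_encode (Suc i, w)) \<inter> range (\<lambda>w. prod_encode (Suc j, w)) = {}"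
      if "i \<noteq> j" for i j
      using that by (auto simp: prod_encode_eq)
  qed
  have E: "mset (path_edges (P j) (Y j)) = mset (map (apsnd (map (rename G F j))) (gE (F j)))"
    if "j < ?n" for j
  proof -
    have "mset (path_edges (P j) (Y j))
        = image_mset (apsnd (map (rename G F j))) (mset (path_edges (U j) (Y j)))"
      unfolding P_def path_edges_map[symmetric] by simp
    then show ?thesis using U[OF that] by (simp add: path_graph_def)
  qed
  \<comment> \<open>\<open>hsubst\<close> joins the copies by index, the path joins them in walk
    order; as multisets both are the sum over all indices.\<close>
  have "mset (gE (hsubst G F))
    = (\<Sum>j\<leftarrow>[0..<?n]. mset (map (apsnd (map (rename G F j))) (gE (F j))))"
    by (simp add: hsubst_simps mset_concat comp_def)
  also have "\<dots> = (\<Sum>j\<in>{..<?n}. mset (map (apsnd (map (rename G F j))) (gE (F j))))"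
    by (simp add: sum_list_distinct_conv_sum_set lessThan_atLeast0)
  also have "\<dots> = (\<Sum>j\<in>set js. mset (path_edges (P j) (Y j)))"
    using E js by (intro sum.cong) auto
  also have "\<dots> = mset (concat (map (\<lambda>j. path_edges (P j) (Y j)) js))"
    using js by (simp add: mset_concat comp_def sum_list_distinct_conv_sum_set)
  finally have "mset (gE (hsubst G F)) = mset (path_edges ws ?Y)" using ws(6) by simp
  moreover have "set ws = gV (hsubst G F)"
    using ws(5) js(2) vs U by (auto simp: hsubst_simps P_def path_graph_def)
  moreover have "gext (hsubst G F) = [hd ws, last ws]"
    using ws vs by (simp add: hsubst_simps path_graph_def)
  ultimately have "path_graph (hsubst G F) ws ?Y"
    using ws by (simp add: path_graph_def)
  then show ?thesis unfolding string_graph_def by blast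
qed

text \<open>For the edges that \<open>repl\<close> leaves alone: an edge replaced by its own handle
  gives back its signed letter, because orienting a positive letter by \<open>d\<close> yields sign
  \<open>d\<close>.\<close>

lemma concat_map2_unchanged:
  assumes "map l js = map fst xs" "\<And>j. j \<in> set js \<Longrightarrow> Y j = [(l j, False)]"
  shows "concat (map2 (\<lambda>j x. orient (snd x) (Y j)) js xs) = xs"
proof -
  have "length js = length xs" using assms(1) map_eq_imp_length_eq by blast
  then show ?thesis using assms
    by (induction js xs rule: list_induct2) auto
qed

lemma string_graph_repl_path_order:
  assumes "path_order G (xs1 @ x # xs2) (js1 @ e # js2)" "length js1 = length xs1"
    "string_graph F ys" "ys \<noteq> []"
  shows "string_graph (repl G e F) (xs1 @ orient (snd x) ys @ xs2)"
proof -
  let ?Y = "\<lambda>j. if j = e then ys else [(lab G j, False)]"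
  have G: "string_graph G (xs1 @ x # xs2)"
    using assms(1) by (auto simp: path_order_def string_graph_def)
  have "string_graph (repl G e F)
    (concat (map2 (\<lambda>j x. orient (snd x) (?Y j)) (js1 @ e # js2) (xs1 @ x # xs2)))"
    unfolding repl_def
  proof (rule string_graph_hsubst[OF assms(1)])
    fix j assume "j < length (gE G)"
    then show "string_graph (if j = e then F else handle (lab G j) (length (att G j))) (?Y j) \<and> ?Y j \<noteq> []"
      using assms(3,4) string_graph_att(2)[OF G] string_graph_handle by auto
  qed
  moreover have e: "e \<notin> set js1" "e \<notin> set js2"
    using assms(1) by (auto simp: path_order_def)
  moreover have l: "map (lab G) js1 = map fst xs1" "map (lab G) js2 = map fst xs2"
    using path_order_labels[OF assms(1)] assms(2) by simp_all
  moreover have "concat (map2 (\<lambda>j x. orient (snd x) (?Y j)) js1 xs1) = xs1"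
    "concat (map2 (\<lambda>j x. orient (snd x) (?Y j)) js2 xs2) = xs2"
    using e by (auto intro!: concat_map2_unchanged l)
  ultimately show ?thesis using assms(2) by simp
qed

text \<open>Starts from an occurrence in the list and finds the edge, for building HL derivations;
  \<open>string_graph_repl_index\<close> starts from the edge, for analysing them.\<close>

lemma string_graph_repl_label:
  assumes "string_graph G (xs1 @ x # xs2)"
  obtains e where "e < length (gE G)" "lab G e = fst x"
    "\<And>F ys. string_graph F ys \<Longrightarrow> ys \<noteq> [] \<Longrightarrow>
       string_graph (repl G e F) (xs1 @ orient (snd x) ys @ xs2)"
proof -
  obtain js where js: "path_order G (xs1 @ x # xs2) js"
    using path_order_exists[OF assms] .
  have len: "length xs1 < length js" using path_order_length[OF js] by simp
  let ?e = "js ! length xs1" and ?js1 = "take (length xs1) js" and ?js2 = "drop (Suc (length xs1)) js"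
  have split: "js = ?js1 @ ?e # ?js2" using id_take_nth_drop[OF len] .
  have "?e \<in> set js" using len by simp
  then have "?e < length (gE G)" using js by (auto simp: path_order_def)
  moreover have "map (lab G) js ! length xs1 = map fst (xs1 @ x # xs2) ! length xs1"
    by (simp only: path_order_labels[OF js])
  then have "lab G ?e = fst x" using len by (simp add: nth_append)
  moreover have "string_graph (repl G ?e F) (xs1 @ orient (snd x) ys @ xs2)"
    if "string_graph F ys" "ys \<noteq> []" for F ys
    by (rule string_graph_repl_path_order[where ?js1.0 = ?js1 and ?js2.0 = ?js2])
      (use js split len that in simp_all)
  ultimately show ?thesis by (rule that)
qed

lemma string_graph_repl_index:
  assumes "string_graph G xs" "e < length (gE G)"
  obtains xs1 d xs2 where "xs = xs1 @ (lab G e, d) # xs2"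
    "\<And>F ys. string_graph F ys \<Longrightarrow> ys \<noteq> [] \<Longrightarrow> string_graph (repl G e F) (xs1 @ orient d ys @ xs2)"
proof -
  obtain js where js: "path_order G xs js"
    using path_order_exists[OF assms(1)] .
  then have "e \<in> set js" using assms(2) by (simp add: path_order_def)
  then obtain js1 js2 where js12: "js = js1 @ e # js2" by (auto simp: in_set_conv_decomp)
  have len: "length js1 < length xs" using path_order_length[OF js] js12 by simp
  let ?x = "xs ! length js1" and ?xs1 = "take (length js1) xs" and ?xs2 = "drop (Suc (length js1)) xs"
  have split: "xs = ?xs1 @ ?x # ?xs2" using id_take_nth_drop[OF len] .
  have "map (lab G) js ! length js1 = map fst xs ! length js1"
    by (simp only: path_order_labels[OF js])
  then have x: "?x = (lab G e, snd ?x)"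
    using len nth_append_length[of "map (lab G) js1"] by (simp add: prod_eq_iff js12)
  have "string_graph (repl G e F) (?xs1 @ orient (snd ?x) ys @ ?xs2)"
    if "string_graph F ys" "ys \<noteq> []" for F ys
    by (rule string_graph_repl_path_order[where ?js1.0 = js1 and ?js2.0 = js2])
      (use js js12 split len that in simp_all)
  then show ?thesis using that[of ?xs1 "snd ?x" ?xs2] split x by simp
qed

text \<open>The two edges may be stored in either order, so their indices are named \<open>i\<close>
  and \<open>j\<close> instead of being fixed as 0 and 1.\<close>

lemma path_order_pair:
  assumes "string_graph D [x, y]"
  obtains i j where "path_order D [x, y] [i, j]" "i \<noteq> j" "{..<length (gE D)} = {i, j}"
    "lab D i = fst x" "lab D j = fst y"
proof -
  obtain js where js: "path_order D [x, y] js" using path_order_exists[OF assms] .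
  then obtain i j where ij: "js = [i, j]"
    using path_order_length[OF js] by (auto simp: length_Suc_conv)
  have "distinct [i, j]" "set [i, j] = {..<length (gE D)}"
    using js unfolding path_order_def ij by blast+
  then have "i \<noteq> j" "{..<length (gE D)} = {i, j}" by simp_all
  moreover have "lab D i = fst x" "lab D j = fst y"
    using path_order_labels[OF js] by (simp_all add: ij)
  ultimately show ?thesis using that js ij by blast
qed

lemma string_graph_hsubst_pair:
  assumes "path_order D [(a, c), (b, d)] [i, j]" "i \<noteq> j"
    "string_graph (F i) ys" "string_graph (F j) zs" "ys \<noteq> []" "zs \<noteq> []"
  shows "string_graph (hsubst D F) (orient c ys @ orient d zs)"
proof -
  have "{..<length (gE D)} = {i, j}" using assms(1) by (simp add: path_order_def)
  then have "k = i \<or> k = j" if "k < length (gE D)" for k using that by blast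
  then have "string_graph (hsubst D F)
    (concat (map2 (\<lambda>k x. orient (snd x) (if k = i then ys else zs)) [i, j] [(a, c), (b, d)]))"
    using assms(2-) by (intro string_graph_hsubst[OF assms(1)]) auto
  then show ?thesis using assms(2) by simp
qed

lemma string_graph_hsubst_single:
  assumes "string_graph D [(a, c)]" "string_graph (F 0) ys" "ys \<noteq> []"
  shows "string_graph (hsubst D F) (orient c ys)" "length (gE D) = 1" "lab D 0 = a"
proof -
  obtain js where js: "path_order D [(a, c)] js" using path_order_exists[OF assms(1)] .
  then obtain i where i: "js = [i]"
    using path_order_length[OF js] by (auto simp: length_Suc_conv)
  then have "{..<length (gE D)} = {i}" using js by (simp add: path_order_def)
  then have n: "{..<length (gE D)} = {0}" "i = 0"
    by (metis equals0D lessThan_iff lessThan_empty_iff gr0I insert_iff singletonD)+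
  then show "length (gE D) = 1" using card_lessThan[of "length (gE D)"] by simp
  show "lab D 0 = a" using path_order_labels[OF js] i n by simp
  have "k = 0" if "k < length (gE D)" for k using that n by blast
  then show "string_graph (hsubst D F) (orient c ys)"
    using string_graph_hsubst[OF js, of F "\<lambda>_. ys"] assms(2-) i by auto
qed

section \<open>Stripping, relabelling and contracting edges of a path\<close>

lemma path_edges_split:
  assumes "e \<in> set (path_edges vs xs)" "length vs = Suc (length xs)"
  obtains vs1 u v vs2 xs1 x xs2 where "vs = vs1 @ u # v # vs2" "xs = xs1 @ x # xs2"
    "length vs1 = length xs1" "e = edge u x v"
  using assms
proof (induction vs xs arbitrary: thesis rule: path_edges.induct)
  case (1 u v vs x xs)
  show ?case
  proof (cases "e = edge u x v")
    case True
    then show ?thesis using "1.prems"(1)[of "[]" u v vs "[]" x xs] by simp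
  next
    case False
    have e: "e \<in> set (path_edges (v # vs) xs)" and len: "length (v # vs) = Suc (length xs)"
      using "1.prems"(2,3) False by simp_all
    obtain vs1 u' v' vs2 xs1 x' xs2 where "v # vs = vs1 @ u' # v' # vs2" "xs = xs1 @ x' # xs2"
      "length vs1 = length xs1" "e = edge u' x' v'"
      by (rule "1.IH"[OF _ e len])
    then show ?thesis using "1.prems"(1)[of "u # vs1" u' v' vs2 "x # xs1" x' xs2] by simp
  qed
qed auto

lemma path_edges_middle:
  "length vs1 = length xs1 \<Longrightarrow> path_edges (vs1 @ u # v # vs2) (xs1 @ x # xs2)
     = path_edges (vs1 @ [u]) xs1 @ edge u x v # path_edges (v # vs2) xs2"
  by (simp add: path_edges_append)

text \<open>Only one edge contains \<open>c\<close>, and the last edge of a walk ending in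
  \<open>c\<close> contains it.\<close>

lemma path_edges_strip_last:
  assumes "mset (path_edges vs xs) = E + {#edge b x c#}" "distinct vs"
    "length vs = Suc (length xs)" "last vs = c" "b \<noteq> c" "\<And>e. e \<in># E \<Longrightarrow> c \<notin> set (snd e)"
  obtains vs' xs' where "vs = vs' @ [c]" "xs = xs' @ [x]" "vs' \<noteq> []" "last vs' = b"
    "mset (path_edges vs' xs') = E"
proof -
  obtain xs' y where xs: "xs = xs' @ [y]"
    using assms(1) by (cases xs rule: rev_cases) auto
  obtain vs' p where vs: "vs = vs' @ [p, c]"
  proof -
    obtain us where us: "vs = us @ [c]"
      using assms(3,4) by (cases vs rule: rev_cases) auto
    then obtain vs' p where "us = vs' @ [p]"
      using assms(3) xs by (cases us rule: rev_cases) auto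
    then show ?thesis using that us by simp
  qed
  have pc: "p \<noteq> c" and len: "length vs' = length xs'"
    using assms(2,3) vs xs by auto
  have eq: "mset (path_edges (vs' @ [p]) xs') + {#edge p y c#} = E + {#edge b x c#}"
    using assms(1) path_edges_append[OF len, of p "[c]" "[y]"] vs xs by simp
  then have "edge p y c \<in># E + {#edge b x c#}"
    by (metis union_iff multi_member_this add_mset_add_single)
  moreover have "edge p y c \<notin># E" using assms(6) set_edge by blast
  ultimately have "edge p y c = edge b x c" by simp
  then have "y = x" "p = b" using edge_eq_right[OF pc] by blast+
  then show ?thesis using eq that[of "vs' @ [p]" xs'] vs xs by simp
qed

text \<open>The same argument for the walk read backwards.\<close>

lemma path_edges_strip_first:
  assumes "mset (path_edges vs xs) = E + {#edge c x b#}" "distinct vs"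
    "length vs = Suc (length xs)" "hd vs = c" "b \<noteq> c" "\<And>e. e \<in># E \<Longrightarrow> c \<notin> set (snd e)"
  obtains vs' xs' where "vs = c # vs'" "xs = x # xs'" "vs' \<noteq> []" "hd vs' = b"
    "mset (path_edges vs' xs') = E"
proof -
  have "mset (path_edges (rev vs) (flip xs)) = E + {#edge b (apsnd Not x) c#}"
    using assms(1,3) by (simp add: path_edges_rev edge_reverse)
  moreover have "last (rev vs) = c" using assms(4) by (simp add: last_rev)
  ultimately obtain vs' xs' where *: "rev vs = vs' @ [c]" "flip xs = xs' @ [apsnd Not x]"
      "vs' \<noteq> []" "last vs' = b" "mset (path_edges vs' xs') = E"
    using path_edges_strip_last[of "rev vs" "flip xs" E b "apsnd Not x" c] assms(2,3,5,6)
    by auto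
  have "vs = c # rev vs'" using *(1) by (metis rev_eq_Cons_iff rev_rev_ident)
  moreover have "xs = flip (xs' @ [apsnd Not x])" using *(2) by (metis flip_simps(4))
  then have "xs = x # flip xs'" by (cases x) simp
  moreover have "length vs' = Suc (length xs')" using calculation assms(3) by simp
  then have "mset (path_edges (rev vs') (flip xs')) = E" using *(5) by (simp add: path_edges_rev)
  ultimately show ?thesis using that[of "rev vs'" "flip xs'"] * by (simp add: hd_rev)
qed

lemma path_edges_relabel:
  assumes "mset (path_edges vs xs) = E + {#(a, if d then [v, u] else [u, v])#}"
    "length vs = Suc (length xs)"
  obtains xs1 d' xs2 where "xs = xs1 @ (a, d \<noteq> d') # xs2"
    "mset (path_edges vs (xs1 @ (c, d') # xs2)) = E + {#(c, [u, v])#}"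
proof -
  have "(a, if d then [v, u] else [u, v]) \<in># mset (path_edges vs xs)"
    unfolding assms(1) by simp
  then obtain vs1 p q vs2 xs1 x xs2 where *: "vs = vs1 @ p # q # vs2" "xs = xs1 @ x # xs2"
    "length vs1 = length xs1" "(a, if d then [v, u] else [u, v]) = edge p x q"
    using path_edges_split[OF _ assms(2)] by (metis set_mset_mset)
  \<comment> \<open>On booleans \<open>\<noteq>\<close> is exclusive or: an edge attached to
    \<open>[u, v]\<close> has the sign \<open>d \<noteq> snd x\<close> in this walk.\<close>
  have x: "x = (a, d \<noteq> (d \<noteq> snd x))" using *(4) by (auto simp: edge_def prod_eq_iff)
  have "edge p (c, d \<noteq> snd x) q = (c, [u, v])"
    using *(4) by (auto simp: edge_def split: if_splits)
  moreover have "mset (path_edges (vs1 @ [p]) xs1) + mset (path_edges (q # vs2) xs2) = E"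
    using assms(1) *(1,2,4) path_edges_middle[OF *(3)] by simp
  ultimately have "mset (path_edges vs (xs1 @ (c, d \<noteq> snd x) # xs2)) = E + {#(c, [u, v])#}"
    unfolding *(1) path_edges_middle[OF *(3)] by auto
  then show ?thesis using that[of xs1 "d \<noteq> snd x" xs2] *(2) x by metis
qed

text \<open>\<open>w\<close> is an inner node of the walk and lies on no edge of \<open>E\<close>,
  so the two walk edges at \<open>w\<close> are exactly the given pair. They are traversed either
  from \<open>u\<close> to \<open>v\<close> or backwards, which is the sign \<open>d\<close> of the
  merged edge.\<close>

lemma path_edges_contract:
  assumes "mset (path_edges vs xs) = E + {#(a, [u, w]), (b, [w, v])#}" "distinct vs"
    "length vs = Suc (length xs)" "hd vs \<noteq> w" "last vs \<noteq> w" "\<And>e. e \<in># E \<Longrightarrow> w \<notin> set (snd e)"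
  obtains vs' xs1 d xs2 where "xs = xs1 @ orient d [(a, False), (b, False)] @ xs2"
    "distinct vs'" "set vs' = set vs - {w}" "length vs' = Suc (length (xs1 @ (c, d) # xs2))"
    "hd vs' = hd vs" "last vs' = last vs"
    "mset (path_edges vs' (xs1 @ (c, d) # xs2)) = E + {#(c, [u, v])#}"
proof -
  have "(a, [u, w]) \<in># mset (path_edges vs xs)" unfolding assms(1) by simp
  then have "w \<in> set vs" using path_edges_nodes[of "(a, [u, w])" vs xs] by simp
  then obtain vs1 vs2 where "vs = vs1 @ w # vs2" by (auto simp: in_set_conv_decomp)
  then obtain p1 p q q2 where vs: "vs = p1 @ p # w # q # q2"
    using assms(4,5) by (cases vs1 rule: rev_cases; cases vs2) auto
  have "length p1 < length xs" "Suc (length p1) < length xs" using assms(3) vs by simp_all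
  then obtain xs1 y z xs2 where xs: "xs = xs1 @ y # z # xs2" and len: "length p1 = length xs1"
    using id_take_nth_drop[of "length p1" xs] Cons_nth_drop_Suc[of "Suc (length p1)" xs]
    by (metis length_take min.absorb4)
  let ?E1 = "mset (path_edges (p1 @ [p]) xs1)" and ?E2 = "mset (path_edges (q # q2) xs2)"
  have eq: "?E1 + ?E2 + {#edge p y w, edge w z q#} = E + {#(a, [u, w]), (b, [w, v])#}"
    using assms(1) path_edges_middle[OF len, of p w "q # q2" y "z # xs2"] vs xs by simp
  have dist: "w \<notin> set (p1 @ [p])" "w \<notin> set (q # q2)" using assms(2) vs by auto
  \<comment> \<open>Filtering both sides of \<open>eq\<close> by the edges through \<open>w\<close>
    leaves exactly the two pairs.\<close>
  let ?in = "\<lambda>e. w \<in> set (snd e)"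
  have E12: "\<not> ?in e" if "e \<in># ?E1 + ?E2" for e
    using that dist path_edges_nodes[of e "p1 @ [p]" xs1] path_edges_nodes[of e "q # q2" xs2]
    by auto
  have f: "filter_mset ?in (?E1 + ?E2) = {#}" "filter_mset ?in E = {#}"
    using E12 assms(6) by (simp_all only: filter_mset_eq_mempty_iff) blast+
  then have two: "{#edge p y w, edge w z q#} = {#(a, [u, w]), (b, [w, v])#}"
  proof -
    have "filter_mset ?in (?E1 + ?E2) + filter_mset ?in {#edge p y w, edge w z q#}
      = filter_mset ?in E + filter_mset ?in {#(a, [u, w]), (b, [w, v])#}"
      using arg_cong[OF eq, of "filter_mset ?in"] by (simp only: filter_union_mset)
    then show ?thesis unfolding f by (simp add: set_edge)
  qed
  then have E: "?E1 + ?E2 = E" using eq by simp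
  have pq: "p \<noteq> w" "q \<noteq> w" using dist by auto
  have "edge p y w = (a, [u, w]) \<and> edge w z q = (b, [w, v]) \<or>
    edge p y w = (b, [w, v]) \<and> edge w z q = (a, [u, w])"
    using two by (auto simp: add_eq_conv_ex)
  then obtain d where d: "[y, z] = orient d [(a, False), (b, False)]" "edge p (c, d) q = (c, [u, v])"
  proof
    assume "edge p y w = (a, [u, w]) \<and> edge w z q = (b, [w, v])"
    then have "y = (a, False)" "z = (b, False)" "p = u" "q = v"
      using pq by (auto simp: edge_def prod_eq_iff split: if_splits)
    then show ?thesis using that[of False] by (simp add: edge_def)
  next
    assume "edge p y w = (b, [w, v]) \<and> edge w z q = (a, [u, w])"
    then have "y = (b, True)" "z = (a, True)" "p = v" "q = u"
      using pq by (auto simp: edge_def prod_eq_iff split: if_splits)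
    then show ?thesis using that[of True] by (simp add: edge_def)
  qed
  show ?thesis
  proof (rule that[of xs1 d xs2 "p1 @ p # q # q2"])
    show "xs = xs1 @ orient d [(a, False), (b, False)] @ xs2" using xs d(1)[symmetric] by simp
    show "mset (path_edges (p1 @ p # q # q2) (xs1 @ (c, d) # xs2)) = E + {#(c, [u, v])#}"
      unfolding path_edges_middle[OF len] using E d(2) by auto
    show "hd (p1 @ p # q # q2) = hd vs" using vs by (cases p1) simp_all
    show "distinct (p1 @ p # q # q2)" "set (p1 @ p # q # q2) = set vs - {w}"
      using assms(2) vs by auto
  qed (use assms(3) vs xs in simp_all)
qed

text \<open>Pulls a walk back along an injective renaming: walks found in a substituted graph run
  through renamed nodes, while the graph of interest has the original ones.\<close>

lemma string_graph_rename:
  assumes wf: "wf_hgraph ok G" and h: "inj_on h (gV G)"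
    and ws: "distinct ws" "set ws = h ` gV G" "length ws = Suc (length xs)"
      "map h (gext G) = [hd ws, last ws]"
      "image_mset (apsnd (map h)) (mset (gE G)) = mset (path_edges ws xs)"
  shows "string_graph G xs"
proof -
  let ?g = "inv_into (gV G) h"
  have gh: "map ?g (map h us) = us" if "set us \<subseteq> gV G" for us
    using that h by (auto intro!: map_idI simp: subset_iff)
  have att: "set (snd e) \<subseteq> gV G" if "e \<in> set (gE G)" for e
    using wf that by (auto simp: wf_hgraph_def)
  have ext: "set (gext G) \<subseteq> gV G" using wf by (simp add: wf_hgraph_def)
  have "path_graph G (map ?g ws) xs"
    unfolding path_graph_def
  proof (intro conjI)
    have "inj_on ?g (set ws)" unfolding ws(2) by (simp add: inj_on_inv_into)
    then show "distinct (map ?g ws)" using ws(1) by (simp add: distinct_map)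
    show "set (map ?g ws) = gV G" using h ws(2) by (simp add: image_image)
    show "length (map ?g ws) = Suc (length xs)" using ws(3) by simp
    have "ws \<noteq> []" using ws(3) by auto
    then show "gext G = [hd (map ?g ws), last (map ?g ws)]"
      using gh[OF ext] unfolding ws(4) by (simp add: hd_map last_map)
    have "mset (path_edges (map ?g ws) xs) = image_mset (apsnd (map ?g)) (mset (path_edges ws xs))"
      by (simp add: path_edges_map[symmetric])
    also have "\<dots> = image_mset (\<lambda>e. e) (mset (gE G))"
      unfolding ws(5)[symmetric] image_mset.compositionality
      using gh[OF att] by (intro image_mset_cong) (auto simp: prod_eq_iff)
    finally show "mset (gE G) = mset (path_edges (map ?g ws) xs)" by simp
  qed
  then show ?thesis by (auto simp: string_graph_def)
qed

section \<open>Reading off the parts of a substituted path\<close>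

lemma rename_handle:
  assumes "F j = handle l (length (att G j))"
  shows "map (rename G F j) [0..<length (att G j)] = map old_node (att G j)"
proof (rule nth_equalityI)
  fix i assume "i < length (map (rename G F j) [0..<length (att G j)])"
  then have i: "i < length (att G j)" by simp
  have "map_of (zip [0..<length (att G j)] (att G j)) ([0..<length (att G j)] ! i) = Some (att G j ! i)"
    by (rule map_of_zip_nth) (use i in simp_all)
  then show "map (rename G F j) [0..<length (att G j)] ! i = map old_node (att G j) ! i"
    using i by (simp add: rename_def assms handle_def)
qed simp

lemma sum_singleton_mset: "finite A \<Longrightarrow> (\<Sum>x\<in>A. {#f x#}) = image_mset f (mset_set A)"
  by (induction A rule: finite_induct) auto

text \<open>All edges but \<open>e\<close> get handles, which at most relabel them. The labels
  \<open>l\<close> are kept apart from \<open>lab G\<close> to cover both \<open>repl\<close> and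
  the premise of \<open>divR\<close>, where the option is stripped from the labels of
  \<open>D\<close>.\<close>

lemma hsubst_one_edge:
  assumes e: "e < length (gE G)" and att: "\<And>j. j < length (gE G) \<Longrightarrow> set (att G j) \<subseteq> gV G"
    and Fs: "Fs = (\<lambda>j. if j = e then F else handle (l j) (length (att G j)))"
  shows "mset (gE (hsubst G Fs)) = image_mset (apsnd (map (rename G Fs e))) (mset (gE F)) +
      image_mset (\<lambda>j. (l j, map old_node (att G j))) (mset_set ({..<length (gE G)} - {e}))"
    "gV (hsubst G Fs) = old_node ` gV G \<union> rename G Fs e ` gV F"
proof -
  let ?n = "length (gE G)" and ?M = "\<lambda>j. mset (map (apsnd (map (rename G Fs j))) (gE (Fs j)))"
  have other: "?M j = {#(l j, map old_node (att G j))#}" if "j \<noteq> e" for j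
    using that rename_handle[of Fs j "l j" G] by (simp add: Fs handle_def)
  have "mset (gE (hsubst G Fs)) = (\<Sum>j\<leftarrow>[0..<?n]. ?M j)"
    by (simp add: hsubst_simps mset_concat comp_def)
  also have "\<dots> = (\<Sum>j\<in>{..<?n}. ?M j)"
    by (simp add: sum_list_distinct_conv_sum_set lessThan_atLeast0)
  also have "\<dots> = ?M e + (\<Sum>j\<in>{..<?n} - {e}. ?M j)"
    using e by (intro sum.remove) auto
  also have "(\<Sum>j\<in>{..<?n} - {e}. ?M j) = (\<Sum>j\<in>{..<?n} - {e}. {#(l j, map old_node (att G j))#})"
    using other by (intro sum.cong) auto
  finally show "mset (gE (hsubst G Fs)) = image_mset (apsnd (map (rename G Fs e))) (mset (gE F)) +
      image_mset (\<lambda>j. (l j, map old_node (att G j))) (mset_set ({..<length (gE G)} - {e}))"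
    by (simp add: sum_singleton_mset Fs)
  have "rename G Fs j ` gV (Fs j) \<subseteq> old_node ` gV G" if "j < ?n" "j \<noteq> e" for j
  proof -
    have "rename G Fs j ` gV (Fs j) = set (map (rename G Fs j) [0..<length (att G j)])"
      using that(2) by (simp add: Fs handle_def)
    also have "\<dots> = old_node ` set (att G j)"
      using that(2) rename_handle[of Fs j "l j" G] by (simp add: Fs del: set_upt)
    finally show ?thesis using att[OF that(1)] by (simp add: image_mono)
  qed
  moreover have "(\<Union>j<?n. rename G Fs j ` gV (Fs j))
      = rename G Fs e ` gV (Fs e) \<union> (\<Union>j\<in>{..<?n} - {e}. rename G Fs j ` gV (Fs j))"
    using e by auto
  ultimately show "gV (hsubst G Fs) = old_node ` gV G \<union> rename G Fs e ` gV F"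
    unfolding hsubst_simps by (auto simp: Fs)
qed

text \<open>\<open>E\<close> collects the edges that the replacement leaves in place, so the edges
  before and after differ only in the other summand. The map \<open>r\<close> sends inner nodes of
  \<open>F\<close> outside the range of \<open>old_node\<close>.\<close>

lemma repl_edges:
  assumes wf: "wf_hgraph ok G" and e: "e < length (gE G)" and att: "att G e = [u, v]"
    and ext: "gext F = [s, t]" "s \<noteq> t"
  obtains r E where "r s = old_node u" "r t = old_node v"
    "\<forall>w. w \<noteq> s \<longrightarrow> w \<noteq> t \<longrightarrow> r w \<notin> range old_node"
    "mset (gE (repl G e F)) = image_mset (apsnd (map r)) (mset (gE F)) + E"
    "image_mset (apsnd (map old_node)) (mset (gE G)) = E + {#(lab G e, [old_node u, old_node v])#}"
    "gV (repl G e F) = old_node ` gV G \<union> r ` gV F" "gext (repl G e F) = map old_node (gext G)"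
proof -
  define Fs where "Fs = (\<lambda>j. if j = e then F else handle (lab G j) (length (att G j)))"
  let ?n = "length (gE G)"
  define E where "E = image_mset (\<lambda>j. (lab G j, map old_node (att G j))) (mset_set ({..<?n} - {e}))"
  have att_sub: "set (att G j) \<subseteq> gV G" if "j < ?n" for j
    using wf nth_mem[OF that] by (simp add: wf_hgraph_def att_def)
  have repl: "repl G e F = hsubst G Fs" by (simp add: repl_def Fs_def)
  have "gext (Fs e) = [s, t]" using ext by (simp add: Fs_def)
  note r = rename_ext[where F = Fs and G = G, OF this att ext(2)]
  have "image_mset (apsnd (map old_node)) (mset (gE G))
    = image_mset (apsnd (map old_node)) (mset (map (\<lambda>j. gE G ! j) [0..<?n]))"
    by (simp add: map_nth)
  also have "\<dots> = image_mset (\<lambda>j. (lab G j, map old_node (att G j))) (mset_set {..<?n})"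
    by (auto simp: lab_def att_def image_mset.compositionality lessThan_atLeast0 prod_eq_iff
        intro!: image_mset_cong)
  also have "mset_set {..<?n} = add_mset e (mset_set ({..<?n} - {e}))"
    using e by (intro mset_set.remove) auto
  finally have "image_mset (apsnd (map old_node)) (mset (gE G))
    = E + {#(lab G e, [old_node u, old_node v])#}"
    by (simp add: E_def att)
  moreover have "\<forall>w. w \<noteq> s \<longrightarrow> w \<noteq> t \<longrightarrow> rename G Fs e w \<notin> range old_node"
    using r(3) by (auto simp: prod_encode_eq)
  ultimately show ?thesis
    using hsubst_one_edge[OF e att_sub Fs_def, folded E_def]
    by (intro that[OF r(1,2)]) (simp_all add: repl hsubst_simps(3))
qed

text \<open>Reads \<open>timesL\<close> for a product from premise to conclusion: the middle node of
  \<open>F\<close> becomes a fresh node that is not external and meets only the two inserted edges,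
  so the walk passes straight through it and the pair can be contracted.\<close>

lemma string_graph_unrepl_pair:
  assumes wf: "wf_hgraph ok G" and e: "e < length (gE G)" "length (att G e) = 2"
    and F: "string_graph F [(a, False), (b, False)]"
    and K: "string_graph (repl G e F) xs"
  obtains xs1 d xs2 where "xs = xs1 @ orient d [(a, False), (b, False)] @ xs2"
    "string_graph G (xs1 @ (lab G e, d) # xs2)"
proof -
  obtain u v where uv: "att G e = [u, v]" using e(2) by (auto simp: length_Suc_conv numeral_2_eq_2)
  have "u \<in> gV G" "v \<in> gV G"
    using wf nth_mem[OF e(1)] uv by (auto simp: wf_hgraph_def att_def)
  obtain us where us: "path_graph F us [(a, False), (b, False)]"
    using F by (auto simp: string_graph_def)
  then obtain s m t where us_eq: "us = [s, m, t]" by (auto simp: path_graph_def length_Suc_conv)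
  have dist: "s \<noteq> t" "m \<noteq> s" "m \<noteq> t" and Fsimps: "gext F = [s, t]" "gV F = {s, m, t}"
    "mset (gE F) = {#(a, [s, m]), (b, [m, t])#}"
    using us unfolding path_graph_def us_eq by (auto simp: edge_def)
  obtain r E where r: "r s = old_node u" "r t = old_node v"
    "\<forall>w. w \<noteq> s \<longrightarrow> w \<noteq> t \<longrightarrow> r w \<notin> range old_node"
    "mset (gE (repl G e F)) = image_mset (apsnd (map r)) (mset (gE F)) + E"
    "image_mset (apsnd (map old_node)) (mset (gE G)) = E + {#(lab G e, [old_node u, old_node v])#}"
    "gV (repl G e F) = old_node ` gV G \<union> r ` gV F" "gext (repl G e F) = map old_node (gext G)"
    by (rule repl_edges[OF wf e(1) uv Fsimps(1) dist(1)])
  have rm: "r m \<notin> range old_node" using r(3) dist by simp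
  obtain vs where vs: "path_graph (repl G e F) vs xs" using K by (auto simp: string_graph_def)
  have "hd vs \<in> set (gext (repl G e F))" "last vs \<in> set (gext (repl G e F))"
    using vs by (simp_all add: path_graph_def)
  then have ends: "hd vs \<noteq> r m" "last vs \<noteq> r m" using rm r(7) by auto
  have "e' \<in># image_mset (apsnd (map old_node)) (mset (gE G))" if "e' \<in># E" for e'
    unfolding r(5) using that by simp
  then have fresh: "r m \<notin> set (snd e')" if "e' \<in># E" for e'
    using that rm by fastforce
  have "mset (path_edges vs xs) = E + {#(a, [old_node u, r m]), (b, [r m, old_node v])#}"
    using vs r(1,2,4) by (simp add: path_graph_def Fsimps)
  from path_edges_contract[OF this, of "lab G e"] vs ends fresh
  obtain vs' xs1 d xs2 where *: "xs = xs1 @ orient d [(a, False), (b, False)] @ xs2"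
    "distinct vs'" "set vs' = set vs - {r m}" "length vs' = Suc (length (xs1 @ (lab G e, d) # xs2))"
    "hd vs' = hd vs" "last vs' = last vs"
    "mset (path_edges vs' (xs1 @ (lab G e, d) # xs2)) = E + {#(lab G e, [old_node u, old_node v])#}"
    unfolding path_graph_def by metis
  have "string_graph G (xs1 @ (lab G e, d) # xs2)"
  proof (rule string_graph_rename[OF wf inj_old_node *(2) _ *(4)])
    have "set vs = gV (repl G e F)" using vs by (simp add: path_graph_def)
    also have "\<dots> = insert (r m) (old_node ` gV G)"
      using \<open>u \<in> gV G\<close> \<open>v \<in> gV G\<close>
      by (simp add: r(1,2,6) Fsimps insert_absorb insert_commute[of "r m"])
    moreover have "r m \<notin> old_node ` gV G"
      using rm image_mono[OF subset_UNIV, of old_node "gV G"] by blast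
    ultimately show "set vs' = old_node ` gV G"
      using *(3) by simp
    show "map old_node (gext G) = [hd vs', last vs']"
      using r(7) vs *(5,6) by (simp add: path_graph_def)
    show "image_mset (apsnd (map old_node)) (mset (gE G))
      = mset (path_edges vs' (xs1 @ (lab G e, d) # xs2))"
      using r(5) *(7) by simp
  qed
  then show ?thesis using that *(1) by blast
qed

text \<open>Here no node is added. The inserted edge joins the same two nodes the other way round,
  so the walk stays and one sign is negated.\<close>

lemma string_graph_unrepl_reversed:
  assumes wf: "wf_hgraph ok G" and e: "e < length (gE G)" "length (att G e) = 2"
    and F: "string_graph F [(a, True)]"
    and K: "string_graph (repl G e F) xs"
  obtains xs1 d xs2 where "xs = xs1 @ orient d [(a, True)] @ xs2"
    "string_graph G (xs1 @ (lab G e, d) # xs2)"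
proof -
  obtain u v where uv: "att G e = [u, v]" using e(2) by (auto simp: length_Suc_conv numeral_2_eq_2)
  have "u \<in> gV G" "v \<in> gV G"
    using wf nth_mem[OF e(1)] uv by (auto simp: wf_hgraph_def att_def)
  obtain us where us: "path_graph F us [(a, True)]"
    using F by (auto simp: string_graph_def)
  then obtain s t where us_eq: "us = [s, t]" by (auto simp: path_graph_def length_Suc_conv)
  have dist: "s \<noteq> t" and Fsimps: "gext F = [s, t]" "gV F = {s, t}" "mset (gE F) = {#(a, [t, s])#}"
    using us unfolding path_graph_def us_eq by (auto simp: edge_def)
  obtain r E where r: "r s = old_node u" "r t = old_node v"
    "mset (gE (repl G e F)) = image_mset (apsnd (map r)) (mset (gE F)) + E"
    "image_mset (apsnd (map old_node)) (mset (gE G)) = E + {#(lab G e, [old_node u, old_node v])#}"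
    "gV (repl G e F) = old_node ` gV G \<union> r ` gV F" "gext (repl G e F) = map old_node (gext G)"
    using repl_edges[OF wf e(1) uv Fsimps(1) dist] by metis
  obtain vs where vs: "path_graph (repl G e F) vs xs" using K by (auto simp: string_graph_def)
  then have len: "length vs = Suc (length xs)" by (simp add: path_graph_def)
  have "mset (path_edges vs xs)
    = E + {#(a, if True then [old_node v, old_node u] else [old_node u, old_node v])#}"
    using vs r(1-3) by (simp add: path_graph_def Fsimps)
  from path_edges_relabel[OF this len, of "lab G e"]
  obtain xs1 d xs2 where *: "xs = xs1 @ (a, True \<noteq> d) # xs2"
    "mset (path_edges vs (xs1 @ (lab G e, d) # xs2)) = E + {#(lab G e, [old_node u, old_node v])#}"
    by metis
  have "string_graph G (xs1 @ (lab G e, d) # xs2)"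
  proof (rule string_graph_rename[OF wf inj_old_node, of vs])
    have "set vs = gV (repl G e F)" using vs by (simp add: path_graph_def)
    also have "\<dots> = old_node ` gV G"
      using \<open>u \<in> gV G\<close> \<open>v \<in> gV G\<close> by (simp add: r(1,2,5) Fsimps insert_absorb)
    finally show "set vs = old_node ` gV G" .
    show "map old_node (gext G) = [hd vs, last vs]" "distinct vs"
      using r(6) vs by (simp_all add: path_graph_def)
    show "image_mset (apsnd (map old_node)) (mset (gE G))
      = mset (path_edges vs (xs1 @ (lab G e, d) # xs2))"
      using r(4) *(2) by simp
    show "length vs = Suc (length (xs1 @ (lab G e, d) # xs2))" using len *(1) by simp
  qed
  moreover have "orient d [(a, True)] = [(a, True \<noteq> d)]" by (cases d) simp_all
  ultimately show ?thesis using that[of xs1 d xs2] *(1) by simp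
qed

text \<open>Shared by both divisions: \<open>p\<close> and \<open>q\<close> are the attachment nodes
  of the edge that \<open>F\<close> replaces, and \<open>z\<close> is the remaining node of
  \<open>D\<close>. It lies outside the copy of \<open>F\<close>, so at most the other edge
  \<open>j\<close> meets it.\<close>

lemma hsubst_div_premise:
  assumes D: "{..<length (gE D)} = {i, j}" "i \<noteq> j" "att D i = [p, q]" "set (att D j) \<subseteq> {p, q, z}"
      "gV D = {p, q, z}" "distinct [p, q, z]"
    and F: "wf_hgraph ok F" "length (gext F) = 2"
    and K: "K = hsubst D (\<lambda>k. if k = i then F else handle (the (lab D k)) (length (att D k)))"
  obtains r where "inj r" "map r (gext F) = [old_node p, old_node q]" "old_node z \<notin> range r"
    "mset (gE K)
      = image_mset (apsnd (map r)) (mset (gE F)) + {#(the (lab D j), map old_node (att D j))#}"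
    "gV K = insert (old_node z) (r ` gV F)"
proof -
  define Fs where "Fs = (\<lambda>k. if k = i then F else handle (the (lab D k)) (length (att D k)))"
  obtain s t where st: "gext F = [s, t]" using F(2) by (auto simp: length_Suc_conv numeral_2_eq_2)
  have "s \<noteq> t" and st_in: "s \<in> gV F" "t \<in> gV F" using F(1) st by (auto simp: wf_hgraph_def)
  have ext: "gext (Fs i) = [s, t]" using st by (simp add: Fs_def)
  note r = rename_ext[where F = Fs and G = D, OF ext D(3) \<open>s \<noteq> t\<close>]
  have "i \<in> {..<length (gE D)}" unfolding D(1) by simp
  then have i: "i < length (gE D)" by simp
  have att: "set (att D k) \<subseteq> gV D" if "k < length (gE D)" for k
  proof -
    have "k = i \<or> k = j" using that D(1) by blast
    then show ?thesis using D(3,4,5) by auto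
  qed
  have "{..<length (gE D)} - {i} = {j}" using D(1,2) by auto
  note E = hsubst_one_edge[OF i att Fs_def, unfolded this]
  show ?thesis
  proof (rule that[of "rename D Fs i"])
    show "inj (rename D Fs i)"
      using rename_inj[where F = Fs and G = D, OF ext D(3) \<open>s \<noteq> t\<close>] D(6) by simp
    show "map (rename D Fs i) (gext F) = [old_node p, old_node q]" using st r by simp
    have "rename D Fs i w \<noteq> old_node z" for w
    proof (cases "w = s \<or> w = t")
      case True
      then show ?thesis using r(1,2) D(6) by (auto simp: prod_encode_eq)
    next
      case False
      then show ?thesis using r(3)[of w] by (simp add: prod_encode_eq)
    qed
    then show "old_node z \<notin> range (rename D Fs i)" by (metis imageE)
    show "mset (gE K) = image_mset (apsnd (map (rename D Fs i))) (mset (gE F))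
      + {#(the (lab D j), map old_node (att D j))#}"
      using E(1) by (simp add: K Fs_def[symmetric])
    have "old_node p \<in> rename D Fs i ` gV F" "old_node q \<in> rename D Fs i ` gV F"
      using r(1,2) st_in by (metis imageI)+
    then show "gV K = insert (old_node z) (rename D Fs i ` gV F)"
      using E(2) D(5) by (simp add: K Fs_def[symmetric] insert_absorb)
  qed
qed

lemma path_order_pair_edges:
  assumes "path_order D [(x, False), (y, False)] [i, j]"
  obtains a b c where "distinct [a, b, c]" "gV D = {a, b, c}" "gext D = [a, c]"
    "att D i = [a, b]" "att D j = [b, c]"
proof -
  obtain vs where vs: "path_graph D vs [(x, False), (y, False)]"
    "map ((!) (gE D)) [i, j] = path_edges vs [(x, False), (y, False)]"
    using assms by (auto simp: path_order_def)
  then obtain a b c where abc: "vs = [a, b, c]" by (auto simp: path_graph_def length_Suc_conv)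
  show ?thesis
    by (rule that[of a b c]) (use vs in \<open>simp_all add: path_graph_def abc att_def edge_def\<close>)
qed

text \<open>The right end \<open>c\<close> of \<open>D\<close> is external and meets only the edge
  labelled \<open>t\<close>, so the walk ends with that letter; what precedes it is a walk of
  \<open>F\<close>.\<close>

lemma string_graph_over_premise:
  assumes D: "string_graph D [(None, False), (Some t, False)]"
    and d0: "d0 < length (gE D)" "lab D d0 = None"
    and F: "wf_hgraph ok F" "length (gext F) = 2"
    and K: "string_graph (hsubst D (\<lambda>k. if k = d0 then F else handle (the (lab D k)) (length (att D k)))) xs"
  obtains xs' where "xs = xs' @ [(t, False)]" "string_graph F xs'"
proof -
  obtain i j where ij: "path_order D [(None, False), (Some t, False)] [i, j]" "i \<noteq> j"
      "{..<length (gE D)} = {i, j}" "lab D i = None" "lab D j = Some t"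
    using path_order_pair[OF D] by (metis fst_conv)
  have "d0 \<in> {i, j}" unfolding ij(3)[symmetric] using d0(1) by simp
  then have d0i: "d0 = i" using d0(2) ij(5) by auto
  obtain a b c where abc: "distinct [a, b, c]" "gV D = {a, b, c}" "gext D = [a, c]"
    "att D i = [a, b]" "att D j = [b, c]"
    using path_order_pair_edges[OF ij(1)] .
  let ?K = "hsubst D (\<lambda>k. if k = i then F else handle (the (lab D k)) (length (att D k)))"
  obtain r where r: "inj r" "map r (gext F) = [old_node a, old_node b]" "old_node c \<notin> range r"
    "mset (gE ?K) = image_mset (apsnd (map r)) (mset (gE F)) + {#(the (lab D j), map old_node (att D j))#}"
    "gV ?K = insert (old_node c) (r ` gV F)"
    by (rule hsubst_div_premise[OF ij(3,2) abc(4) _ abc(2,1) F refl]) (use abc in auto)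
  obtain ws where ws: "path_graph ?K ws xs" using K by (auto simp: string_graph_def d0i)
  then have ext: "hd ws = old_node a" "last ws = old_node c"
    using abc(3) by (auto simp: path_graph_def hsubst_simps)
  have bc: "old_node b \<noteq> old_node c" using abc(1) by (simp add: prod_encode_eq)
  have "mset (path_edges ws xs)
    = image_mset (apsnd (map r)) (mset (gE F)) + {#edge (old_node b) (t, False) (old_node c)#}"
    using ws r(4) abc(5) ij(5) by (simp add: path_graph_def edge_def)
  moreover have "old_node c \<notin> set (snd e)" if "e \<in># image_mset (apsnd (map r)) (mset (gE F))" for e
    using that r(3) by auto
  moreover have "distinct ws" "length ws = Suc (length xs)" using ws by (simp_all add: path_graph_def)
  ultimately obtain ws' xs' where *: "ws = ws' @ [old_node c]" "xs = xs' @ [(t, False)]" "ws' \<noteq> []"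
      "last ws' = old_node b" "mset (path_edges ws' xs') = image_mset (apsnd (map r)) (mset (gE F))"
    using path_edges_strip_last[OF _ _ _ ext(2) bc] by metis
  have "string_graph F xs'"
  proof (rule string_graph_rename[OF F(1), of r ws'])
    show "inj_on r (gV F)" using r(1) by (rule inj_on_subset) simp
    show "distinct ws'" "length ws' = Suc (length xs')"
      using ws *(1,2) by (auto simp: path_graph_def)
    have "set ws' = set ws - {old_node c}"
      using ws *(1) by (auto simp: path_graph_def)
    also have "set ws = insert (old_node c) (r ` gV F)"
      using ws r(5) by (simp add: path_graph_def)
    also have "\<dots> - {old_node c} = r ` gV F"
      using r(3) by (metis Diff_insert_absorb imageE rangeI)
    finally show "set ws' = r ` gV F" .
    show "map r (gext F) = [hd ws', last ws']" using r(2) ext(1) * by simp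
    show "image_mset (apsnd (map r)) (mset (gE F)) = mset (path_edges ws' xs')" using *(5) by simp
  qed
  then show ?thesis using that *(2) by blast
qed

text \<open>Mirror image: the argument edge comes first and \<open>c\<close> is the start of the
  walk.\<close>

lemma string_graph_under_premise:
  assumes D: "string_graph D [(Some t, False), (None, False)]"
    and d0: "d0 < length (gE D)" "lab D d0 = None"
    and F: "wf_hgraph ok F" "length (gext F) = 2"
    and K: "string_graph (hsubst D (\<lambda>k. if k = d0 then F else handle (the (lab D k)) (length (att D k)))) xs"
  obtains xs' where "xs = (t, False) # xs'" "string_graph F xs'"
proof -
  obtain j i where ij: "path_order D [(Some t, False), (None, False)] [j, i]" "j \<noteq> i"
      "{..<length (gE D)} = {j, i}" "lab D j = Some t" "lab D i = None"
    using path_order_pair[OF D] by (metis fst_conv)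
  have "d0 \<in> {j, i}" unfolding ij(3)[symmetric] using d0(1) by simp
  then have d0i: "d0 = i" using d0(2) ij(4) by auto
  obtain c a b where abc: "distinct [c, a, b]" "gV D = {c, a, b}" "gext D = [c, b]"
    "att D j = [c, a]" "att D i = [a, b]"
    using path_order_pair_edges[OF ij(1)] .
  let ?K = "hsubst D (\<lambda>k. if k = i then F else handle (the (lab D k)) (length (att D k)))"
  have n: "{..<length (gE D)} = {i, j}" "i \<noteq> j" using ij(2,3) by auto
  have V: "gV D = {a, b, c}" "distinct [a, b, c]" using abc(1,2) by auto
  obtain r where r: "inj r" "map r (gext F) = [old_node a, old_node b]" "old_node c \<notin> range r"
    "mset (gE ?K) = image_mset (apsnd (map r)) (mset (gE F)) + {#(the (lab D j), map old_node (att D j))#}"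
    "gV ?K = insert (old_node c) (r ` gV F)"
    by (rule hsubst_div_premise[OF n abc(5) _ V F refl]) (use abc in auto)
  obtain ws where ws: "path_graph ?K ws xs" using K by (auto simp: string_graph_def d0i)
  then have ext: "hd ws = old_node c" "last ws = old_node b"
    using abc(3) by (auto simp: path_graph_def hsubst_simps)
  have ac: "old_node a \<noteq> old_node c" using abc(1) by (auto simp: prod_encode_eq)
  have "mset (path_edges ws xs)
    = image_mset (apsnd (map r)) (mset (gE F)) + {#edge (old_node c) (t, False) (old_node a)#}"
    using ws r(4) abc(4) ij(4) by (simp add: path_graph_def edge_def)
  moreover have "old_node c \<notin> set (snd e)" if "e \<in># image_mset (apsnd (map r)) (mset (gE F))" for e
    using that r(3) by auto
  moreover have "distinct ws" "length ws = Suc (length xs)" using ws by (simp_all add: path_graph_def)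
  ultimately obtain ws' xs' where *: "ws = old_node c # ws'" "xs = (t, False) # xs'" "ws' \<noteq> []"
      "hd ws' = old_node a" "mset (path_edges ws' xs') = image_mset (apsnd (map r)) (mset (gE F))"
    using path_edges_strip_first[OF _ _ _ ext(1) ac] by metis
  have "string_graph F xs'"
  proof (rule string_graph_rename[OF F(1), of r ws'])
    show "inj_on r (gV F)" using r(1) by (rule inj_on_subset) simp
    show "distinct ws'" "length ws' = Suc (length xs')"
      using ws *(1,2) by (auto simp: path_graph_def)
    have "set ws' = set ws - {old_node c}"
      using ws *(1) by (auto simp: path_graph_def)
    also have "set ws = insert (old_node c) (r ` gV F)"
      using ws r(5) by (simp add: path_graph_def)
    also have "\<dots> - {old_node c} = r ` gV F"
      using r(3) by (metis Diff_insert_absorb imageE rangeI)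
    finally show "set ws' = r ` gV F" .
    show "map r (gext F) = [hd ws', last ws']" using r(2) ext(2) * by simp
    show "image_mset (apsnd (map r)) (mset (gE F)) = mset (path_edges ws' xs')" using *(5) by simp
  qed
  then show ?thesis using that *(2) by blast
qed

section \<open>Translated types\<close>

lemma graph_iso_wf:
  assumes "graph_iso R G H" "wf_hgraph ok G" "\<And>l l' k. R l l' \<Longrightarrow> ok l k \<Longrightarrow> ok' l' k"
  shows "wf_hgraph ok' H"
proof -
  obtain f es where *: "bij_betw f (gV G) (gV H)" "gext H = map f (gext G)"
    "mset es = mset (gE H)" "list_all2 (\<lambda>(l, a) (l', a'). R l l' \<and> a' = map f a) (gE G) es"
    using assms(1) by (auto simp: graph_iso_iff)
  have im: "f ` gV G = gV H" and inj: "inj_on f (gV G)" using *(1) by (auto simp: bij_betw_def)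
  have "distinct (snd y) \<and> set (snd y) \<subseteq> gV H \<and> ok' (fst y) (length (snd y))"
    if "y \<in> set (gE H)" for y
  proof -
    have "y \<in> set es" using that *(3) mset_eq_setD by blast
    then obtain i where "i < length es" "y = es ! i" by (auto simp: in_set_conv_nth)
    then have i: "i < length (gE G)" "R (fst (gE G ! i)) (fst y)" "snd y = map f (snd (gE G ! i))"
      using *(4) by (auto simp: list_all2_conv_all_nth split_beta)
    define x where "x = gE G ! i"
    have x: "x \<in> set (gE G)" "R (fst x) (fst y)" "snd y = map f (snd x)"
      using i by (simp_all add: x_def)
    then have "distinct (snd x)" "set (snd x) \<subseteq> gV G" "ok (fst x) (length (snd x))"
      using assms(2) by (auto simp: wf_hgraph_def)
    then show ?thesis
      using x(2,3) assms(3) im inj_on_subset[OF inj] image_mono[of "set (snd x)" "gV G" f]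
      by (simp add: distinct_map)
  qed
  moreover have "finite (gV H)" using *(1) assms(2) bij_betw_finite by (auto simp: wf_hgraph_def)
  moreover have "distinct (gext H)" "set (gext H) \<subseteq> gV H"
    using assms(2) *(2) im inj_on_subset[OF inj] by (auto simp: wf_hgraph_def distinct_map)
  ultimately show ?thesis by (simp add: wf_hgraph_def)
qed

text \<open>The node map is injective only on \<open>gV G\<close>, so inverting it needs the
  attachments to lie there. Labels have to be reversible only where \<open>ok\<close> holds, which
  is the form in which the induction of \<open>tp_eq_wf\<close> supplies it.\<close>

lemma graph_iso_sym:
  assumes "graph_iso R G H" "wf_hgraph ok G" "\<And>l l' k. R l l' \<Longrightarrow> ok l k \<Longrightarrow> S l' l"
  shows "graph_iso S H G"
proof -
  obtain f es where *: "bij_betw f (gV G) (gV H)" "gext H = map f (gext G)"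
    "mset es = mset (gE H)" "list_all2 (\<lambda>(l, a) (l', a'). R l l' \<and> a' = map f a) (gE G) es"
    using assms(1) by (auto simp: graph_iso_iff)
  let ?g = "inv_into (gV G) f"
  have gf: "map ?g (map f us) = us" if "set us \<subseteq> gV G" for us
    using that *(1) by (auto intro!: map_idI simp: bij_betw_def subset_iff)
  have "list_all2 (\<lambda>(l, a) (l', a'). S l l' \<and> a' = map ?g a) es (gE G)"
    unfolding list_all2_conv_all_nth
  proof (intro conjI allI impI)
    show "length es = length (gE G)" using *(4) list_all2_lengthD by fastforce
    fix i assume "i < length es"
    then have i: "i < length (gE G)" using *(4) list_all2_lengthD by fastforce
    then have "set (snd (gE G ! i)) \<subseteq> gV G" "ok (fst (gE G ! i)) (length (snd (gE G ! i)))"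
      using assms(2) nth_mem[OF i] unfolding wf_hgraph_def by blast+
    moreover have "R (fst (gE G ! i)) (fst (es ! i))" "snd (es ! i) = map f (snd (gE G ! i))"
      using *(4) i by (auto simp: list_all2_conv_all_nth split_beta)
    ultimately show "(\<lambda>(l, a) (l', a'). S l l' \<and> a' = map ?g a) (es ! i) (gE G ! i)"
      using gf[of "snd (gE G ! i)"] assms(3) by (simp add: split_beta del: map_map)
  qed
  then obtain es' where "list_all2 (\<lambda>(l, a) (l', a'). S l l' \<and> a' = map ?g a) (gE H) es'"
    "mset es' = mset (gE G)"
    using list_all2_reorder_left_invariance[OF _ *(3)[symmetric]] by blast
  moreover have "bij_betw ?g (gV H) (gV G)" using *(1) by (rule bij_betw_inv_into)
  moreover have "gext G = map ?g (gext H)"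
    using gf[of "gext G"] assms(2) by (simp add: *(2) wf_hgraph_def)
  ultimately show ?thesis unfolding graph_iso_iff by blast
qed

text \<open>Three label relations instead of one: inside the induction of \<open>tp_eq_trans\<close>
  the relation \<open>R\<close> contains the induction hypothesis.\<close>

lemma graph_iso_trans:
  assumes "graph_iso R G H" "graph_iso S H K" "\<And>x y z. R x y \<Longrightarrow> S y z \<Longrightarrow> T x z"
  shows "graph_iso T G K"
proof -
  obtain f s where f: "bij_betw f (gV G) (gV H)" "length (gE H) = length (gE G)"
    "bij_betw s {..<length (gE G)} {..<length (gE H)}" "gext H = map f (gext G)"
    "\<And>i. i < length (gE G) \<Longrightarrow> R (lab G i) (lab H (s i)) \<and> att H (s i) = map f (att G i)"
    using assms(1) unfolding graph_iso_def by blast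
  obtain g t where g: "bij_betw g (gV H) (gV K)" "length (gE K) = length (gE H)"
    "bij_betw t {..<length (gE H)} {..<length (gE K)}" "gext K = map g (gext H)"
    "\<And>i. i < length (gE H) \<Longrightarrow> S (lab H i) (lab K (t i)) \<and> att K (t i) = map g (att H i)"
    using assms(2) unfolding graph_iso_def by blast
  have s: "s i < length (gE H)" if "i < length (gE G)" for i
    using f(3) that by (auto simp: bij_betw_def)
  show ?thesis
    unfolding graph_iso_def
  proof (rule exI[of _ "g \<circ> f"], rule exI[of _ "t \<circ> s"], intro conjI allI impI)
    fix i assume i: "i < length (gE G)"
    show "T (lab G i) (lab K ((t \<circ> s) i))" "att K ((t \<circ> s) i) = map (g \<circ> f) (att G i)"
      using f(5)[OF i] g(5)[OF s[OF i]] assms(3) by auto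
  qed (use f g bij_betw_trans in auto)
qed

lemma genstr_iso_iff:
  "graph_iso R (genstr xs) (genstr ys) \<longleftrightarrow> list_all2 (rel_prod R (=)) xs ys"
  using string_graph_iso[OF string_graph_genstr] string_graph_unique[OF string_graph_genstr]
    graph_iso_string_graph[OF string_graph_genstr string_graph_genstr] by metis

abbreviation lab_eq :: "'p htp option \<Rightarrow> 'p htp option \<Rightarrow> bool" where
  "lab_eq \<equiv> \<lambda>l l'. (l = None \<and> l' = None) \<or> (\<exists>t t'. l = Some t \<and> l' = Some t' \<and> tp_eq t t')"

inductive_cases tp_eq_PrimE: "tp_eq (HPrim p n) t"
inductive_cases tp_eq_DivE: "tp_eq (HDiv N D) t"
inductive_cases tp_eq_TimesE: "tp_eq (HTimes M) t"
inductive_cases wf_tp_DivE: "wf_tp (HDiv N D)"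
inductive_cases wf_tp_TimesE: "wf_tp (HTimes M)"

text \<open>\<open>tarity\<close> takes the first edge labelled \<open>None\<close> in list order.
  As there is only one, the value does not depend on the order.\<close>

lemma tarity_HDiv:
  assumes "length (filter (\<lambda>x. fst x = None) (gE D)) = 1" "x \<in> set (gE D)" "fst x = None"
  shows "tarity (HDiv N D) = length (snd x)"
proof -
  obtain z where z: "filter (\<lambda>x. fst x = None) (gE D) = [z]"
    using assms(1) by (auto simp: length_Suc_conv)
  have uniq: "y = z" if "y \<in> set (gE D)" "fst y = None" for y
  proof -
    have "y \<in> set (filter (\<lambda>x. fst x = None) (gE D))" using that by simp
    then show ?thesis unfolding z by simp
  qed
  obtain y where y: "find (\<lambda>x. fst x = None) (gE D) = Some y"
    using assms(2,3) by (metis (mono_tags, lifting) find_None_iff not_Some_eq)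
  then have "y \<in> set (gE D)" "fst y = None"
    by (auto simp: find_Some_iff)
  then show ?thesis
    using y uniq assms(2,3) by (simp add: tarity_def) metis
qed

lemma graph_iso_filter_None:
  assumes "graph_iso R G H" "\<And>l l'. R l l' \<Longrightarrow> (l = None) = (l' = None)"
  shows "length (filter (\<lambda>x. fst x = None) (gE H)) = length (filter (\<lambda>x. fst x = None) (gE G))"
proof -
  obtain f es where *: "mset es = mset (gE H)"
    "list_all2 (\<lambda>(l, a) (l', a'). R l l' \<and> a' = map f a) (gE G) es"
    using assms(1) by (auto simp: graph_iso_iff)
  have "list_all2 (\<lambda>x y. (fst x = None) = (fst y = None)) (gE G) es"
    using *(2) by (rule list_all2_mono) (use assms(2) in \<open>simp add: split_beta\<close>)
  then have "length (filter (\<lambda>x. fst x = None) (gE G)) = length (filter (\<lambda>x. fst x = None) es)"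
    by (induction rule: list_all2_induct) auto
  moreover have "length (filter (\<lambda>x. fst x = None) es) = length (filter (\<lambda>x. fst x = None) (gE H))"
    using *(1) by (metis mset_filter size_mset)
  ultimately show ?thesis by simp
qed

lemma graph_iso_ext: "graph_iso R G H \<Longrightarrow> length (gext H) = length (gext G)"
  by (auto simp: graph_iso_def)

text \<open>Symmetry goes together with well-formedness because inverting an isomorphism of the
  inner graphs needs their attachments inside the node set. Arity joins the induction because
  well-formedness of a graph mentions the arities of its labels.\<close>

lemma tp_eq_wf:
  "tp_eq t t' \<Longrightarrow> wf_tp t \<Longrightarrow> wf_tp t' \<and> tarity t' = tarity t \<and> tp_eq t' t"
proof (induction rule: tp_eq.induct)
  case (1 p n)
  then show ?case by (auto intro: tp_eq.intros)
next
  case (2 N N' D D')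
  let ?R = "\<lambda>l l'. (l = None \<and> l' = None) \<or> (\<exists>t t'. l = Some t \<and> l' = Some t' \<and>
    tp_eq t t' \<and> (wf_tp t \<longrightarrow> wf_tp t' \<and> tarity t' = tarity t \<and> tp_eq t' t))"
  let ?ok = "\<lambda>l k. l = None \<or> (\<exists>t. l = Some t \<and> wf_tp t \<and> tarity t = k)"
  have iso: "graph_iso ?R D D'" using 2(3) by simp
  have wf: "wf_tp N" "wf_hgraph ?ok D" "length (filter (\<lambda>x. fst x = None) (gE D)) = 1"
    "tarity N = length (gext D)"
    using 2(4) by (auto elim: wf_tp_DivE)
  have N: "wf_tp N'" "tarity N' = tarity N" "tp_eq N' N" using 2(2) wf(1) by auto
  have wfD': "wf_hgraph ?ok D'" by (rule graph_iso_wf[OF iso wf(2)]) auto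
  have one: "length (filter (\<lambda>x. fst x = None) (gE D')) = 1"
    using graph_iso_filter_None[OF iso] wf(3) by auto
  have "graph_iso lab_eq D' D" by (rule graph_iso_sym[OF iso wf(2)]) auto
  moreover have "wf_tp (HDiv N' D')"
    using N wfD' one wf(4) graph_iso_ext[OF iso] by (auto intro: wf_tp.intros)
  moreover have "tarity (HDiv N' D') = tarity (HDiv N D)"
  proof -
    obtain f es where *: "mset es = mset (gE D')"
      "list_all2 (\<lambda>(l, a) (l', a'). ?R l l' \<and> a' = map f a) (gE D) es"
      using iso unfolding graph_iso_iff by blast
    obtain z where "filter (\<lambda>x. fst x = None) (gE D) = [z]"
      using wf(3) by (auto simp: length_Suc_conv)
    then have "z \<in> set (filter (\<lambda>x. fst x = None) (gE D))" by simp
    then have z: "z \<in> set (gE D)" "fst z = None" by auto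
    then obtain i where i: "i < length (gE D)" "z = gE D ! i" by (auto simp: in_set_conv_nth)
    then have R: "?R (fst z) (fst (es ! i))" "snd (es ! i) = map f (snd z)" and "i < length es"
      using *(2) by (auto simp: list_all2_conv_all_nth split_beta)
    then have "es ! i \<in> set (gE D')" using *(1) by (metis mset_eq_setD nth_mem)
    moreover have "fst (es ! i) = None" using R(1) z(2) by auto
    ultimately have "tarity (HDiv N' D') = length (snd (es ! i))" using one tarity_HDiv by blast
    then show ?thesis using R(2) tarity_HDiv[OF wf(3) z] by simp
  qed
  ultimately show ?case using N(3) by (auto intro: tp_eq.intros)
next
  case (3 M M')
  let ?R = "\<lambda>t t'. tp_eq t t' \<and> (wf_tp t \<longrightarrow> wf_tp t' \<and> tarity t' = tarity t \<and> tp_eq t' t)"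
  let ?ok = "\<lambda>t k. wf_tp t \<and> tarity t = k"
  have iso: "graph_iso ?R M M'" using 3(1) by simp
  have wf: "wf_hgraph ?ok M" using 3(2) by (auto elim: wf_tp_TimesE)
  have "wf_hgraph ?ok M'" by (rule graph_iso_wf[OF iso wf]) auto
  moreover have "graph_iso tp_eq M' M" by (rule graph_iso_sym[OF iso wf]) auto
  ultimately show ?case
    using graph_iso_ext[OF iso] by (auto intro: wf_tp.intros tp_eq.intros simp: tarity_def)
qed

lemma tp_eq_sym: "tp_eq t t' \<Longrightarrow> wf_tp t \<Longrightarrow> tp_eq t' t"
  using tp_eq_wf by blast

lemma tp_eq_trans: "tp_eq t t' \<Longrightarrow> tp_eq t' t'' \<Longrightarrow> tp_eq t t''"
proof (induction arbitrary: t'' rule: tp_eq.induct)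
  case (2 N N' D D')
  from 2(4) obtain N'' D'' where t'': "t'' = HDiv N'' D''" "tp_eq N' N''" "graph_iso lab_eq D' D''"
    by (auto elim: tp_eq_DivE)
  have "graph_iso lab_eq D D''"
    by (rule graph_iso_trans[OF 2(3) t''(3)]) auto
  then show ?case using 2(2) t''(1,2) by (auto intro: tp_eq.intros)
next
  case (3 M M')
  from 3(2) obtain M'' where t'': "t'' = HTimes M''" "graph_iso tp_eq M' M''"
    by (auto elim: tp_eq_TimesE)
  have "graph_iso tp_eq M M''"
    by (rule graph_iso_trans[OF 3(1) t''(2)]) auto
  then show ?case using t''(1) by (auto intro: tp_eq.intros)
qed

abbreviation htp_ok :: "'p htp \<Rightarrow> nat \<Rightarrow> bool" where
  "htp_ok \<equiv> \<lambda>t k. wf_tp t \<and> tarity t = k"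

lemma HL_der_wf: "HL_der G T \<Longrightarrow> hseq_wf G T"
proof (induction rule: HL_der.induct)
  case (ax p n)
  then show ?case
    by (auto simp: hseq_wf_def handle_def wf_hgraph_def tarity_def intro: wf_tp.intros)
next
  case (iso H A H' A')
  then have "wf_tp A" "wf_hgraph htp_ok H" "length (gext H) = tarity A"
    by (simp_all add: hseq_wf_def)
  moreover have "wf_hgraph htp_ok H'"
    by (rule graph_iso_wf[OF iso(2) \<open>wf_hgraph htp_ok H\<close>]) (auto dest: tp_eq_wf)
  ultimately show ?case
    using tp_eq_wf[OF iso(3)] graph_iso_ext[OF iso(2)] by (simp add: hseq_wf_def)
qed

section \<open>Translations up to isomorphism\<close>

lemma reversed_edge_genstr: "Gr {0, 1} [(l, [1, 0])] [0, 1] = genstr [(l, True)]"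
  by (auto simp: genstr_def)

lemma trR_LRev: "trR (LRev A) = HTimes (genstr [(trR A, True)])"
  by (simp add: reversed_edge_genstr[simplified])

lemma tp_eq_trR: "tp_eq (trR A) (trR A)"
proof (induction A)
  case (LRev A)
  then show ?case unfolding trR_LRev by (auto intro!: tp_eq.intros simp: genstr_iso_iff)
qed (auto intro!: tp_eq.intros simp: genstr_iso_iff)

text \<open>Isomorphic generalized strings have the same shape (\<open>genstr_iso_iff\<close>): the
  position of \<open>None\<close> tells the divisions apart, the length tells product from reversal,
  and the components follow by induction.\<close>

lemma trR_inj: "tp_eq (trR A) (trR B) \<Longrightarrow> A = B"
proof (induction A arbitrary: B)
  case (LPrim p)
  then show ?case by (cases B) (auto elim: tp_eq_PrimE)
next
  case (LUnder A1 A2)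
  from LUnder(3) show ?case
    by (cases B) (auto elim!: tp_eq_DivE simp: genstr_iso_iff dest: LUnder.IH)
next
  case (LOver A1 A2)
  from LOver(3) show ?case
    by (cases B) (auto elim!: tp_eq_DivE simp: genstr_iso_iff dest: LOver.IH)
next
  case (LProd A1 A2)
  from LProd(3) show ?case
    by (cases B) (auto elim!: tp_eq_TimesE simp: genstr_iso_iff trR_LRev dest: LProd.IH simp del: trR.simps(5))
next
  case (LRev A)
  from LRev(2) show ?case
    by (cases B) (auto elim!: tp_eq_TimesE simp: genstr_iso_iff trR_LRev dest: LRev.IH simp del: trR.simps(5))
qed

lemma wf_trR: "wf_tp (trR A) \<and> tarity (trR A) = 2"
proof -
  have div: "wf_tp (HDiv N (genstr xs)) \<and> tarity (HDiv N (genstr xs)) = 2"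
    if xs: "xs = [(None, False), (Some B, False)] \<or> xs = [(Some B, False), (None, False)]"
      and N: "wf_tp N" "tarity N = 2" and B: "wf_tp B" "tarity B = 2" for N B :: "'a htp" and xs
  proof -
    have "wf_hgraph (\<lambda>l k. l = None \<or> (\<exists>t. l = Some t \<and> wf_tp t \<and> tarity t = k)) (genstr xs)"
      by (rule string_graph_wf[OF string_graph_genstr]) (use xs B in auto)
    moreover have "length (filter (\<lambda>x. fst x = None) (gE (genstr xs))) = 1"
      using xs by (auto simp: genstr_def)
    moreover have "length (gext (genstr xs)) = 2" by (simp add: genstr_def)
    moreover have "tarity (HDiv N (genstr xs)) = 2" using xs by (auto simp: tarity_def genstr_def)
    ultimately show ?thesis using N by (auto intro: wf_tp.intros)
  qed
  have times: "wf_tp (HTimes (genstr xs)) \<and> tarity (HTimes (genstr xs)) = 2"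
    if "xs \<noteq> []" "\<And>t. t \<in> fst ` set xs \<Longrightarrow> wf_tp t \<and> tarity t = 2" for xs :: "('a htp \<times> bool) list"
  proof -
    have "wf_hgraph htp_ok (genstr xs)" by (rule string_graph_wf[OF string_graph_genstr that(1)]) (use that(2) in blast)
    then show ?thesis by (auto intro: wf_tp.intros simp: tarity_def genstr_def)
  qed
  show ?thesis
  proof (induction A)
    case (LPrim p)
    then show ?case by (auto intro: wf_tp.intros simp: tarity_def)
  next
    case (LRev A)
    then show ?case unfolding trR_LRev by (intro times) auto
  next
    case (LProd A B)
    then show ?case unfolding trR.simps by (intro times) auto
  next
    case (LUnder B A)
    then show ?case unfolding trR.simps by (intro div) auto
  next
    case (LOver A B)
    then show ?case unfolding trR.simps by (intro div) auto
  qed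
qed

text \<open>The rule \<open>iso\<close> can replace a label by an isomorphic one that is not
  literally in the range of \<open>trR\<close>, so the class has to be closed under
  \<open>tp_eq\<close>.\<close>

definition translated :: "'p htp \<Rightarrow> bool" where
  "translated t \<longleftrightarrow> (\<exists>B. tp_eq (trR B) t)"

definition untr :: "'p htp \<Rightarrow> 'p ltp" where
  "untr t = (THE B. tp_eq (trR B) t)"

lemma untr_eq: "tp_eq (trR B) t \<Longrightarrow> untr t = B"
  unfolding untr_def
proof (rule the_equality)
  assume B: "tp_eq (trR B) t"
  fix B' assume "tp_eq (trR B') t"
  moreover have "tp_eq t (trR B)" using B wf_trR by (blast intro: tp_eq_sym)
  ultimately show "B' = B" using tp_eq_trans trR_inj by blast
qed

lemma untr_trR [simp]: "untr (trR B) = B"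
  by (rule untr_eq[OF tp_eq_trR])

lemma translated_trR [simp]: "translated (trR B)"
  using tp_eq_trR by (auto simp: translated_def)

lemma translated_untr: "translated t \<Longrightarrow> tp_eq (trR (untr t)) t"
  unfolding translated_def using untr_eq by metis

lemma translated_tarity: "translated t \<Longrightarrow> tarity t = 2"
  unfolding translated_def using tp_eq_wf wf_trR by metis

lemma translated_tp_eq: "tp_eq t t' \<Longrightarrow> translated t \<Longrightarrow> translated t' \<and> untr t' = untr t"
  using translated_untr tp_eq_trans untr_eq unfolding translated_def by metis

lemma translated_tp_eq_rev: "tp_eq t t' \<Longrightarrow> wf_tp t \<Longrightarrow> translated t' \<Longrightarrow> translated t"
  using tp_eq_sym translated_tp_eq by blast

lemma translated_HPrim: "translated (HPrim p n) \<Longrightarrow> n = 2 \<and> untr (HPrim p n) = LPrim p"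
proof -
  assume t: "translated (HPrim p n)"
  then have "tp_eq (trR (untr (HPrim p n))) (HPrim p n)" by (rule translated_untr)
  then show ?thesis by (cases "untr (HPrim p n)") (auto elim: tp_eq.cases)
qed

lemma string_graph_genstr_iso:
  "graph_iso R (genstr xs) G \<Longrightarrow> \<exists>ys. string_graph G ys \<and> list_all2 (rel_prod R (=)) xs ys"
  by (rule string_graph_iso[OF string_graph_genstr])

text \<open>\<open>D\<close> is only isomorphic to the prescribed string, so the cases describe it
  as a path whose label \<open>t\<close> is again a translation up to \<open>tp_eq\<close>.\<close>

lemma translated_HDiv:
  assumes "translated (HDiv N D)"
  obtains (over) t where "translated N" "translated t"
      "string_graph D [(None, False), (Some t, False)]" "untr (HDiv N D) = LOver (untr N) (untr t)"
    | (under) t where "translated N" "translated t"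
      "string_graph D [(Some t, False), (None, False)]" "untr (HDiv N D) = LUnder (untr t) (untr N)"
proof (cases "untr (HDiv N D)")
  case (LOver A B)
  then have "tp_eq (trR (LOver A B)) (HDiv N D)" using translated_untr[OF assms] by simp
  then have N: "tp_eq (trR A) N"
    and iso: "graph_iso lab_eq (genstr [(None, False), (Some (trR B), False)]) D"
    by (auto elim: tp_eq_DivE)
  obtain t where "string_graph D [(None, False), (Some t, False)]" "tp_eq (trR B) t"
    using string_graph_genstr_iso[OF iso] by (auto simp: list_all2_Cons1 rel_prod_sel)
  then show ?thesis using over N LOver untr_eq by (metis translated_def)
next
  case (LUnder B A)
  then have "tp_eq (trR (LUnder B A)) (HDiv N D)" using translated_untr[OF assms] by simp
  then have N: "tp_eq (trR A) N"
    and iso: "graph_iso lab_eq (genstr [(Some (trR B), False), (None, False)]) D"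
    by (auto elim: tp_eq_DivE)
  obtain t where "string_graph D [(Some t, False), (None, False)]" "tp_eq (trR B) t"
    using string_graph_genstr_iso[OF iso] by (auto simp: list_all2_Cons1 rel_prod_sel)
  then show ?thesis using under N LUnder untr_eq by (metis translated_def)
qed (use translated_untr[OF assms] in \<open>auto elim: tp_eq.cases\<close>)

lemma translated_HTimes:
  assumes "translated (HTimes M)"
  obtains (prod) a b where "translated a" "translated b"
      "string_graph M [(a, False), (b, False)]" "untr (HTimes M) = LProd (untr a) (untr b)"
    | (rev) a where "translated a" "string_graph M [(a, True)]" "untr (HTimes M) = LRev (untr a)"
proof (cases "untr (HTimes M)")
  case (LProd A B)
  then have "tp_eq (trR (LProd A B)) (HTimes M)" using translated_untr[OF assms] by simp
  then have iso: "graph_iso tp_eq (genstr [(trR A, False), (trR B, False)]) M"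
    by (auto elim: tp_eq_TimesE)
  obtain a b where "string_graph M [(a, False), (b, False)]" "tp_eq (trR A) a" "tp_eq (trR B) b"
    using string_graph_genstr_iso[OF iso] by (auto simp: list_all2_Cons1 rel_prod_sel)
  then show ?thesis using prod LProd untr_eq by (metis translated_def)
next
  case (LRev A)
  then have "tp_eq (trR (LRev A)) (HTimes M)" using translated_untr[OF assms] by simp
  then have iso: "graph_iso tp_eq (genstr [(trR A, True)]) M"
    unfolding trR_LRev by (auto elim: tp_eq_TimesE)
  obtain a where "string_graph M [(a, True)]" "tp_eq (trR A) a"
    using string_graph_genstr_iso[OF iso] by (auto simp: list_all2_Cons1 rel_prod_sel)
  then show ?thesis using rev LRev untr_eq by (metis translated_def)
qed (use translated_untr[OF assms] in \<open>auto elim: tp_eq.cases\<close>)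

section \<open>From HL to L with reversal\<close>

lemma LR_der_nonempty: "LR_der Gam C \<Longrightarrow> Gam \<noteq> []"
  by (induction rule: LR_der.induct) auto

lemma LR_der_refl: "LR_der [A] A"
proof (induction A)
  case (LPrim p)
  then show ?case by (rule LR_der.ax)
next
  case (LUnder A B)
  then show ?case
    using LR_der.underR[of "[LUnder A B]" A B] LR_der.underL[of "[A]" A "[]" B "[]" B] by simp
next
  case (LOver B A)
  then show ?case
    using LR_der.overR[of "[LOver B A]" A B] LR_der.overL[of "[A]" A "[]" B "[]" B] by simp
next
  case (LProd A B)
  then show ?case
    using LR_der.prodL[of "[]" A B "[]"] LR_der.prodR[of "[A]" "[B]" A B] by simp
next
  case (LRev A)
  then show ?case using LR_der.revR by fastforce
qed

section \<open>Signed lists in L with reversal\<close>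

abbreviation brks :: "('p ltp \<times> bool) list \<Rightarrow> 'p ltp list" where
  "brks \<equiv> map (\<lambda>(A, d). brk A d)"

text \<open>A letter of negative sign becomes a double reversal under \<open>LRev\<close>, which
  \<open>rrL\<close> removes; a positive one already has the required form.\<close>

lemma LR_der_brk_flip:
  "LR_der (Gam @ map LRev (brks ys) @ Del) C \<Longrightarrow> LR_der (Gam @ brks (map (apsnd Not) ys) @ Del) C"
proof (induction ys arbitrary: Gam)
  case (Cons y ys)
  obtain A d where y: "y = (A, d)" by (cases y)
  from Cons.prems have "LR_der (Gam @ [brk A (\<not> d)] @ map LRev (brks ys) @ Del) C"
    using LR_der.rrL[of Gam A "map LRev (brks ys) @ Del" C] by (cases d) (simp_all add: y brk_def)
  then show ?case using Cons.IH[of "Gam @ [brk A (\<not> d)]"] by (simp add: y)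
qed simp

lemma LR_der_flip: "LR_der (brks ys) C \<Longrightarrow> LR_der (brks (flip ys)) (LRev C)"
  using LR_der.revR[of "brks ys" C] LR_der_brk_flip[of "[]" "rev ys" "[]"]
  by (simp add: flip_def rev_map)

text \<open>Inserting a list at an edge of sign \<open>d\<close> is a cut on \<open>brk A d\<close>;
  for a negative edge the left premise is reversed first.\<close>

lemma LR_der_cut_orient:
  assumes "LR_der (brks ys) A" "LR_der (Gam @ brk A d # Del) C"
  shows "LR_der (Gam @ brks (orient d ys) @ Del) C"
proof -
  have "LR_der (brks (orient d ys)) (brk A d)"
    using assms(1) LR_der_flip by (cases d) (auto simp: brk_def)
  then show ?thesis using LR_der.cut[of _ "brk A d" Gam Del] assms(2) by simp
qed

text \<open>\<open>LOver A B\<close> followed by \<open>ys\<close> derives \<open>A\<close>. The cut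
  then moves this to a signed occurrence of \<open>A\<close>, which \<open>overL\<close> alone could
  not reach when \<open>d\<close> is true.\<close>

lemma LR_der_over_orient:
  assumes "LR_der (brks ys) B" "LR_der (Gam @ brk A d # Del) C"
  shows "LR_der (Gam @ brks (orient d ((LOver A B, False) # ys)) @ Del) C"
proof (rule LR_der_cut_orient[OF _ assms(2)])
  show "LR_der (brks ((LOver A B, False) # ys)) A"
    using LR_der.overL[of "brks ys" B "[]" A "[]" A] assms(1) LR_der_nonempty LR_der_refl
    by (auto simp: brk_def)
qed

lemma LR_der_under_orient:
  assumes "LR_der (brks ys) B" "LR_der (Gam @ brk A d # Del) C"
  shows "LR_der (Gam @ brks (orient d (ys @ [(LUnder B A, False)])) @ Del) C"
proof (rule LR_der_cut_orient[OF _ assms(2)])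
  show "LR_der (brks (ys @ [(LUnder B A, False)])) A"
    using LR_der.underL[of "brks ys" B "[]" A "[]" A] assms(1) LR_der_nonempty LR_der_refl
    by (auto simp: brk_def)
qed

text \<open>\<open>prodL\<close> acts on an unreversed product only, so a reversed one is turned
  into a product of reversals. The proof derives the reversal of that product from
  \<open>A, B\<close> and then reverses both sides, leaving a double reversal for
  \<open>rrR\<close>.\<close>

lemma LR_der_rev_prod: "LR_der [LRev (LProd A B)] (LProd (LRev B) (LRev A))"
proof -
  let ?R = "LProd (LRev B) (LRev A)"
  have "LR_der [LRev B, LRev A] ?R"
    using LR_der.prodR[OF _ _ LR_der_refl[of "LRev B"] LR_der_refl[of "LRev A"]] by simp
  then have "LR_der [LRev (LRev A), LRev (LRev B)] (LRev ?R)"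
    using LR_der.revR by fastforce
  then have "LR_der [A, LRev (LRev B)] (LRev ?R)"
    using LR_der.rrL[of "[]" A] by simp
  then have "LR_der [A, B] (LRev ?R)"
    using LR_der.rrL[of "[A]" B "[]"] by simp
  then have "LR_der [LProd A B] (LRev ?R)"
    using LR_der.prodL[of "[]" A B "[]"] by simp
  then have "LR_der [LRev (LProd A B)] (LRev (LRev ?R))"
    using LR_der.revR by fastforce
  then show ?thesis by (rule LR_der.rrR)
qed

lemma LR_der_prod_orient:
  assumes "LR_der (Gam @ brks (orient d [(A, False), (B, False)]) @ Del) C"
  shows "LR_der (Gam @ brk (LProd A B) d # Del) C"
proof (cases d)
  case False
  then show ?thesis using assms LR_der.prodL[of Gam A B Del C] by (simp add: brk_def)
next
  case True
  then have "LR_der (Gam @ [LRev B, LRev A] @ Del) C" using assms by (simp add: brk_def)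
  then have "LR_der (Gam @ [LProd (LRev B) (LRev A)] @ Del) C" by (rule LR_der.prodL)
  then show ?thesis using LR_der.cut[OF LR_der_rev_prod] True by (fastforce simp: brk_def)
qed

lemma LR_der_rev_orient:
  assumes "LR_der (Gam @ brks (orient d [(A, True)]) @ Del) C"
  shows "LR_der (Gam @ brk (LRev A) d # Del) C"
proof (cases d)
  case False
  then show ?thesis using assms by (simp add: brk_def)
next
  case True
  then have "LR_der (Gam @ [A] @ Del) C" using assms by (simp add: brk_def)
  moreover have "LR_der [LRev (LRev A)] A" by (rule LR_der.rrR[OF LR_der_refl])
  ultimately show ?thesis using LR_der.cut True by (fastforce simp: brk_def)
qed

lemma lessThan_pair:
  assumes "{..<n::nat} = {i, j}"
  shows "i < n" "j < n" "k < n \<Longrightarrow> k = i \<or> k = j"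
proof -
  have "k < n \<longleftrightarrow> k = i \<or> k = j" for k
    using arg_cong[OF assms, of "\<lambda>A. k \<in> A"] by simp
  then show "i < n" "j < n" "k < n \<Longrightarrow> k = i \<or> k = j" by blast+
qed

lemma gE_labels: "fst ` set (gE G) = lab G ` {..<length (gE G)}"
  by (force simp: lab_def in_set_conv_nth)

lemma hsubst_at_labels:
  assumes "e < length (gE G)"
  shows "fst ` set (gE (hsubst G (\<lambda>j. if j = e then F else handle (l j) (k j))))
    = fst ` set (gE F) \<union> l ` ({..<length (gE G)} - {e})"
proof -
  let ?f = "\<lambda>j. fst ` set (gE (if j = e then F else handle (l j) (k j)))"
  have "(\<Union>j<length (gE G). ?f j) = ?f e \<union> (\<Union>j\<in>{..<length (gE G)} - {e}. ?f j)"
    using assms by blast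
  moreover have "(\<Union>j\<in>{..<length (gE G)} - {e}. ?f j) = l ` ({..<length (gE G)} - {e})"
    by (auto simp: handle_def)
  ultimately show ?thesis unfolding hsubst_labels by simp
qed

lemma string_graph_nonempty: "string_graph G xs \<Longrightarrow> wf_hgraph ok G \<Longrightarrow> xs \<noteq> []"
  by (auto simp: string_graph_def path_graph_def wf_hgraph_def length_Suc_conv)

text \<open>Every premise again has only translated labels, being parts of translated types or
  isomorphic to them. For \<open>divL\<close> and \<open>timesR\<close> the list of the conclusion
  is pasted from those of the premises; for \<open>divR\<close> and \<open>timesL\<close> it has to
  be read off the list of the premise.\<close>

lemma HL_der_imp_LR_der:
  assumes "HL_der G T" "\<And>l. l \<in> fst ` set (gE G) \<Longrightarrow> translated l" "translated T"
  shows "\<exists>xs. string_graph G xs \<and> LR_der (brks (map (apfst untr) xs)) (untr T)"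
  using assms
proof (induction rule: HL_der.induct)
  case (ax p n)
  from translated_HPrim[OF ax(2)] have "n = 2" "untr (HPrim p 2) = LPrim p" by auto
  then show ?case
    using string_graph_handle[of "HPrim p n"] LR_der.ax[of p]
    by (intro exI[of _ "[(HPrim p n, False)]"]) (simp add: brk_def)
next
  case (iso H A H' A')
  have wf: "wf_hgraph htp_ok H" "wf_tp A"
    using HL_der_wf[OF iso(1)] by (simp_all add: hseq_wf_def)
  \<comment> \<open>Going from \<open>H'\<close> back to \<open>H\<close> uses symmetry of
    \<open>tp_eq\<close>, available because the labels of \<open>H\<close> are well formed.\<close>
  have "translated l" if l: "l \<in> fst ` set (gE H)" for l
  proof -
    obtain f es where *: "mset es = mset (gE H')"
      "list_all2 (\<lambda>(l, a) (l', a'). tp_eq l l' \<and> a' = map f a) (gE H) es"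
      using iso(2) by (auto simp: graph_iso_iff)
    obtain i where i: "i < length (gE H)" "l = fst (gE H ! i)" using l by (auto simp: in_set_conv_nth)
    then have "tp_eq l (fst (es ! i))" "i < length es"
      using *(2) by (auto simp: list_all2_conv_all_nth split_beta)
    moreover have "fst (es ! i) \<in> fst ` set (gE H')"
      using \<open>i < length es\<close> *(1) by (metis imageI mset_eq_setD nth_mem)
    moreover have "wf_tp l" using wf(1) i nth_mem unfolding wf_hgraph_def by blast
    ultimately show ?thesis using translated_tp_eq_rev iso.prems(1) by blast
  qed
  moreover have A: "translated A" using translated_tp_eq_rev[OF iso(3) wf(2)] iso.prems(2) by simp
  ultimately obtain xs where xs: "string_graph H xs" "LR_der (brks (map (apfst untr) xs)) (untr A)"
    and tr: "\<And>l. l \<in> fst ` set xs \<Longrightarrow> translated l"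
    using iso.IH string_graph_labels by metis
  obtain ys where ys: "string_graph H' ys" "list_all2 (rel_prod tp_eq (=)) xs ys"
    using string_graph_iso[OF xs(1) iso(2)] by blast
  have "map (apfst untr) ys = map (apfst untr) xs"
    using ys(2) tr
  proof (induction rule: list_all2_induct)
    case (Cons x xs y ys)
    then show ?case using translated_tp_eq[of "fst x" "fst y"]
      by (cases x; cases y) auto
  qed simp
  then show ?case using ys(1) xs(2) translated_tp_eq[OF iso(3) A] by metis
next
  case (divL H A e N d0 D Hs G)
  let ?K = "hsubst D (\<lambda>j. if j = d0 then handle (HDiv N D) (length (att D d0)) else Hs j)"
  have GK: "fst ` set (gE G) = fst ` set (gE ?K) \<union> lab H ` ({..<length (gE H)} - {e})"
    unfolding divL(6) repl_def by (rule hsubst_at_labels[OF divL(2)])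
  have K: "fst ` set (gE (if j = d0 then handle (HDiv N D) (length (att D d0)) else Hs j))
      \<subseteq> fst ` set (gE G)" if "j < length (gE D)" for j
    using that unfolding GK hsubst_labels by blast
  have "HDiv N D \<in> fst ` set (gE G)" using K[OF divL(4)] by (simp add: handle_def)
  then have NDt: "translated (HDiv N D)" by (rule divL.prems(1))
  \<comment> \<open>\<open>N\<close> need not be a label of \<open>G\<close>, as its edge is
    replaced; it is translated as a part of \<open>HDiv N D\<close>.\<close>
  have N: "translated N" by (rule translated_HDiv[OF NDt])
  have "translated l" if l: "l \<in> fst ` set (gE H)" for l
  proof -
    obtain i where i: "i < length (gE H)" "l = lab H i" using l unfolding gE_labels by blast
    have "l = N \<or> l \<in> fst ` set (gE G)"
      unfolding GK using i divL(3) by (cases "i = e") auto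
    then show ?thesis using N divL.prems(1) by blast
  qed
  then obtain xs where xs: "string_graph H xs" "LR_der (brks (map (apfst untr) xs)) (untr A)"
    using divL(8) divL.prems(2) by blast
  obtain xs1 d xs2 where split: "xs = xs1 @ (N, d) # xs2"
    and repl: "\<And>F ys. string_graph F ys \<Longrightarrow> ys \<noteq> [] \<Longrightarrow>
      string_graph (repl H e F) (xs1 @ orient d ys @ xs2)"
    using string_graph_repl_index[OF xs(1) divL(2)] divL(3) by metis
  have LR: "LR_der (brks (map (apfst untr) xs1) @ brk (untr N) d # brks (map (apfst untr) xs2)) (untr A)"
    using xs(2) split by simp
  have arg: "\<exists>ys. string_graph (Hs j) ys \<and> LR_der (brks (map (apfst untr) ys)) (untr t)"
    if "j < length (gE D)" "j \<noteq> d0" "lab D j = Some t" "translated t" for j t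
  proof -
    have "\<And>l. l \<in> fst ` set (gE (Hs j)) \<Longrightarrow> translated l"
      using K[OF that(1)] that(2) divL.prems(1) by auto
    moreover have "(\<forall>l. l \<in> fst ` set (gE (Hs j)) \<longrightarrow> translated l) \<longrightarrow> translated t \<longrightarrow>
        (\<exists>ys. string_graph (Hs j) ys \<and> LR_der (brks (map (apfst untr) ys)) (untr t))"
      using divL(9)[rule_format, OF that(1,2)] unfolding that(3) by blast
    ultimately show ?thesis using that(4) by blast
  qed
  have handle: "string_graph (handle (HDiv N D) (length (att D d0))) [(HDiv N D, False)]"
    if "string_graph D zs" for zs
    using string_graph_att(2)[OF that divL(4)] string_graph_handle by metis
  show ?case
  proof (rule translated_HDiv[OF NDt])
    fix t assume t: "translated t" and D: "string_graph D [(None, False), (Some t, False)]"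
      and untr: "untr (HDiv N D) = LOver (untr N) (untr t)"
    obtain i j where ij: "path_order D [(None, False), (Some t, False)] [i, j]" "i \<noteq> j"
      "{..<length (gE D)} = {i, j}" "lab D i = None" "lab D j = Some t"
      using path_order_pair[OF D] by (metis fst_conv)
    note n = lessThan_pair[OF ij(3)]
    have j: "j < length (gE D)" by (rule n(2))
    have "d0 \<noteq> j" using divL(5) ij(5) by auto
    then have d0: "d0 = i" using n(3)[OF divL(4)] by simp
    obtain ys where ys: "string_graph (Hs j) ys" "LR_der (brks (map (apfst untr) ys)) (untr t)"
      using arg[OF j _ ij(5) t] d0 ij(2) by auto
    have "ys \<noteq> []" using LR_der_nonempty[OF ys(2)] by auto
    then have "string_graph ?K (orient False [(HDiv N D, False)] @ orient False ys)"
      by (intro string_graph_hsubst_pair[OF ij(1,2)]) (use handle[OF D] ys(1) d0 ij(2) in auto)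
    then have "string_graph G (xs1 @ orient d ((HDiv N D, False) # ys) @ xs2)"
      unfolding divL(6) by (intro repl) auto
    moreover have "LR_der (brks (map (apfst untr) (xs1 @ orient d ((HDiv N D, False) # ys) @ xs2))) (untr A)"
      using LR_der_over_orient[OF ys(2) LR] by (simp add: map_orient untr)
    ultimately show ?thesis by blast
  next
    fix t assume t: "translated t" and D: "string_graph D [(Some t, False), (None, False)]"
      and untr: "untr (HDiv N D) = LUnder (untr t) (untr N)"
    obtain j i where ij: "path_order D [(Some t, False), (None, False)] [j, i]" "j \<noteq> i"
      "{..<length (gE D)} = {j, i}" "lab D j = Some t" "lab D i = None"
      using path_order_pair[OF D] by (metis fst_conv)
    note n = lessThan_pair[OF ij(3)]
    have j: "j < length (gE D)" by (rule n(1))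
    have "d0 \<noteq> j" using divL(5) ij(4) by auto
    then have d0: "d0 = i" using n(3)[OF divL(4)] by simp
    obtain ys where ys: "string_graph (Hs j) ys" "LR_der (brks (map (apfst untr) ys)) (untr t)"
      using arg[OF j _ ij(4) t] d0 ij(2) by auto
    have "ys \<noteq> []" using LR_der_nonempty[OF ys(2)] by auto
    then have "string_graph ?K (orient False ys @ orient False [(HDiv N D, False)])"
      by (intro string_graph_hsubst_pair[OF ij(1,2)]) (use handle[OF D] ys(1) d0 ij(2) in auto)
    then have "string_graph G (xs1 @ orient d (ys @ [(HDiv N D, False)]) @ xs2)"
      unfolding divL(6) by (intro repl) auto
    moreover have "LR_der (brks (map (apfst untr) (xs1 @ orient d (ys @ [(HDiv N D, False)]) @ xs2))) (untr A)"
      using LR_der_under_orient[OF ys(2) LR] by (simp add: map_orient untr)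
    ultimately show ?thesis by blast
  qed
next
  case (divR d0 D F N)
  have wf: "wf_hgraph htp_ok F" "length (gext F) = 2"
    using divR(4) translated_tarity[OF divR.prems(2)] by (simp_all add: hseq_wf_def)
  let ?K = "hsubst D (\<lambda>j. if j = d0 then F else handle (the (lab D j)) (length (att D j)))"
  have labels: "\<And>l. l \<in> fst ` set (gE ?K) \<Longrightarrow> translated l"
    if "\<And>j. j < length (gE D) \<Longrightarrow> j \<noteq> d0 \<Longrightarrow> translated (the (lab D j))"
    using that divR.prems(1) unfolding hsubst_at_labels[OF divR(1)] by blast
  \<comment> \<open>\<open>D\<close> has two edges and \<open>d0\<close> is the one labelled
    \<open>None\<close>, so any other edge is the argument edge.\<close>
  have other: "translated (the (lab D k))"
    if "{..<length (gE D)} = {i, j}" "lab D i = None" "lab D j = Some t" "translated t"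
      "k < length (gE D)" "k \<noteq> d0" for i j k t
  proof -
    have "d0 \<noteq> j" using divR(2) that(3) by auto
    then have "k = j"
      using lessThan_pair(3)[OF that(1,5)] lessThan_pair(3)[OF that(1) divR(1)] that(6) by auto
    then show ?thesis using that(3,4) by simp
  qed
  show ?case
  proof (rule translated_HDiv[OF divR.prems(2)])
    fix t assume N: "translated N" and t: "translated t"
      and D: "string_graph D [(None, False), (Some t, False)]"
      and untr: "untr (HDiv N D) = LOver (untr N) (untr t)"
    obtain i j where "{..<length (gE D)} = {i, j}" "lab D i = None" "lab D j = Some t"
      using path_order_pair[OF D] by (metis fst_conv)
    from divR(5)[OF labels[OF other[OF this t]] N] obtain xs
      where xs: "string_graph ?K xs" "LR_der (brks (map (apfst untr) xs)) (untr N)" by blast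
    obtain xs' where xs': "xs = xs' @ [(t, False)]" "string_graph F xs'"
      using string_graph_over_premise[OF D divR(1,2) wf xs(1)] .
    have "LR_der (brks (map (apfst untr) xs') @ [untr t]) (untr N)"
      using xs(2) xs'(1) by (simp add: brk_def)
    then have "LR_der (brks (map (apfst untr) xs')) (untr (HDiv N D))"
      unfolding untr using string_graph_nonempty[OF xs'(2) wf(1)] by (intro LR_der.overR) simp_all
    then show ?thesis using xs'(2) by blast
  next
    fix t assume N: "translated N" and t: "translated t"
      and D: "string_graph D [(Some t, False), (None, False)]"
      and untr: "untr (HDiv N D) = LUnder (untr t) (untr N)"
    obtain j i where "{..<length (gE D)} = {j, i}" "lab D j = Some t" "lab D i = None"
      using path_order_pair[OF D] by (metis fst_conv)
    then have "{..<length (gE D)} = {i, j}" "lab D i = None" "lab D j = Some t"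
      by (simp_all only: insert_commute)
    from divR(5)[OF labels[OF other[OF this t]] N] obtain xs
      where xs: "string_graph ?K xs" "LR_der (brks (map (apfst untr) xs)) (untr N)" by blast
    obtain xs' where xs': "xs = (t, False) # xs'" "string_graph F xs'"
      using string_graph_under_premise[OF D divR(1,2) wf xs(1)] .
    have "LR_der (untr t # brks (map (apfst untr) xs')) (untr N)"
      using xs(2) xs'(1) by (simp add: brk_def)
    then have "LR_der (brks (map (apfst untr) xs')) (untr (HDiv N D))"
      unfolding untr using string_graph_nonempty[OF xs'(2) wf(1)] by (intro LR_der.underR) simp_all
    then show ?thesis using xs'(2) by blast
  qed
next
  case (timesL e G F A)
  have G: "HTimes F \<in> fst ` set (gE G)" using timesL(1,2) unfolding gE_labels by force
  then have Ft: "translated (HTimes F)" by (rule timesL.prems(1))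
  have wf: "wf_hgraph htp_ok G" using timesL(4) by (simp add: hseq_wf_def)
  \<comment> \<open>Well-formedness of the conclusion makes \<open>e\<close> an edge between two
    nodes.\<close>
  have "length (att G e) = tarity (HTimes F)"
    using wf nth_mem[OF timesL(1)] timesL(2) by (auto simp: wf_hgraph_def lab_def att_def)
  then have att: "length (att G e) = 2" using translated_tarity[OF Ft] by simp
  have labels: "translated l"
    if "\<And>l. l \<in> fst ` set (gE F) \<Longrightarrow> translated l" "l \<in> fst ` set (gE (repl G e F))" for l
    using that timesL.prems(1)
    unfolding repl_def hsubst_at_labels[OF timesL(1)] gE_labels[of G] by blast
  show ?case
  proof (rule translated_HTimes[OF Ft])
    fix a b assume ab: "translated a" "translated b" and F: "string_graph F [(a, False), (b, False)]"
      and untr: "untr (HTimes F) = LProd (untr a) (untr b)"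
    have "\<And>l. l \<in> fst ` set (gE F) \<Longrightarrow> translated l"
      using ab string_graph_labels[OF F] by auto
    from timesL(5)[OF labels[OF this] timesL.prems(2)] obtain xs
      where xs: "string_graph (repl G e F) xs" "LR_der (brks (map (apfst untr) xs)) (untr A)" by blast
    obtain xs1 d xs2 where *: "xs = xs1 @ orient d [(a, False), (b, False)] @ xs2"
      "string_graph G (xs1 @ (lab G e, d) # xs2)"
      using string_graph_unrepl_pair[OF wf timesL(1) att F xs(1)] .
    show ?thesis
      using *(2) xs(2) LR_der_prod_orient[of "brks (map (apfst untr) xs1)" d "untr a" "untr b"
          "brks (map (apfst untr) xs2)" "untr A"]
      by (intro exI[of _ "xs1 @ (lab G e, d) # xs2"]) (simp add: *(1) map_orient timesL(2) untr)
  next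
    fix a assume a: "translated a" and F: "string_graph F [(a, True)]"
      and untr: "untr (HTimes F) = LRev (untr a)"
    have "\<And>l. l \<in> fst ` set (gE F) \<Longrightarrow> translated l"
      using a string_graph_labels[OF F] by auto
    from timesL(5)[OF labels[OF this] timesL.prems(2)] obtain xs
      where xs: "string_graph (repl G e F) xs" "LR_der (brks (map (apfst untr) xs)) (untr A)" by blast
    obtain xs1 d xs2 where *: "xs = xs1 @ orient d [(a, True)] @ xs2"
      "string_graph G (xs1 @ (lab G e, d) # xs2)"
      using string_graph_unrepl_reversed[OF wf timesL(1) att F xs(1)] .
    show ?thesis
      using *(2) xs(2) LR_der_rev_orient[of "brks (map (apfst untr) xs1)" d "untr a"
          "brks (map (apfst untr) xs2)" "untr A"]
      by (intro exI[of _ "xs1 @ (lab G e, d) # xs2"]) (simp add: *(1) map_orient timesL(2) untr)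
  qed
next
  case (timesR M Hs)
  have labels: "translated l" if "l \<in> fst ` set (gE (Hs j))" "j < length (gE M)" for l j
    using that timesR.prems(1) unfolding hsubst_labels by blast
  have arg: "\<exists>ys. string_graph (Hs j) ys \<and> LR_der (brks (map (apfst untr) ys)) (untr (lab M j))"
    if "j < length (gE M)" "translated (lab M j)" for j
    using timesR(1) labels that by blast
  show ?case
  proof (rule translated_HTimes[OF timesR.prems(2)])
    fix a b assume ab: "translated a" "translated b" and M: "string_graph M [(a, False), (b, False)]"
      and untr: "untr (HTimes M) = LProd (untr a) (untr b)"
    obtain i j where ij: "path_order M [(a, False), (b, False)] [i, j]" "i \<noteq> j"
      "{..<length (gE M)} = {i, j}" "lab M i = a" "lab M j = b"
      using path_order_pair[OF M] by (metis fst_conv)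
    have "i < length (gE M)" "j < length (gE M)" using lessThan_pair[OF ij(3)] by simp_all
    then obtain ys zs where ys: "string_graph (Hs i) ys" "LR_der (brks (map (apfst untr) ys)) (untr a)"
      and zs: "string_graph (Hs j) zs" "LR_der (brks (map (apfst untr) zs)) (untr b)"
      using arg[of i, unfolded ij(4), OF _ ab(1)] arg[of j, unfolded ij(5), OF _ ab(2)] by metis
    have ne: "ys \<noteq> []" "zs \<noteq> []" using LR_der_nonempty ys(2) zs(2) by auto
    have "string_graph (hsubst M Hs) (ys @ zs)"
      using string_graph_hsubst_pair[OF ij(1,2) ys(1) zs(1) ne] by simp
    moreover have "LR_der (brks (map (apfst untr) (ys @ zs))) (untr (HTimes M))"
      using LR_der.prodR[OF _ _ ys(2) zs(2)] ne untr by simp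
    ultimately show ?thesis by blast
  next
    fix a assume a: "translated a" and M: "string_graph M [(a, True)]"
      and untr: "untr (HTimes M) = LRev (untr a)"
    note single = string_graph_hsubst_single[OF M]
    \<comment> \<open>These facts about \<open>M\<close> do not involve the inserted graphs; a
      handle serves as a dummy instance.\<close>
    have "length (gE M) = 1" "lab M 0 = a"
      using single(2,3)[of "\<lambda>_. handle a 2" "[(a, False)]"] string_graph_handle[of a] by auto
    then obtain ys where ys: "string_graph (Hs 0) ys" "LR_der (brks (map (apfst untr) ys)) (untr a)"
      using arg[of 0] a by auto
    then have "ys \<noteq> []" using LR_der_nonempty by fastforce
    then have "string_graph (hsubst M Hs) (flip ys)" using single(1)[of Hs, OF ys(1)] by simp
    moreover have "LR_der (brks (map (apfst untr) (flip ys))) (untr (HTimes M))"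
      using LR_der_flip[OF ys(2)] untr by (simp add: map_flip)
    ultimately show ?thesis by blast
  qed
qed

section \<open>From L with reversal to HL\<close>

definition HL_str :: "('p ltp \<times> bool) list \<Rightarrow> 'p ltp \<Rightarrow> bool" where
  "HL_str xs C \<longleftrightarrow> HL_der (genstr (map (apfst trR) xs)) (trR C)"

text \<open>The rule \<open>iso\<close> used in both directions: derivability of a path depends only
  on its signed list, so the rules can be computed on lists without tracking node names.\<close>

lemma HL_der_string_graph:
  assumes "string_graph G (map (apfst trR) xs)"
  shows "HL_der G (trR C) \<longleftrightarrow> HL_str xs C"
proof -
  have refl: "list_all2 (rel_prod tp_eq (=)) (map (apfst trR) xs) (map (apfst trR) xs)"
    by (rule list.rel_refl_strong) (auto simp: tp_eq_trR)
  show ?thesis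
    unfolding HL_str_def
    using HL_der.iso tp_eq_trR graph_iso_string_graph[OF assms string_graph_genstr refl]
      graph_iso_string_graph[OF string_graph_genstr assms refl]
    by blast
qed

lemma hseq_wf_string_graph:
  assumes "string_graph G (map (apfst trR) xs)" "xs \<noteq> []"
  shows "hseq_wf G (trR C)"
proof -
  have "wf_hgraph htp_ok G"
    by (rule string_graph_wf[OF assms(1)]) (use assms(2) in \<open>auto simp: wf_trR\<close>)
  then show ?thesis
    using wf_trR[of C] string_graph_ext[OF assms(1)] by (simp add: hseq_wf_def)
qed

lemma HL_str_nonempty: "HL_str xs C \<Longrightarrow> xs \<noteq> []"
  unfolding HL_str_def using HL_der_wf string_graph_nonempty[OF string_graph_genstr]
  by (fastforce simp: hseq_wf_def)

lemma HL_str_prim: "HL_str [(LPrim p, False)] (LPrim p)"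
proof -
  have "string_graph (handle (HPrim p 2) 2) (map (apfst trR) [(LPrim p, False)])"
    using string_graph_handle[of "HPrim p 2"] by simp
  then show ?thesis using HL_der_string_graph HL_der.ax[of p 2] by fastforce
qed

text \<open>\<open>divL\<close> at an edge of sign \<open>d\<close>: the string inserted for the
  edge follows the direction of that edge, hence the orientation of the whole block.\<close>

lemma HL_str_overL:
  assumes "HL_str ys B" "HL_str (Gam @ (A, d) # Del) C"
  shows "HL_str (Gam @ orient d ((LOver A B, False) # ys) @ Del) C"
proof -
  let ?m = "map (apfst trR)"
  let ?H = "genstr (?m Gam @ (trR A, d) # ?m Del)"
  let ?D = "genstr [(None, False), (Some (trR B), False)]"
  let ?Hs = "\<lambda>_. genstr (?m ys)"
  obtain e where e: "e < length (gE ?H)" "lab ?H e = trR A"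
    and repl: "\<And>F ys. string_graph F ys \<Longrightarrow> ys \<noteq> [] \<Longrightarrow>
       string_graph (repl ?H e F) (?m Gam @ orient d ys @ ?m Del)"
    using string_graph_repl_label[OF string_graph_genstr] by (metis fst_conv snd_conv)
  obtain i j where ij: "path_order ?D [(None, False), (Some (trR B), False)] [i, j]" "i \<noteq> j"
    "{..<length (gE ?D)} = {i, j}" "lab ?D i = None" "lab ?D j = Some (trR B)"
    using path_order_pair[OF string_graph_genstr] by (metis fst_conv)
  note n = lessThan_pair[OF ij(3)]
  have i: "i < length (gE ?D)" by (rule n(1))
  have other: "lab ?D k = Some (trR B)" if "k < length (gE ?D)" "k \<noteq> i" for k
    using n(3)[OF that(1)] that(2) ij(5) by blast
  let ?K = "hsubst ?D (\<lambda>k. if k = i then handle (HDiv (trR A) ?D) (length (att ?D i)) else ?Hs k)"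
  have "string_graph (handle (HDiv (trR A) ?D) (length (att ?D i))) [(trR (LOver A B), False)]"
    unfolding string_graph_att(2)[OF string_graph_genstr i] trR.simps by (rule string_graph_handle)
  then have "string_graph ?K (orient False [(trR (LOver A B), False)] @ orient False (?m ys))"
    using HL_str_nonempty[OF assms(1)] ij(2)
    by (intro string_graph_hsubst_pair[OF ij(1,2)]) (auto simp: string_graph_genstr)
  then have G: "string_graph (repl ?H e ?K) (?m (Gam @ orient d ((LOver A B, False) # ys) @ Del))"
    using repl[of ?K "(trR (LOver A B), False) # ?m ys"] by (simp add: map_orient)
  have "HL_der (repl ?H e ?K) (trR C)"
  proof (rule HL_der.divL[OF _ e i ij(4) _ refl])
    show "HL_der ?H (trR C)" using assms(2) by (simp add: HL_str_def)
    show "\<forall>j<length (gE ?D). j \<noteq> i \<longrightarrow> (\<exists>t. lab ?D j = Some t \<and> HL_der (?Hs j) t)"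
      using other assms(1) by (auto simp: HL_str_def)
    show "hseq_wf (repl ?H e ?K) (trR C)" by (rule hseq_wf_string_graph[OF G]) simp
  qed
  then show ?thesis by (rule HL_der_string_graph[OF G, THEN iffD1])
qed

lemma HL_str_underL:
  assumes "HL_str ys B" "HL_str (Gam @ (A, d) # Del) C"
  shows "HL_str (Gam @ orient d (ys @ [(LUnder B A, False)]) @ Del) C"
proof -
  let ?m = "map (apfst trR)"
  let ?H = "genstr (?m Gam @ (trR A, d) # ?m Del)"
  let ?D = "genstr [(Some (trR B), False), (None, False)]"
  let ?Hs = "\<lambda>_. genstr (?m ys)"
  obtain e where e: "e < length (gE ?H)" "lab ?H e = trR A"
    and repl: "\<And>F ys. string_graph F ys \<Longrightarrow> ys \<noteq> [] \<Longrightarrow>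
       string_graph (repl ?H e F) (?m Gam @ orient d ys @ ?m Del)"
    using string_graph_repl_label[OF string_graph_genstr] by (metis fst_conv snd_conv)
  obtain j i where ij: "path_order ?D [(Some (trR B), False), (None, False)] [j, i]" "j \<noteq> i"
    "{..<length (gE ?D)} = {j, i}" "lab ?D j = Some (trR B)" "lab ?D i = None"
    using path_order_pair[OF string_graph_genstr] by (metis fst_conv)
  note n = lessThan_pair[OF ij(3)]
  have i: "i < length (gE ?D)" by (rule n(2))
  have other: "lab ?D k = Some (trR B)" if "k < length (gE ?D)" "k \<noteq> i" for k
    using n(3)[OF that(1)] that(2) ij(4) by blast
  let ?K = "hsubst ?D (\<lambda>k. if k = i then handle (HDiv (trR A) ?D) (length (att ?D i)) else ?Hs k)"
  have "string_graph (handle (HDiv (trR A) ?D) (length (att ?D i))) [(trR (LUnder B A), False)]"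
    unfolding string_graph_att(2)[OF string_graph_genstr i] trR.simps by (rule string_graph_handle)
  then have "string_graph ?K (orient False (?m ys) @ orient False [(trR (LUnder B A), False)])"
    using HL_str_nonempty[OF assms(1)] ij(2)
    by (intro string_graph_hsubst_pair[OF ij(1,2)]) (auto simp: string_graph_genstr)
  then have G: "string_graph (repl ?H e ?K) (?m (Gam @ orient d (ys @ [(LUnder B A, False)]) @ Del))"
    using repl[of ?K "?m ys @ [(trR (LUnder B A), False)]"] by (simp add: map_orient)
  have "HL_der (repl ?H e ?K) (trR C)"
  proof (rule HL_der.divL[OF _ e i ij(5) _ refl])
    show "HL_der ?H (trR C)" using assms(2) by (simp add: HL_str_def)
    show "\<forall>j<length (gE ?D). j \<noteq> i \<longrightarrow> (\<exists>t. lab ?D j = Some t \<and> HL_der (?Hs j) t)"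
      using other assms(1) by (auto simp: HL_str_def)
    show "hseq_wf (repl ?H e ?K) (trR C)" by (rule hseq_wf_string_graph[OF G]) simp
  qed
  then show ?thesis by (rule HL_der_string_graph[OF G, THEN iffD1])
qed

lemma HL_str_overR:
  assumes "xs \<noteq> []" "HL_str (xs @ [(B, False)]) A"
  shows "HL_str xs (LOver A B)"
proof -
  let ?m = "map (apfst trR)"
  let ?D = "genstr [(None, False), (Some (trR B), False)]"
  obtain i j where ij: "path_order ?D [(None, False), (Some (trR B), False)] [i, j]" "i \<noteq> j"
    "{..<length (gE ?D)} = {i, j}" "lab ?D i = None" "lab ?D j = Some (trR B)"
    using path_order_pair[OF string_graph_genstr] by (metis fst_conv)
  have i: "i < length (gE ?D)" and j: "j < length (gE ?D)"
    using lessThan_pair[OF ij(3)] by simp_all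
  let ?K = "hsubst ?D (\<lambda>k. if k = i then genstr (?m xs) else handle (the (lab ?D k)) (length (att ?D k)))"
  have "string_graph (handle (the (lab ?D j)) (length (att ?D j))) [(trR B, False)]"
    unfolding string_graph_att(2)[OF string_graph_genstr j] ij(5) option.sel by (rule string_graph_handle)
  then have "string_graph ?K (orient False (?m xs) @ orient False [(trR B, False)])"
    using assms(1) ij(2)
    by (intro string_graph_hsubst_pair[OF ij(1,2)]) (auto simp: string_graph_genstr)
  then have K: "string_graph ?K (?m (xs @ [(B, False)]))" by simp
  have "HL_der (genstr (?m xs)) (trR (LOver A B))"
    unfolding trR.simps
  proof (rule HL_der.divR[OF i ij(4)])
    show "HL_der ?K (trR A)" using assms(2) HL_der_string_graph[OF K] by simp
    show "hseq_wf (genstr (?m xs)) (HDiv (trR A) ?D)"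
      using hseq_wf_string_graph[OF string_graph_genstr assms(1), of "LOver A B"] by simp
  qed
  then show ?thesis by (simp add: HL_str_def)
qed

lemma HL_str_underR:
  assumes "xs \<noteq> []" "HL_str ((B, False) # xs) A"
  shows "HL_str xs (LUnder B A)"
proof -
  let ?m = "map (apfst trR)"
  let ?D = "genstr [(Some (trR B), False), (None, False)]"
  obtain j i where ij: "path_order ?D [(Some (trR B), False), (None, False)] [j, i]" "j \<noteq> i"
    "{..<length (gE ?D)} = {j, i}" "lab ?D j = Some (trR B)" "lab ?D i = None"
    using path_order_pair[OF string_graph_genstr] by (metis fst_conv)
  have i: "i < length (gE ?D)" and j: "j < length (gE ?D)"
    using lessThan_pair[OF ij(3)] by simp_all
  let ?K = "hsubst ?D (\<lambda>k. if k = i then genstr (?m xs) else handle (the (lab ?D k)) (length (att ?D k)))"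
  have "string_graph (handle (the (lab ?D j)) (length (att ?D j))) [(trR B, False)]"
    unfolding string_graph_att(2)[OF string_graph_genstr j] ij(4) option.sel by (rule string_graph_handle)
  then have "string_graph ?K (orient False [(trR B, False)] @ orient False (?m xs))"
    using assms(1) ij(2)
    by (intro string_graph_hsubst_pair[OF ij(1,2)]) (auto simp: string_graph_genstr)
  then have K: "string_graph ?K (?m ((B, False) # xs))" by simp
  have "HL_der (genstr (?m xs)) (trR (LUnder B A))"
    unfolding trR.simps
  proof (rule HL_der.divR[OF i ij(5)])
    show "HL_der ?K (trR A)" using assms(2) HL_der_string_graph[OF K] by simp
    show "hseq_wf (genstr (?m xs)) (HDiv (trR A) ?D)"
      using hseq_wf_string_graph[OF string_graph_genstr assms(1), of "LUnder B A"] by simp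
  qed
  then show ?thesis by (simp add: HL_str_def)
qed

text \<open>Product and reversal both translate to \<open>HTimes\<close> of a generalized string, of
  length two or one, so one argument gives both left rules.\<close>

lemma HL_str_timesL:
  assumes T: "trR T = HTimes (genstr (map (apfst trR) ys))" and ys: "ys \<noteq> []"
    and prem: "HL_str (Gam @ orient d ys @ Del) C"
  shows "HL_str (Gam @ (T, d) # Del) C"
proof -
  let ?m = "map (apfst trR)"
  let ?G = "genstr (?m Gam @ (trR T, d) # ?m Del)"
  obtain e where e: "e < length (gE ?G)" "lab ?G e = trR T"
    and repl: "\<And>F ys. string_graph F ys \<Longrightarrow> ys \<noteq> [] \<Longrightarrow>
       string_graph (repl ?G e F) (?m Gam @ orient d ys @ ?m Del)"
    using string_graph_repl_label[OF string_graph_genstr] by (metis fst_conv snd_conv)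
  have "string_graph (repl ?G e (genstr (?m ys))) (?m (Gam @ orient d ys @ Del))"
    using repl[OF string_graph_genstr, of "?m ys"] ys by (simp add: map_orient)
  then have "HL_der (repl ?G e (genstr (?m ys))) (trR C)"
    using HL_der_string_graph prem by blast
  moreover have "hseq_wf ?G (trR C)"
    using hseq_wf_string_graph[OF string_graph_genstr, of "Gam @ (T, d) # Del"] by simp
  ultimately have "HL_der ?G (trR C)" using e(2) by (intro HL_der.timesL[OF e(1)]) (simp_all add: T)
  then show ?thesis by (simp add: HL_str_def)
qed

lemma HL_str_prodL:
  "HL_str (Gam @ orient d [(A, False), (B, False)] @ Del) C \<Longrightarrow> HL_str (Gam @ (LProd A B, d) # Del) C"
  by (rule HL_str_timesL) simp_all

lemma HL_str_revL:
  assumes "HL_str (Gam @ (A, \<not> d) # Del) C"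
  shows "HL_str (Gam @ (LRev A, d) # Del) C"
proof (rule HL_str_timesL)
  show "trR (LRev A) = HTimes (genstr (map (apfst trR) [(A, True)]))"
    by (simp only: trR_LRev list.map apfst_conv)
  have "orient d [(A, True)] = [(A, \<not> d)]" by (cases d) simp_all
  then show "HL_str (Gam @ orient d [(A, True)] @ Del) C" using assms by simp
qed simp

lemma HL_str_prodR:
  assumes "HL_str ys A" "HL_str zs B"
  shows "HL_str (ys @ zs) (LProd A B)"
proof -
  let ?m = "map (apfst trR)"
  let ?M = "genstr [(trR A, False), (trR B, False)]"
  obtain i j where ij: "path_order ?M [(trR A, False), (trR B, False)] [i, j]" "i \<noteq> j"
    "{..<length (gE ?M)} = {i, j}" "lab ?M i = trR A" "lab ?M j = trR B"
    using path_order_pair[OF string_graph_genstr] by (metis fst_conv)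
  let ?Hs = "\<lambda>k. if k = i then genstr (?m ys) else genstr (?m zs)"
  have "string_graph (hsubst ?M ?Hs) (orient False (?m ys) @ orient False (?m zs))"
    using assms[THEN HL_str_nonempty] ij(2)
    by (intro string_graph_hsubst_pair[OF ij(1,2)]) (auto simp: string_graph_genstr)
  then have G: "string_graph (hsubst ?M ?Hs) (?m (ys @ zs))" by simp
  have "HL_der (hsubst ?M ?Hs) (trR (LProd A B))"
    unfolding trR.simps
  proof (rule HL_der.timesR)
    show "hseq_wf (hsubst ?M ?Hs) (HTimes ?M)"
      using hseq_wf_string_graph[OF G, of "LProd A B"] HL_str_nonempty[OF assms(1)] by simp
    have "HL_der (?Hs k) (lab ?M k)" if "k < length (gE ?M)" for k
    proof -
      have "k = i \<or> k = j" by (rule lessThan_pair(3)[OF ij(3) that])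
      then show ?thesis using assms ij(2,4,5) by (auto simp: HL_str_def)
    qed
    then show "\<forall>k<length (gE ?M). HL_der (?Hs k) (lab ?M k)" by blast
  qed
  then show ?thesis by (rule HL_der_string_graph[OF G, THEN iffD1])
qed

lemma HL_str_revR:
  assumes "HL_str xs A"
  shows "HL_str (flip xs) (LRev A)"
proof -
  let ?m = "map (apfst trR)"
  define M where "M = genstr [(trR A, True)]"
  define F where "F = genstr (?m xs)"
  have M: "string_graph M [(trR A, True)]" "length (gE M) = 1" "lab M 0 = trR A"
    unfolding M_def by (rule string_graph_genstr) (simp_all add: genstr_def lab_def)
  have ne: "flip xs \<noteq> []" "?m xs \<noteq> []" using HL_str_nonempty[OF assms] by simp_all
  have "string_graph F (?m xs)" unfolding F_def by (rule string_graph_genstr)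
  from string_graph_hsubst_single(1)[OF M(1) this ne(2)]
  have G: "string_graph (hsubst M (\<lambda>_. F)) (?m (flip xs))" by (simp add: map_flip)
  have "HL_der (hsubst M (\<lambda>_. F)) (HTimes M)"
  proof (rule HL_der.timesR)
    show "hseq_wf (hsubst M (\<lambda>_. F)) (HTimes M)"
      using hseq_wf_string_graph[OF G ne(1), of "LRev A"] unfolding trR_LRev M_def .
    show "\<forall>k<length (gE M). HL_der F (lab M k)"
      using assms by (simp add: M F_def HL_str_def)
  qed
  then have "HL_der (hsubst M (\<lambda>_. F)) (trR (LRev A))" unfolding trR_LRev M_def .
  then show ?thesis by (rule HL_der_string_graph[OF G, THEN iffD1])
qed

section \<open>A phase semantics of signed lists\<close>

definition closure :: "('p ltp \<times> bool) list set \<Rightarrow> ('p ltp \<times> bool) list set" where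
  "closure X = {w. \<forall>Gam Del C d. (\<forall>x \<in> X. HL_str (Gam @ orient d x @ Del) C) \<longrightarrow>
     HL_str (Gam @ orient d w @ Del) C}"

lemma closureI:
  "(\<And>Gam Del C d. (\<And>x. x \<in> X \<Longrightarrow> HL_str (Gam @ orient d x @ Del) C) \<Longrightarrow>
     HL_str (Gam @ orient d w @ Del) C) \<Longrightarrow> w \<in> closure X"
  by (simp add: closure_def)

lemma closureD:
  "w \<in> closure X \<Longrightarrow> (\<And>x. x \<in> X \<Longrightarrow> HL_str (Gam @ orient d x @ Del) C) \<Longrightarrow>
     HL_str (Gam @ orient d w @ Del) C"
  by (simp add: closure_def)

text \<open>Divisions are residuals of concatenation. Without \<open>w \<noteq> []\<close> the empty
  list would lie in \<open>sem (LUnder A A)\<close>, against the nonempty antecedents of the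
  calculus. The product is closed explicitly, since a list such as the product letter itself need
  not split into members. As \<open>flip\<close> is an involution, \<open>LRev (LRev A)\<close> is
  interpreted like \<open>A\<close>.\<close>

primrec sem :: "'p ltp \<Rightarrow> ('p ltp \<times> bool) list set" where
  "sem (LPrim p) = {w. HL_str w (LPrim p)}"
| "sem (LUnder B A) = {w. w \<noteq> [] \<and> (\<forall>b \<in> sem B. b @ w \<in> sem A)}"
| "sem (LOver A B) = {w. w \<noteq> [] \<and> (\<forall>b \<in> sem B. w @ b \<in> sem A)}"
| "sem (LProd A B) = {w. w \<noteq> [] \<and> w \<in> closure {a @ b | a b. a \<in> sem A \<and> b \<in> sem B}}"
| "sem (LRev A) = {w. flip w \<in> sem A}"

lemma sem_nonempty: "w \<in> sem A \<Longrightarrow> w \<noteq> []"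
  by (induction A arbitrary: w) (use HL_str_nonempty in fastforce)+

text \<open>The list \<open>b\<close> is absorbed into the context; a reversed context receives it
  as \<open>flip b\<close> on the other side.\<close>

lemma closure_append_right:
  assumes w: "w \<in> closure X" and X: "\<And>x. x \<in> X \<Longrightarrow> x @ b \<in> Y"
  shows "w @ b \<in> closure Y"
proof (rule closureI)
  fix Gam Del C d assume Y: "\<And>y. y \<in> Y \<Longrightarrow> HL_str (Gam @ orient d y @ Del) C"
  show "HL_str (Gam @ orient d (w @ b) @ Del) C"
  proof (cases d)
    case True
    then show ?thesis
      using closureD[OF w, of "Gam @ flip b" True Del C] Y[OF X] by simp
  next
    case False
    then show ?thesis
      using closureD[OF w, of Gam False "b @ Del" C] Y[OF X] by simp
  qed
qed

lemma closure_append_left: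
  assumes w: "w \<in> closure X" and X: "\<And>x. x \<in> X \<Longrightarrow> b @ x \<in> Y"
  shows "b @ w \<in> closure Y"
proof (rule closureI)
  fix Gam Del C d assume Y: "\<And>y. y \<in> Y \<Longrightarrow> HL_str (Gam @ orient d y @ Del) C"
  show "HL_str (Gam @ orient d (b @ w) @ Del) C"
  proof (cases d)
    case True
    then show ?thesis
      using closureD[OF w, of Gam True "flip b @ Del" C] Y[OF X] by simp
  next
    case False
    then show ?thesis
      using closureD[OF w, of "Gam @ b" False Del C] Y[OF X] by simp
  qed
qed

text \<open>The sign quantified in \<open>closure\<close> exists for this: \<open>flip w\<close> in
  a context of sign \<open>d\<close> is \<open>w\<close> in the same context with the opposite
  sign.\<close>

lemma closure_flip:
  assumes w: "w \<in> closure X" and X: "\<And>x. x \<in> X \<Longrightarrow> flip x \<in> Y"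
  shows "flip w \<in> closure Y"
proof (rule closureI)
  fix Gam Del C d assume Y: "\<And>y. y \<in> Y \<Longrightarrow> HL_str (Gam @ orient d y @ Del) C"
  have o: "orient d (flip z) = orient (\<not> d) z" for z :: "('a ltp \<times> bool) list"
    by (cases d) simp_all
  show "HL_str (Gam @ orient d (flip w) @ Del) C"
    unfolding o
  proof (rule closureD[OF w])
    fix x assume "x \<in> X"
    from Y[OF X[OF this]] show "HL_str (Gam @ orient (\<not> d) x @ Del) C" unfolding o .
  qed
qed

text \<open>Primitive types are tested by the trivial context, residuals and reversal move their
  test into the context, and for the product closing twice is closing once. Thus HL left rules,
  which act inside any context, carry over to membership.\<close>

lemma sem_closed: "w \<in> closure (sem A) \<Longrightarrow> w \<noteq> [] \<Longrightarrow> w \<in> sem A"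
proof (induction A arbitrary: w)
  case (LPrim p)
  have "HL_str ([] @ orient False w @ []) (LPrim p)"
    by (rule closureD[OF LPrim(1)]) simp
  then show ?case by simp
next
  case (LUnder B A)
  have "b @ w \<in> sem A" if b: "b \<in> sem B" for b
  proof (rule LUnder.IH(2))
    show "b @ w \<in> closure (sem A)"
      by (rule closure_append_left[OF LUnder.prems(1)]) (simp add: b)
    show "b @ w \<noteq> []" using LUnder.prems(2) by simp
  qed
  then show ?case using LUnder.prems(2) by simp
next
  case (LOver A B)
  have "w @ b \<in> sem A" if b: "b \<in> sem B" for b
  proof (rule LOver.IH(1))
    show "w @ b \<in> closure (sem A)"
      by (rule closure_append_right[OF LOver.prems(1)]) (simp add: b)
    show "w @ b \<noteq> []" using LOver.prems(2) by simp
  qed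
  then show ?case using LOver.prems(2) by simp
next
  case (LProd A B)
  let ?X = "{a @ b | a b. a \<in> sem A \<and> b \<in> sem B}"
  have "w \<in> closure ?X"
  proof (rule closureI)
    fix Gam Del C d assume X: "\<And>x. x \<in> ?X \<Longrightarrow> HL_str (Gam @ orient d x @ Del) C"
    show "HL_str (Gam @ orient d w @ Del) C"
    proof (rule closureD[OF LProd.prems(1)])
      fix v assume "v \<in> sem (LProd A B)"
      then have "v \<in> closure ?X" by simp
      then show "HL_str (Gam @ orient d v @ Del) C" using X by (rule closureD)
    qed
  qed
  then show ?case using LProd.prems(2) by simp
next
  case (LRev A)
  have "flip w \<in> sem A"
  proof (rule LRev.IH)
    show "flip w \<in> closure (sem A)" by (rule closure_flip[OF LRev.prems(1)]) simp
    show "flip w \<noteq> []" using LRev.prems(2) by simp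
  qed
  then show ?case by simp
qed

text \<open>Okada's lemma. The halves need a joint induction: division is contravariant, so its
  membership half uses derivability for the argument type and its derivability half uses membership
  of the argument letter. Left rules give membership through closure, right rules give
  derivability.\<close>

lemma sem_atom: "[(A, False)] \<in> sem A \<and> (\<forall>w \<in> sem A. HL_str w A)"
proof (induction A)
  case (LPrim p)
  then show ?case using HL_str_prim by simp
next
  case (LUnder B A)
  have "b @ [(LUnder B A, False)] \<in> sem A" if "b \<in> sem B" for b
  proof (rule sem_closed)
    show "b @ [(LUnder B A, False)] \<in> closure (sem A)"
    proof (rule closureI)
      fix Gam Del C d assume "\<And>x. x \<in> sem A \<Longrightarrow> HL_str (Gam @ orient d x @ Del) C"
      from this[of "[(A, False)]"] show "HL_str (Gam @ orient d (b @ [(LUnder B A, False)]) @ Del) C"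
        using HL_str_underL[of b B Gam A d Del C] that LUnder by simp
    qed
  qed simp
  moreover have "HL_str w (LUnder B A)" if "w \<in> sem (LUnder B A)" for w
  proof -
    have "w \<noteq> []" "[(B, False)] @ w \<in> sem A" using that LUnder(1) by auto
    then show ?thesis using LUnder(2) by (intro HL_str_underR) auto
  qed
  ultimately show ?case by simp
next
  case (LOver A B)
  have "[(LOver A B, False)] @ b \<in> sem A" if "b \<in> sem B" for b
  proof (rule sem_closed)
    show "[(LOver A B, False)] @ b \<in> closure (sem A)"
    proof (rule closureI)
      fix Gam Del C d assume "\<And>x. x \<in> sem A \<Longrightarrow> HL_str (Gam @ orient d x @ Del) C"
      from this[of "[(A, False)]"] show "HL_str (Gam @ orient d ([(LOver A B, False)] @ b) @ Del) C"
        using HL_str_overL[of b B Gam A d Del C] that LOver by simp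
    qed
  qed simp
  moreover have "HL_str w (LOver A B)" if "w \<in> sem (LOver A B)" for w
  proof -
    have "w \<noteq> []" "w @ [(B, False)] \<in> sem A" using that LOver(2) by auto
    then show ?thesis using LOver(1) by (intro HL_str_overR) auto
  qed
  ultimately show ?case by simp
next
  case (LProd A B)
  let ?X = "{a @ b | a b. a \<in> sem A \<and> b \<in> sem B}"
  have "[(LProd A B, False)] \<in> closure ?X"
  proof (rule closureI)
    fix Gam Del C d assume "\<And>x. x \<in> ?X \<Longrightarrow> HL_str (Gam @ orient d x @ Del) C"
    moreover have "[(A, False)] @ [(B, False)] \<in> ?X" using LProd by blast
    ultimately have "HL_str (Gam @ orient d ([(A, False)] @ [(B, False)]) @ Del) C" by blast
    then show "HL_str (Gam @ orient d [(LProd A B, False)] @ Del) C"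
      using HL_str_prodL[of Gam d A B Del C] by simp
  qed
  moreover have "HL_str w (LProd A B)" if "w \<in> sem (LProd A B)" for w
  proof -
    have "w \<in> closure ?X" using that by simp
    then have "HL_str ([] @ orient False w @ []) (LProd A B)"
    proof (rule closureD)
      fix x assume "x \<in> ?X"
      then obtain a b where "x = a @ b" "a \<in> sem A" "b \<in> sem B" by blast
      then show "HL_str ([] @ orient False x @ []) (LProd A B)"
        using LProd HL_str_prodR[of a A b B] by simp
    qed
    then show ?thesis by simp
  qed
  ultimately show ?case by simp
next
  case (LRev A)
  have "[(A, True)] \<in> closure (sem (LRev A)) \<and> [(LRev A, True)] \<in> sem A"
  proof
    \<comment> \<open>Membership of \<open>[(LRev A, False)]\<close> in \<open>sem (LRev A)\<close>
      means that its flip \<open>[(LRev A, True)]\<close> lies in \<open>sem A\<close>. In any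
      context \<open>HL_str_revL\<close> exchanges a signed \<open>A\<close> for
      \<open>LRev A\<close> of the opposite sign.\<close>
    have "[(LRev A, True)] \<in> closure (sem A)"
    proof (rule closureI)
      fix Gam Del C d assume "\<And>x. x \<in> sem A \<Longrightarrow> HL_str (Gam @ orient d x @ Del) C"
      from this[of "[(A, False)]"] show "HL_str (Gam @ orient d [(LRev A, True)] @ Del) C"
        using HL_str_revL[of Gam A "\<not> d" Del C] LRev by (cases d) simp_all
    qed
    then show "[(LRev A, True)] \<in> sem A" by (rule sem_closed) simp
  qed (use LRev in \<open>simp add: closure_def\<close>)
  moreover have "HL_str w (LRev A)" if "w \<in> sem (LRev A)" for w
    using HL_str_revR[of "flip w" A] that LRev by simp
  ultimately show ?case by simp
qed

lemma sem_concat_nonempty: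
  assumes "list_all2 (\<lambda>w A. w \<in> sem A) ws Gam" "Gam \<noteq> []"
  shows "concat ws \<noteq> []"
proof -
  obtain A Gam' where "Gam = A # Gam'" using assms(2) by (cases Gam) blast
  then obtain w ws' where "ws = w # ws'" "w \<in> sem A"
    using assms(1) by (cases ws) auto
  then show ?thesis using sem_nonempty[of w A] by simp
qed

text \<open>The quantifier over \<open>ws\<close> turns cut into composition: the concatenation
  obtained for \<open>A\<close> serves as the member chosen for \<open>A\<close> in the other
  premise. The double reversal rules change nothing, and \<open>prodL\<close> is where the
  conclusion has to be extended by closure.\<close>

lemma LR_der_sem:
  "LR_der Gam C \<Longrightarrow> list_all2 (\<lambda>w A. w \<in> sem A) ws Gam \<Longrightarrow> concat ws \<in> sem C"
proof (induction arbitrary: ws rule: LR_der.induct)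
  case (ax p)
  from ax.prems show ?case by (auto simp: list_all2_Cons2)
next
  case (underL Pi A Gam B Del C)
  from underL.prems obtain us ps w vs where ws: "ws = us @ ps @ w # vs" "list_all2 (\<lambda>w A. w \<in> sem A) us Gam"
    "list_all2 (\<lambda>w A. w \<in> sem A) ps Pi" "w \<in> sem (LUnder A B)" "list_all2 (\<lambda>w A. w \<in> sem A) vs Del"
    by (auto simp: list_all2_append2 list_all2_Cons2)
  have "concat ps @ w \<in> sem B" using ws(4) underL.IH(1)[OF ws(3)] by simp
  then have "list_all2 (\<lambda>w A. w \<in> sem A) (us @ [concat ps @ w] @ vs) (Gam @ [B] @ Del)"
    using ws by (simp add: list_all2_appendI)
  from underL.IH(2)[OF this] show ?case using ws(1) by simp
next
  case (underR Pi A B)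
  have "concat ws \<noteq> []" using underR.prems underR.hyps(1) by (rule sem_concat_nonempty)
  moreover have "a @ concat ws \<in> sem B" if "a \<in> sem A" for a
    using underR.IH[of "a # ws"] that underR.prems by simp
  ultimately show ?case by simp
next
  case (prodL Gam A B Del C)
  from prodL.prems obtain us w vs where ws: "ws = us @ w # vs" "list_all2 (\<lambda>w A. w \<in> sem A) us Gam"
    "w \<in> sem (LProd A B)" "list_all2 (\<lambda>w A. w \<in> sem A) vs Del"
    by (auto simp: list_all2_append2 list_all2_Cons2)
  let ?X = "{a @ b | a b. a \<in> sem A \<and> b \<in> sem B}"
  have X: "concat us @ x @ concat vs \<in> sem C" if x: "x \<in> ?X" for x
  proof -
    obtain a b where ab: "x = a @ b" "a \<in> sem A" "b \<in> sem B" using x by blast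
    then have "list_all2 (\<lambda>w A. w \<in> sem A) (us @ [a, b] @ vs) (Gam @ [A, B] @ Del)"
      using ws by (simp add: list_all2_appendI)
    from prodL.IH[OF this] show ?thesis using ab by simp
  qed
  have "w \<in> closure ?X" using ws(3) by simp
  \<comment> \<open>The claim holds for the lists in \<open>?X\<close>, which split. It extends to
    \<open>w\<close>, which need not split, because \<open>sem C\<close> is closed.\<close>
  then have "concat us @ w \<in> closure {concat us @ x | x. x \<in> ?X}"
    by (rule closure_append_left) blast
  then have "(concat us @ w) @ concat vs \<in> closure (sem C)"
  proof (rule closure_append_right)
    fix y assume "y \<in> {concat us @ x | x. x \<in> ?X}"
    then obtain x where x: "x \<in> ?X" "y = concat us @ x" by blast
    show "y @ concat vs \<in> sem C" using X[OF x(1)] x(2) by simp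
  qed
  then show ?case using sem_closed[of _ C] sem_nonempty[OF ws(3)] ws(1) by simp
next
  case (overL Pi A Gam B Del C)
  from overL.prems obtain us w ps vs where ws: "ws = us @ w # ps @ vs" "list_all2 (\<lambda>w A. w \<in> sem A) us Gam"
    "list_all2 (\<lambda>w A. w \<in> sem A) ps Pi" "w \<in> sem (LOver B A)" "list_all2 (\<lambda>w A. w \<in> sem A) vs Del"
    by (auto simp: list_all2_append2 list_all2_Cons2)
  have "w @ concat ps \<in> sem B" using ws(4) overL.IH(1)[OF ws(3)] by simp
  then have "list_all2 (\<lambda>w A. w \<in> sem A) (us @ [w @ concat ps] @ vs) (Gam @ [B] @ Del)"
    using ws by (simp add: list_all2_appendI)
  from overL.IH(2)[OF this] show ?case using ws(1) by simp
next
  case (overR Pi A B)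
  have "concat ws \<noteq> []" using overR.prems overR.hyps(1) by (rule sem_concat_nonempty)
  moreover have "concat ws @ a \<in> sem B" if "a \<in> sem A" for a
    using overR.IH[of "ws @ [a]"] that overR.prems by (simp add: list_all2_appendI)
  ultimately show ?case by simp
next
  case (prodR Pi Psi A B)
  from prodR.prems obtain us vs where ws: "ws = us @ vs" "list_all2 (\<lambda>w A. w \<in> sem A) us Pi"
    "list_all2 (\<lambda>w A. w \<in> sem A) vs Psi"
    by (auto simp: list_all2_append2)
  have a: "concat us \<in> sem A" and b: "concat vs \<in> sem B"
    by (rule prodR.IH(1)[OF ws(2)], rule prodR.IH(2)[OF ws(3)])
  have "concat us @ concat vs \<in> closure {a @ b | a b. a \<in> sem A \<and> b \<in> sem B}"
    using a b by (intro closureI) blast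
  then show ?case using sem_nonempty[OF a] ws(1) by simp
next
  case (revR Gam C)
  have "list_all2 (\<lambda>w A. w \<in> sem A) (map flip (rev ws)) Gam"
    using revR.prems by (simp add: rev_map list_all2_map1 list_all2_map2 list_all2_rev1)
  from revR.IH[OF this] have "concat (map flip (rev ws)) \<in> sem C" .
  moreover have "flip (concat ws) = concat (map flip (rev ws))"
    by (induction ws) simp_all
  ultimately show ?case by simp
next
  case (rrL Gam A Del C)
  from rrL.prems obtain us w vs where ws: "ws = us @ w # vs" "list_all2 (\<lambda>w A. w \<in> sem A) us Gam"
    "w \<in> sem A" "list_all2 (\<lambda>w A. w \<in> sem A) vs Del"
    by (auto simp: list_all2_append2 list_all2_Cons2)
  then have "list_all2 (\<lambda>w A. w \<in> sem A) ws (Gam @ [LRev (LRev A)] @ Del)"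
    by (simp add: list_all2_appendI)
  then show ?case by (rule rrL.IH)
next
  case (rrR Pi C)
  from rrR.IH[OF rrR.prems] show ?case by simp
next
  case (cut Pi A Gam Del B)
  from cut.prems obtain us ps vs where ws: "ws = us @ ps @ vs" "list_all2 (\<lambda>w A. w \<in> sem A) us Gam"
    "list_all2 (\<lambda>w A. w \<in> sem A) ps Pi" "list_all2 (\<lambda>w A. w \<in> sem A) vs Del"
    by (auto simp: list_all2_append2)
  then have "list_all2 (\<lambda>w A. w \<in> sem A) (us @ [concat ps] @ vs) (Gam @ [A] @ Del)"
    using cut.IH(1)[OF ws(3)] by (simp add: list_all2_appendI)
  from cut.IH(2)[OF this] show ?case using ws(1) by simp
qed

text \<open>One-letter lists are the canonical members to choose; \<open>sem_atom\<close> supplies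
  them and turns the resulting membership back into a derivation.\<close>

lemma LR_der_imp_HL_str:
  assumes "LR_der Gam C"
  shows "HL_str (map (\<lambda>A. (A, False)) Gam) C"
proof -
  have "list_all2 (\<lambda>w A. w \<in> sem A) (map (\<lambda>A. [(A, False)]) Gam) Gam"
    by (simp add: list_all2_map1 list_all2_same sem_atom)
  from LR_der_sem[OF assms this] have "concat (map (\<lambda>A. [(A, False)]) Gam) \<in> sem C" .
  moreover have "concat (map (\<lambda>A. [(A, False)]) Gam) = map (\<lambda>A. (A, False)) Gam"
    by (induction Gam) simp_all
  ultimately show ?thesis using sem_atom[of C] by simp
qed

theorem theorem10:
  shows "(\<forall>(Gam :: 'p ltp list) C. Gam \<noteq> [] \<longrightarrow>
            (LR_der Gam C \<longleftrightarrow> HL_der (fst (trR_seq Gam C)) (snd (trR_seq Gam C))))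
       \<and> (\<forall>(G :: 'p htp hgraph) T.
            HL_der G T \<and> (\<forall>i < length (gE G). \<exists>B. tp_eq (lab G i) (trR B)) \<and> (\<exists>B. tp_eq T (trR B))
            \<longrightarrow> (\<exists>Gam C. seq_mem (G, T) (trR' Gam C) \<and> LR_der Gam C))"
proof (intro conjI allI impI)
  fix Gam :: "'p ltp list" and C
  let ?xs = "map (\<lambda>A. (trR A, False)) Gam"
  have xs: "?xs = map (apfst trR) (map (\<lambda>A. (A, False)) Gam)" by simp
  show "LR_der Gam C \<longleftrightarrow> HL_der (fst (trR_seq Gam C)) (snd (trR_seq Gam C))"
  proof
    assume "LR_der Gam C"
    then show "HL_der (fst (trR_seq Gam C)) (snd (trR_seq Gam C))"
      using LR_der_imp_HL_str unfolding trR_seq_def fst_conv snd_conv xs HL_str_def by blast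
  next
    assume "HL_der (fst (trR_seq Gam C)) (snd (trR_seq Gam C))"
    then have der: "HL_der (genstr ?xs) (trR C)" by (simp add: trR_seq_def)
    have "translated l" if "l \<in> fst ` set (gE (genstr ?xs))" for l
      using that unfolding string_graph_labels[OF string_graph_genstr] by auto
    from HL_der_imp_LR_der[OF der this translated_trR] obtain ys
      where ys: "string_graph (genstr ?xs) ys" "LR_der (brks (map (apfst untr) ys)) (untr (trR C))"
      by blast
    \<comment> \<open>Uniqueness forces the signs to be the positive ones of the translation, so
      \<open>brks\<close> adds no reversal.\<close>
    have "ys = ?xs" using string_graph_unique[OF ys(1) string_graph_genstr] .
    then have "brks (map (apfst untr) ys) = Gam" by (simp add: comp_def brk_def)
    then show "LR_der Gam C" using ys(2) by simp
  qed
next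
  fix G :: "'p htp hgraph" and T
  assume asm: "HL_der G T \<and> (\<forall>i < length (gE G). \<exists>B. tp_eq (lab G i) (trR B)) \<and> (\<exists>B. tp_eq T (trR B))"
  have wf: "wf_tp T" "wf_hgraph htp_ok G" using HL_der_wf asm by (auto simp: hseq_wf_def)
  \<comment> \<open>The hypothesis states \<open>tp_eq\<close> in the direction opposite to
    \<open>translated\<close>; well-formedness allows the exchange.\<close>
  have T: "translated T" using asm tp_eq_sym[OF _ wf(1)] by (auto simp: translated_def)
  have lab: "translated l" if l: "l \<in> fst ` set (gE G)" for l
  proof -
    obtain i where "i < length (gE G)" "l = lab G i" using l unfolding gE_labels by blast
    then obtain B where "tp_eq l (trR B)" using asm by blast
    moreover have "wf_tp l" using l wf(2) by (auto simp: wf_hgraph_def)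
    ultimately show ?thesis using tp_eq_sym unfolding translated_def by blast
  qed
  obtain xs where xs: "string_graph G xs" "LR_der (brks (map (apfst untr) xs)) (untr T)"
    using HL_der_imp_LR_der[OF _ lab T] asm by blast
  \<comment> \<open>The signs of the walk serve as the exponents \<delta>, the untranslated labels
    as the types B, and \<open>brks\<close> joins them into the antecedent.\<close>
  let ?Bs = "map (untr \<circ> fst) xs" and ?ds = "map snd xs"
  let ?Gam = "brks (map (apfst untr) xs)" and ?S = "genstr (zip (map trR ?Bs) ?ds)"
  have zip: "zip (map trR ?Bs) ?ds = map (apfst (trR \<circ> untr)) xs"
    by (induction xs) auto
  have "list_all2 (rel_prod tp_eq (=)) (map (apfst (trR \<circ> untr)) xs) xs"
    unfolding list.rel_map
    by (rule list.rel_refl_strong)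
      (use lab string_graph_labels[OF xs(1)] translated_untr in \<open>force simp: rel_prod_sel\<close>)
  then have "graph_iso tp_eq ?S G"
    unfolding zip using graph_iso_string_graph[OF string_graph_genstr xs(1)] by blast
  moreover have "(?S, trR (untr T)) \<in> trR' ?Gam (untr T)"
    unfolding trR'_def
    by (rule CollectI, rule exI[of _ ?Bs], rule exI[of _ ?ds]) (auto simp: split_beta)
  ultimately have "seq_mem (G, T) (trR' ?Gam (untr T))"
    using translated_untr[OF T] unfolding seq_mem_def by force
  then show "\<exists>Gam C. seq_mem (G, T) (trR' Gam C) \<and> LR_der Gam C" using xs(2) by blast
qed

end
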